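(* Let $\mathcal{O}$ be a Euclidean oriented matroid on $E$ and let $\mathcal{O}'=\mathcal{O}[e_1^{\alpha_1},\dots,e_k^{\alpha_k}]$ be any lexicographic extension of $\mathcal{O}$ ($[e_1,\dots,e_k]$ an ordered subset of $E$, $\alpha\in\{+,-\}^k$). Then $\mathcal{O}'$ is Euclidean.
   Context: Let $\mathcal{O}$ be an oriented matroid of rank $r$ on a finite ground set $E$, given by its set of cocircuits (sign vectors in $\{+,-,0\}^E$). For sign vectors $X,Y$: $\operatorname{supp}(X)=\{e:X_e\neq 0\}$, $z(X)=E\setminus\operatorname{supp}(X)$, $\operatorname{sep}(X,Y)=\{e: X_e=-Y_e\neq 0\}$, $(X\circ Y)_e=X_e$ if $X_e\neq 0$ and $(X\circ Y)_e=Y_e$ otherwise; $X,Y$ are conformal if $\operatorname{sep}(X,Y)=\emptyset$. An edge is a covector $F$ whose zero set $z(F)$ is a flat of rank $r-2$ of the underlying matroid. Two cocircuits $X\neq\pm Y$ are comodular if $X\circ Y$ is an edge. For comodular cocircuits $X,Y$ and $e\in\operatorname{sep}(X,Y)$ there is a unique cocircuit $Z$ with $Z_e=0$ and $Z_h=(X\circ Y)_h$ for all $h\notin\operatorname{sep}(X,Y)$ ("cocircuit elimination of $e$ between $X$ and $Y$"). An oriented matroid program is a triple $(\mathcal{O},g,f)$ with $g\neq f\in E$, $g$ not a loop, $f$ not a coloop. For comodular cocircuits $X,Y$ with $X_g=Y_g\neq 0$ let $Z$ be obtained by eliminating $g$ between $-X$ and $Y$; write $X\to_{g,f}Y$ if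 $Z_f=+$, $X\leftarrow_{g,f}Y$ if $Z_f=-$, and $X\leftrightarrow_{g,f}Y$ if $Z_f=0$. The cocircuit graph $G_f$ of $(\mathcal{O},g,f)$ has as vertices the cocircuits $X$ with $X_g=+$ and as edges the pairs of conformal comodular such cocircuits, oriented as described. A directed cycle in $G_f$ is a sequence $P^1,\dots,P^n=P^1$ of vertices with $P^1,\dots,P^{n-1}$ pairwise distinct, $\{P^i,P^{i+1}\}$ an edge, $P^i\to P^{i+1}$ or $P^i\leftrightarrow P^{i+1}$ for all $i$, and $P^i\to P^{i+1}$ for at least one $i$. The program is Euclidean if $G_f$ has no directed cycle. An oriented matroid is Euclidean if every oriented matroid program on it is Euclidean. A single-element extension $\mathcal{O}\cup p$ is determined by a localization $\sigma$ from cocircuits of $\mathcal{O}$ to $\{+,-,0\}$. For an ordered subset $I=[e_1,\dots,e_k]$ of $E$, the index of a cocircuit $Y$ w.r.t. $I$ is the smallest $i$ with $Y_{e_i}\neq 0$, or $k+1$ if none. For $\alpha\in\{+,-\}^k$ the lexicographic extension $\mathcal{O}[e_1^{\alpha_1},\dots,e_k^{\alpha_k}]=\mathcal{O}\cup p$ is the single-element extension with localization $\sigma(Y)=\alpha_iY_{e_i}$ if the index $i$ of $Y$ is $\le k$, and $\sigma(Y)=0$ otherwise. *)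

theory Defs
  imports Main
begin

datatype sign = Neg | Zero | Pos

fun sneg :: "sign \<Rightarrow> sign" where
  "sneg Pos = Neg" | "sneg Neg = Pos" | "sneg Zero = Zero"

fun smult :: "sign \<Rightarrow> sign \<Rightarrow> sign" where
  "smult Zero _ = Zero" | "smult _ Zero = Zero"
| "smult Pos s = s" | "smult Neg s = sneg s"

type_synonym 'a svec = "'a \<Rightarrow> sign"

definition zerovec :: "'a svec" where "zerovec = (\<lambda>_. Zero)"

definition negv :: "'a svec \<Rightarrow> 'a svec" where "negv X = (\<lambda>e. sneg (X e))"

definition supp :: "'a svec \<Rightarrow> 'a set" where "supp X = {e. X e \<noteq> Zero}"

definition zset :: "'a set \<Rightarrow> 'a svec \<Rightarrow> 'a set" where "zset E X = E - supp X"

definition sep :: "'a svec \<Rightarrow> 'a svec \<Rightarrow> 'a set" where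
  "sep X Y = {e. X e \<noteq> Zero \<and> X e = sneg (Y e)}"

definition comp :: "'a svec \<Rightarrow> 'a svec \<Rightarrow> 'a svec" where
  "comp X Y = (\<lambda>e. if X e \<noteq> Zero then X e else Y e)"

definition conformal :: "'a svec \<Rightarrow> 'a svec \<Rightarrow> bool" where
  "conformal X Y \<longleftrightarrow> sep X Y = {}"

text \<open>C is the set of cocircuits of an oriented matroid on the finite ground set E
  (sign vectors vanish outside E).\<close>
definition OM :: "'a set \<Rightarrow> 'a svec set \<Rightarrow> bool" where
  "OM E C \<longleftrightarrow> finite E
    \<and> (\<forall>X\<in>C. supp X \<subseteq> E)
    \<and> zerovec \<notin> C
    \<and> (\<forall>X\<in>C. negv X \<in> C)
    \<and> (\<forall>X\<in>C. \<forall>Y\<in>C. supp X \<subseteq> supp Y \<longrightarrow> X = Y \<or> X = negv Y)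
    \<and> (\<forall>X\<in>C. \<forall>Y\<in>C. X \<noteq> negv Y \<longrightarrow> (\<forall>e\<in>sep X Y. \<exists>Z\<in>C. Z e = Zero
          \<and> (\<forall>h. Z h = Pos \<longrightarrow> X h = Pos \<or> Y h = Pos)
          \<and> (\<forall>h. Z h = Neg \<longrightarrow> X h = Neg \<or> Y h = Neg)))"

inductive_set covectors :: "'a svec set \<Rightarrow> 'a svec set" for C where
  zero: "zerovec \<in> covectors C"
| compose: "X \<in> covectors C \<Longrightarrow> Y \<in> C \<Longrightarrow> comp X Y \<in> covectors C"

section \<open>The underlying matroid (given by its cocircuits = supports of cocircuits)\<close>

definition hyperplanes :: "'a set \<Rightarrow> 'a svec set \<Rightarrow> 'a set set" where
  "hyperplanes E C = {E - supp X | X. X \<in> C}"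

definition flat :: "'a set \<Rightarrow> 'a svec set \<Rightarrow> 'a set \<Rightarrow> bool" where
  "flat E C F \<longleftrightarrow> (\<exists>S. S \<subseteq> hyperplanes E C \<and> F = E \<inter> \<Inter>S)"

definition mclosure :: "'a set \<Rightarrow> 'a svec set \<Rightarrow> 'a set \<Rightarrow> 'a set" where
  "mclosure E C A = E \<inter> \<Inter>{F. flat E C F \<and> A \<subseteq> F}"

definition mindep :: "'a set \<Rightarrow> 'a svec set \<Rightarrow> 'a set \<Rightarrow> bool" where
  "mindep E C I \<longleftrightarrow> I \<subseteq> E \<and> (\<forall>e\<in>I. e \<notin> mclosure E C (I - {e}))"

definition mrank :: "'a set \<Rightarrow> 'a svec set \<Rightarrow> 'a set \<Rightarrow> nat" where
  "mrank E C A = Max (card ` {I. I \<subseteq> A \<and> mindep E C I})"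

definition omrank :: "'a set \<Rightarrow> 'a svec set \<Rightarrow> nat" where
  "omrank E C = mrank E C E"

definition is_loop :: "'a svec set \<Rightarrow> 'a \<Rightarrow> bool" where
  "is_loop C e \<longleftrightarrow> (\<forall>X\<in>C. X e = Zero)"

definition is_coloop :: "'a svec set \<Rightarrow> 'a \<Rightarrow> bool" where
  "is_coloop C e \<longleftrightarrow> (\<exists>X\<in>C. supp X = {e})"

definition is_edge :: "'a set \<Rightarrow> 'a svec set \<Rightarrow> 'a svec \<Rightarrow> bool" where
  "is_edge E C F \<longleftrightarrow> F \<in> covectors C \<and> flat E C (zset E F)
     \<and> mrank E C (zset E F) + 2 = omrank E C"

definition comodular :: "'a set \<Rightarrow> 'a svec set \<Rightarrow> 'a svec \<Rightarrow> 'a svec \<Rightarrow> bool" where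
  "comodular E C X Y \<longleftrightarrow> X \<in> C \<and> Y \<in> C \<and> X \<noteq> Y \<and> X \<noteq> negv Y \<and> is_edge E C (comp X Y)"

text \<open>Cocircuit elimination of e between comodular X and Y (the unique such cocircuit).\<close>
definition elim :: "'a svec set \<Rightarrow> 'a svec \<Rightarrow> 'a svec \<Rightarrow> 'a \<Rightarrow> 'a svec" where
  "elim C X Y e = (THE Z. Z \<in> C \<and> Z e = Zero \<and> (\<forall>h. h \<notin> sep X Y \<longrightarrow> Z h = comp X Y h))"

definition is_program :: "'a set \<Rightarrow> 'a svec set \<Rightarrow> 'a \<Rightarrow> 'a \<Rightarrow> bool" where
  "is_program E C g f \<longleftrightarrow> OM E C \<and> g \<in> E \<and> f \<in> E \<and> g \<noteq> f
     \<and> \<not> is_loop C g \<and> \<not> is_coloop C f"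

text \<open>orientation sign: Pos means X -> Y, Neg means X <- Y, Zero means X <-> Y\<close>
definition arrow_sign :: "'a svec set \<Rightarrow> 'a \<Rightarrow> 'a \<Rightarrow> 'a svec \<Rightarrow> 'a svec \<Rightarrow> sign" where
  "arrow_sign C g f X Y = elim C (negv X) Y g f"

definition cg_vertex :: "'a svec set \<Rightarrow> 'a \<Rightarrow> 'a svec \<Rightarrow> bool" where
  "cg_vertex C g X \<longleftrightarrow> X \<in> C \<and> X g = Pos"

definition cg_edge :: "'a set \<Rightarrow> 'a svec set \<Rightarrow> 'a \<Rightarrow> 'a svec \<Rightarrow> 'a svec \<Rightarrow> bool" where
  "cg_edge E C g X Y \<longleftrightarrow> cg_vertex C g X \<and> cg_vertex C g Y \<and> conformal X Y \<and> comodular E C X Y"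

definition directed_cycle ::
  "'a set \<Rightarrow> 'a svec set \<Rightarrow> 'a \<Rightarrow> 'a \<Rightarrow> (nat \<Rightarrow> 'a svec) \<Rightarrow> nat \<Rightarrow> bool" where
  "directed_cycle E C g f P n \<longleftrightarrow> 2 \<le> n \<and> P n = P 1 \<and> inj_on P {1..n-1}
     \<and> (\<forall>i\<in>{1..<n}. cg_edge E C g (P i) (P (Suc i))
           \<and> arrow_sign C g f (P i) (P (Suc i)) \<in> {Pos, Zero})
     \<and> (\<exists>i\<in>{1..<n}. arrow_sign C g f (P i) (P (Suc i)) = Pos)"

definition euclidean_program :: "'a set \<Rightarrow> 'a svec set \<Rightarrow> 'a \<Rightarrow> 'a \<Rightarrow> bool" where
  "euclidean_program E C g f \<longleftrightarrow> \<not> (\<exists>P n. directed_cycle E C g f P n)"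

definition euclidean_OM :: "'a set \<Rightarrow> 'a svec set \<Rightarrow> bool" where
  "euclidean_OM E C \<longleftrightarrow> OM E C
     \<and> (\<forall>g f. is_program E C g f \<longrightarrow> euclidean_program E C g f)"

definition deletion :: "'a svec set \<Rightarrow> 'a \<Rightarrow> 'a svec set" where
  "deletion C' p = (let R = (\<lambda>Y. Y(p := Zero)) ` C' in
     {X\<in>R. X \<noteq> zerovec \<and> \<not> (\<exists>Z\<in>R. Z \<noteq> zerovec \<and> supp Z \<subset> supp X)})"

definition single_elem_ext ::
  "'a set \<Rightarrow> 'a svec set \<Rightarrow> 'a \<Rightarrow> ('a svec \<Rightarrow> sign) \<Rightarrow> 'a svec set \<Rightarrow> bool" where
  "single_elem_ext E C p \<sigma> C' \<longleftrightarrow> p \<notin> E \<and> OM (insert p E) C'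
     \<and> deletion C' p = C \<and> (\<forall>Y\<in>C. Y(p := \<sigma> Y) \<in> C')"

fun lex_sigma :: "'a list \<Rightarrow> sign list \<Rightarrow> 'a svec \<Rightarrow> sign" where
  "lex_sigma (e # es) (a # as) Y = (if Y e \<noteq> Zero then smult a (Y e) else lex_sigma es as Y)"
| "lex_sigma _ _ Y = Zero"

end

theory Submission
  imports Defs
begin

text \<open>
  Write the extension as \<open>C'\<close> on \<open>E \<union> {p}\<close> and call cocircuits points and
      flats of corank two
  lines. A program \<open>(g, f)\<close> is Euclidean iff no edge of positive direction lies on a closed walk
  of comodular points all of whose directions are nonnegative; conformality is irrelevant.
  Reversing a walk exchanges the roles of \<open>g\<close> and \<open>f\<close>, and on a closed walk the
      sign of \<open>f\<close> is
  constant, so the vertices may be assumed to have \<open>g\<close> and \<open>f\<close> nonzero.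

  If \<open>f = p\<close> or \<open>g = p\<close>, all vertices are old and the direction of
      \<open>p\<close> is that of the first
  nonvanishing \<open>e\<^sub>i\<close>; the Euclidean programs \<open>(g, e\<^sub>1), (g, e\<^sub>2),
      \<dots>\<close> of the old oriented matroid
  successively show that all these directions vanish.

  If \<open>g\<close> and \<open>f\<close> are old, new points are removed by downward induction on
      \<open>m\<close>: at level \<open>m\<close> only
  those new points and lines are allowed that contain \<open>e\<^sub>1, \<dots>, e\<^sub>m\<close>. A point
      \<open>P\<close> that is new at level
  \<open>m - 1\<close> but not allowed at level \<open>m\<close> is infinitesimally close to the old point
      \<open>X\<close> in which its old
  line meets \<open>e = e\<^sub>m\<close>. Moving all such points to their neighbours gives a closed walk
      at level \<open>m\<close>,
  so to first order all heights agree. The sign of the infinitesimal change of height from \<open>X\<close>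
  to \<open>P\<close> is then monotone, hence constant on the walk. If it is nonzero, the walk lies in
      \<open>p\<close>; up to
  a constant sign this change of height is the product of \<open>f/e\<close> in the direction from
      \<open>X\<close> to \<open>P\<close> and
  of \<open>p/g\<close> in \<open>X\<close>, and the programs \<open>(e, f)\<close>, \<open>(g, p)\<close>
      and \<open>(e, p)\<close> show that it does not change.
\<close>

section \<open>Signs\<close>

text \<open>A vertex has the height f/g, but heights are compared only along lines, through the sign
  of f at the point \<open>dif\<close> where g vanishes. Every argument on closed walks then rests
  on signs that can only move one way. Three obstacles shape the level step. The neighbour of a new
  point may have g = 0, so heights live on the closed quadrant \<open>quad\<close>, infinity
  included; this end is treated by exchanging g and f. The neighbour may have g = f = 0 and no
  height at all; then g and f are proportional along the old line of the point, and another point of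
  that line can stand in for it. Finally, two cocircuits of a rank three contraction need not lie on
  a common line, unlike two points of a realization. An edge is therefore replaced by a path of
  three arcs through auxiliary points, only the middle one of which may change the height.\<close>

text \<open>Hyperaddition on the sign hyperfield: \<^term>\<open>ssum a b c\<close> says that
    \<^term>\<open>c\<close> is a possible
  sign of a sum of two numbers of signs \<^term>\<open>a\<close> and \<^term>\<open>b\<close>.\<close>

definition ssum :: "sign \<Rightarrow> sign \<Rightarrow> sign \<Rightarrow> bool" where
  "ssum a b c \<longleftrightarrow> (a = Zero \<longrightarrow> c = b) \<and> (b = Zero \<longrightarrow> c
      = a) \<and> (a = b \<longrightarrow> c = a)"

lemma smult_Zero_right [simp]: "smult a Zero = Zero"
  by (cases a) auto

lemma smult_Pos_right [simp]: "smult a Pos = a"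
  by (cases a) auto

lemma smult_Pos_left [simp]: "smult Pos a = a"
  by (cases a) auto

lemma smult_Neg_left [simp]: "smult Neg a = sneg a"
  by (cases a) auto

lemma smult_Neg_right [simp]: "smult a Neg = sneg a"
  by (cases a) auto

lemma sneg_sneg [simp]: "sneg (sneg a) = a"
  by (cases a) auto

lemma sneg_eq_iff [simp]:
  "sneg a = Zero \<longleftrightarrow> a = Zero" "sneg a = Pos \<longleftrightarrow> a = Neg" "sneg a = Neg
      \<longleftrightarrow> a = Pos"
  "Zero = sneg a \<longleftrightarrow> a = Zero"
  by (cases a; auto)+

lemma sneg_inject [simp]: "sneg a = sneg b \<longleftrightarrow> a = b"
  by (cases a; cases b) auto

lemma sneg_eq_self [simp]: "sneg a = a \<longleftrightarrow> a = Zero" "a = sneg a \<longleftrightarrow> a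
    = Zero"
  by (cases a; auto)+

lemma smult_eq_Zero [simp]: "smult a b = Zero \<longleftrightarrow> a = Zero \<or> b = Zero"
  by (cases a; cases b) auto

lemma smult_assoc: "smult (smult a b) c = smult a (smult b c)"
  by (cases a; cases b; cases c) auto

lemma smult_sneg [simp]: "smult (sneg a) b = sneg (smult a b)" "smult a (sneg b) = sneg (smult a b)"
  by (cases a; cases b; auto)+

lemma smult_self: "a \<noteq> Zero \<Longrightarrow> smult a (smult a b) = b"
  by (cases a; cases b) auto

lemma ssum_Zero [simp]: "ssum Zero b c \<longleftrightarrow> c = b" "ssum a Zero c \<longleftrightarrow> c = a"
  by (cases a; cases b; auto simp: ssum_def)+

lemma ssum_scale: "ssum a b c \<Longrightarrow> ssum (smult t a) (smult t b) (smult t c)"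
  by (cases a; cases b; cases c; cases t) (auto simp: ssum_def)

lemma ssum_commute: "ssum a b c \<longleftrightarrow> ssum b a c"
  by (auto simp: ssum_def)

text \<open>A pair of an element and a sign is a reoriented element. This permits normalising the
  vertices of a program to the value \<open>Pos\<close> on both of its elements.\<close>

definition ev :: "'a \<times> sign \<Rightarrow> 'a svec \<Rightarrow> sign" where
  "ev G X = smult (snd G) (X (fst G))"

lemma ev_negv [simp]: "ev G (negv X) = sneg (ev G X)"
  by (simp add: ev_def negv_def)

lemma ev_eq_Zero: "snd G \<noteq> Zero \<Longrightarrow> ev G X = Zero \<longleftrightarrow> X (fst G) = Zero"
  by (simp add: ev_def)

lemma negv_negv [simp]: "negv (negv X) = X"
  by (simp add: negv_def)

lemma negv_apply [simp]: "negv X h = sneg (X h)"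
  by (simp add: negv_def)

lemma zerovec_apply [simp]: "zerovec h = Zero"
  by (simp add: zerovec_def)

lemma negv_zerovec [simp]: "negv zerovec = zerovec"
  by (simp add: negv_def zerovec_def)

lemma supp_negv [simp]: "supp (negv X) = supp X"
  by (simp add: supp_def)

section \<open>Matroid closure and rank\<close>

locale oriented_matroid =
  fixes E :: "'a set" and C :: "'a svec set"
  assumes om: "OM E C"
begin

abbreviation z :: "'a svec \<Rightarrow> 'a set" where "z X \<equiv> zset E X"

lemma finE: "finite E"
  using om by (simp add: OM_def)

lemma supp_E: "X \<in> C \<Longrightarrow> supp X \<subseteq> E"
  using om by (simp add: OM_def)

lemma outside: "X \<in> C \<Longrightarrow> h \<notin> E \<Longrightarrow> X h = Zero"
  using supp_E by (auto simp: supp_def)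

lemma negv_C: "X \<in> C \<Longrightarrow> negv X \<in> C"
  using om by (simp add: OM_def)

lemma zerovec_notin: "zerovec \<notin> C"
  using om by (simp add: OM_def)

lemma supp_subset_eq: "X \<in> C \<Longrightarrow> Y \<in> C \<Longrightarrow> supp X \<subseteq> supp Y
    \<Longrightarrow> X = Y \<or> X = negv Y"
  using om by (simp add: OM_def)

lemma weak_elim:
  assumes "X \<in> C" "Y \<in> C" "X \<noteq> negv Y" "e \<in> sep X Y"
  shows "\<exists>Z\<in>C. Z e = Zero \<and> (\<forall>h. Z h = Zero \<or> Z h = X h \<or> Z h = Y h)"
proof -
  obtain Z where Z: "Z\<in>C" "Z e = Zero"
       "\<forall>h. Z h = Pos \<longrightarrow> X h = Pos \<or> Y h = Pos"
       "\<forall>h. Z h = Neg \<longrightarrow> X h = Neg \<or> Y h = Neg"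
  proof -
    have "\<forall>X\<in>C. \<forall>Y\<in>C. X \<noteq> negv Y \<longrightarrow> (\<forall>e\<in>sep X Y.
        \<exists>Z\<in>C. Z e = Zero
          \<and> (\<forall>h. Z h = Pos \<longrightarrow> X h = Pos \<or> Y h = Pos)
          \<and> (\<forall>h. Z h = Neg \<longrightarrow> X h = Neg \<or> Y h = Neg))"
      using om unfolding OM_def by (elim conjE)
    from this[rule_format, OF assms] show thesis using that by (elim bexE conjE)
  qed
  have "Z h = Zero \<or> Z h = X h \<or> Z h = Y h" for h
    using Z(3,4) by (cases "Z h") auto
  then show ?thesis using Z(1,2) by blast
qed

lemma z_sub: "z X \<subseteq> E"
  by (auto simp: zset_def)

lemma in_z: "h \<in> z X \<longleftrightarrow> h \<in> E \<and> X h = Zero"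
  by (auto simp: zset_def supp_def)

lemma z_negv [simp]: "z (negv X) = z X"
  by (simp add: zset_def)

lemma z_supp: "X \<in> C \<Longrightarrow> Y \<in> C \<Longrightarrow> z X \<subseteq> z Y
    \<longleftrightarrow> supp Y \<subseteq> supp X"
  using supp_E by (auto simp: zset_def)

lemma z_subset_eq: "X \<in> C \<Longrightarrow> Y \<in> C \<Longrightarrow> z X \<subseteq> z Y
    \<Longrightarrow> X = Y \<or> X = negv Y"
  using supp_subset_eq[of Y X] z_supp by auto

lemma z_eq_iff: "X \<in> C \<Longrightarrow> Y \<in> C \<Longrightarrow> z X = z Y \<longleftrightarrow> X
    = Y \<or> X = negv Y"
  using z_subset_eq by auto

lemma nonzero_point: "X \<in> C \<Longrightarrow> \<exists>h\<in>E. X h \<noteq> Zero"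
proof (rule ccontr)
  assume a: "X \<in> C" "\<not> (\<exists>h\<in>E. X h \<noteq> Zero)"
  then have "X = zerovec" using outside by (auto simp: zerovec_def fun_eq_iff)
  then show False using a zerovec_notin by simp
qed

lemma weak_elim_supp:
  assumes "X \<in> C" "Y \<in> C" "supp X \<noteq> supp Y" "e \<in> supp X" "e \<in> supp Y"
  shows "\<exists>Z\<in>C. e \<notin> supp Z \<and> supp Z \<subseteq> supp X \<union> supp Y"
proof -
  \<comment> \<open>Reorient \<open>Y\<close> so that the two cocircuits disagree at
    \<open>e\<close>; supports do not see the change.\<close>
  define Y' where "Y' = (if X e = Y e then negv Y else Y)"
  have Y': "e \<in> sep X Y'"
    using assms(4,5) by (cases "X e"; cases "Y e") (simp_all add: Y'_def sep_def supp_def)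
  have Y'C: "Y' \<in> C" "supp Y' = supp Y"
    using assms(2) negv_C[of Y] by (simp_all add: Y'_def)
  have ne: "X \<noteq> negv Y'"
  proof
    assume "X = negv Y'"
    then show False using assms(3) Y'C(2) by simp
  qed
  obtain Z where
    Z: "Z \<in> C" "Z e = Zero" "\<forall>h. Z h = Zero \<or> Z h = X h \<or> Z h = Y' h"
    using weak_elim[OF assms(1) Y'C(1) ne Y'] by (elim bexE conjE)
  have "supp Z \<subseteq> supp X \<union> supp Y'"
  proof
    fix h assume "h \<in> supp Z"
    then show "h \<in> supp X \<union> supp Y'" using Z(3)[rule_format, of h] by (auto simp: supp_def)
  qed
  with Z(1,2) \<open>supp Y' = supp Y\<close> show ?thesis by (auto simp: supp_def)
qed

text \<open>The textbook argument: in a counterexample with smallest union, two eliminations lead to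
  smaller unions.\<close>
lemma strong_elim_supp:
  assumes "X \<in> C" "Y \<in> C" "x \<in> supp X" "x \<in> supp Y" "y \<in> supp X" "y \<notin> supp Y"
  shows "\<exists>Z\<in>C. y \<in> supp Z \<and> x \<notin> supp Z \<and> supp Z \<subseteq> supp X
      \<union> supp Y"
  using assms
proof (induction "card (supp X \<union> supp Y)" arbitrary: X Y x y rule: less_induct)
  case less
  have fin: "finite (supp A \<union> supp B)" if "A \<in> C" "B \<in> C" for A B
    using that supp_E finE by (meson finite_Un finite_subset)
  have "supp X \<noteq> supp Y" using less.prems(5,6) by blast
  from weak_elim_supp[OF less.prems(1,2) this less.prems(3,4)]
  obtain Z where Z: "Z \<in> C" "x \<notin> supp Z" "supp Z \<subseteq> supp X \<union> supp Y" by blast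
  show ?case
  proof (cases "y \<in> supp Z")
    case True with Z show ?thesis by blast
  next
    case False
    have "\<not> supp Z \<subseteq> supp X"
      using supp_subset_eq[OF Z(1) less.prems(1)] less.prems(3) Z(2) by auto
    then obtain w where w: "w \<in> supp Z" "w \<notin> supp X" "w \<in> supp Y" using Z by blast
    have "supp Y \<union> supp Z \<subset> supp X \<union> supp Y" using Z(3) False less.prems(5,6) by blast
    then have "card (supp Y \<union> supp Z) < card (supp X \<union> supp Y)"
      by (intro psubset_card_mono fin less.prems)
    from less.hyps[OF this less.prems(2) Z(1) w(3,1) less.prems(4) Z(2)]
    obtain V where V: "V \<in> C" "x \<in> supp V" "w \<notin> supp V" "supp V \<subseteq> supp Y \<union>
        supp Z" by blast
    have y: "y \<notin> supp V" using V(4) False less.prems(6) by blast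
    have "supp X \<union> supp V \<subset> supp X \<union> supp Y" using Z(3) V(3,4) w by blast
    then have "card (supp X \<union> supp V) < card (supp X \<union> supp Y)"
      by (intro psubset_card_mono fin less.prems)
    from less.hyps[OF this less.prems(1) V(1) less.prems(3) V(2) less.prems(5) y]
    obtain W where "W \<in> C" "y \<in> supp W" "x \<notin> supp W" "supp W \<subseteq> supp X \<union>
        supp V" by blast
    moreover from this have "supp W \<subseteq> supp X \<union> supp Y" using V(4) Z(3) by blast
    ultimately show ?thesis by blast
  qed
qed

section \<open>Closure, exchange and rank\<close>

definition cl :: "'a set \<Rightarrow> 'a set" where
  "cl A = {h \<in> E. \<forall>X\<in>C. A \<subseteq> z X \<longrightarrow> X h = Zero}"

lemma flat_z: "X \<in> C \<Longrightarrow> flat E C (z X)"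
  unfolding flat_def hyperplanes_def zset_def by (intro exI[of _ "{E - supp X}"]) auto

lemma mclosure_eq: "mclosure E C A = cl A"
proof
  show "mclosure E C A \<subseteq> cl A"
  proof
    fix h assume h: "h \<in> mclosure E C A"
    have "X h = Zero" if "X \<in> C" "A \<subseteq> z X" for X
      using h flat_z[OF that(1)] that(2) in_z by (auto simp: mclosure_def)
    then show "h \<in> cl A" using h by (auto simp: cl_def mclosure_def)
  qed
next
  show "cl A \<subseteq> mclosure E C A"
  proof
    fix h assume h: "h \<in> cl A"
    have "h \<in> F" if F: "flat E C F" "A \<subseteq> F" for F
    proof -
      obtain S where S: "S \<subseteq> hyperplanes E C" "F = E \<inter> \<Inter>S" using F unfolding
          flat_def by blast
      have "h \<in> H" if H: "H \<in> S" for H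
      proof -
        obtain X where "X \<in> C" "H = z X" using H S unfolding hyperplanes_def zset_def by blast
        moreover have "A \<subseteq> H" using F S H by blast
        ultimately show ?thesis using h by (auto simp: cl_def in_z)
      qed
      then show ?thesis using S h by (auto simp: cl_def)
    qed
    then show "h \<in> mclosure E C A" using h by (auto simp: mclosure_def cl_def)
  qed
qed

lemma cl_E: "cl A \<subseteq> E"
  by (auto simp: cl_def)

lemma cl_extensive: "A \<subseteq> E \<Longrightarrow> A \<subseteq> cl A"
  by (auto simp: cl_def in_z)

lemma cl_mono: "A \<subseteq> B \<Longrightarrow> cl A \<subseteq> cl B"
  by (auto simp: cl_def)

lemma z_cl: "X \<in> C \<Longrightarrow> A \<subseteq> z X \<Longrightarrow> cl A \<subseteq> z X"
  by (auto simp: cl_def in_z)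

lemma cl_cl [simp]: "cl (cl A) = cl A"
proof
  show "cl (cl A) \<subseteq> cl A" using z_cl by (auto simp: cl_def)
  show "cl A \<subseteq> cl (cl A)" by (simp add: cl_E cl_extensive)
qed

lemma cl_least: "A \<subseteq> cl B \<Longrightarrow> cl A \<subseteq> cl B"
  using cl_mono[of A "cl B"] by simp

lemma not_clD: "h \<in> E \<Longrightarrow> h \<notin> cl A \<Longrightarrow> \<exists>X\<in>C. A
    \<subseteq> z X \<and> X h \<noteq> Zero"
  by (auto simp: cl_def)

lemma cl_z: "X \<in> C \<Longrightarrow> cl (z X) = z X"
  by (simp add: cl_extensive subset_antisym z_cl z_sub)

text \<open>A failure gives two hyperplanes through \<open>A\<close>, one through \<open>y\<close>
  but not \<open>x\<close>, the other avoiding both. Eliminating \<open>x\<close> while keeping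
  \<open>y\<close> yields a hyperplane through \<open>x\<close> and \<open>A\<close> that misses
  \<open>y\<close>.\<close>

lemma exchange:
  assumes A: "A \<subseteq> E" and x: "x \<in> E" and y: "y \<in> cl (insert x A)" "y \<notin> cl A"
  shows "x \<in> cl (insert y A)"
proof (rule ccontr)
  assume "x \<notin> cl (insert y A)"
  from not_clD[OF x this] obtain H where H: "H \<in> C" "insert y A \<subseteq> z H" "H x \<noteq> Zero" by
      blast
  have yE: "y \<in> E" using y cl_E by blast
  from not_clD[OF yE y(2)] obtain H' where H': "H' \<in> C" "A \<subseteq> z H'" "H' y \<noteq> Zero" by blast
  have "H' x \<noteq> Zero" using y(1) H' x by (auto simp: cl_def in_z)
  from strong_elim_supp[OF H'(1) H(1), of x y] this H H' obtain Z where
    Z: "Z \<in> C" "y \<in> supp Z" "x \<notin> supp Z" "supp Z \<subseteq> supp H' \<union> supp H"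
    by (auto simp: supp_def in_z)
  have "h \<in> z Z" if "h \<in> insert x A" for h
  proof (cases "h = x")
    case False
    then have "H h = Zero" "H' h = Zero" "h \<in> E"
      using that H(2) H'(2) A in_z[of h H] in_z[of h H'] by blast+
    then show ?thesis using Z(4) by (auto simp: supp_def in_z)
  qed (use Z(3) x in \<open>simp add: supp_def in_z\<close>)
  then have "insert x A \<subseteq> z Z" by blast
  then show False using y(1) Z(1,2) by (auto simp: cl_def supp_def)
qed

abbreviation indep :: "'a set \<Rightarrow> bool" where "indep \<equiv> mindep E C"
abbreviation rk :: "'a set \<Rightarrow> nat" where "rk \<equiv> mrank E C"

lemma indep_iff: "indep I \<longleftrightarrow> I \<subseteq> E \<and> (\<forall>e\<in>I. e \<notin> cl (I
    - {e}))"
  by (simp add: mindep_def mclosure_eq)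

lemma indep_insert:
  assumes "indep I" "x \<in> E" "x \<notin> cl I"
  shows "indep (insert x I)"
proof -
  have "y \<notin> cl (insert x I - {y})" if "y \<in> insert x I" for y
  proof (cases "y = x")
    case True
    have "x \<notin> I" using assms cl_extensive[of I] by (auto simp: indep_iff)
    then show ?thesis using True assms(3) by simp
  next
    case False
    then have yI: "y \<in> I" using that by auto
    show ?thesis
    proof
      assume "y \<in> cl (insert x I - {y})"
      then have "y \<in> cl (insert x (I - {y}))" using False by (simp add: insert_Diff_if)
      moreover have "y \<notin> cl (I - {y})" using assms(1) yI by (simp add: indep_iff)
      moreover have "I - {y} \<subseteq> E" using assms(1) by (auto simp: indep_iff)
      ultimately have "x \<in> cl (insert y (I - {y}))" using exchange assms(2) by blast
      then show False using assms(3) yI by (simp add: insert_absorb)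
    qed
  qed
  then show ?thesis using assms by (auto simp: indep_iff)
qed

lemma indep_subset: "indep I \<Longrightarrow> J \<subseteq> I \<Longrightarrow> indep J"
  unfolding indep_iff by (meson Diff_mono cl_mono order_refl subset_iff)

text \<open>Elements of \<open>I - J\<close> are traded one at a time for elements of
  \<open>J\<close>; independence and size are kept while \<open>I - J\<close> shrinks.\<close>

lemma steinitz:
  assumes "indep I" "J \<subseteq> E" "I \<subseteq> cl J"
  shows "card I \<le> card J"
  using assms
proof (induction "card (I - J)" arbitrary: I rule: less_induct)
  case less
  have finI: "finite I" using less.prems(1) finE by (auto simp: indep_iff intro: finite_subset)
  have finJ: "finite J" using less.prems(2) finE by (auto intro: finite_subset)
  show ?case
  proof (cases "I \<subseteq> J")
    case True then show ?thesis using finJ by (simp add: card_mono)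
  next
    case False
    then obtain x where x: "x \<in> I" "x \<notin> J" by auto
    have nx: "x \<notin> cl (I - {x})" using less.prems(1) x by (simp add: indep_iff)
    have "\<not> J \<subseteq> cl (I - {x})"
      using nx x less.prems(3) cl_least by blast
    then obtain y where y: "y \<in> J" "y \<notin> cl (I - {x})" by auto
    let ?I = "insert y (I - {x})"
    have ind: "indep ?I"
      using indep_insert[OF indep_subset[OF less.prems(1)], of "I - {x}" y] y less.prems(2) by blast
    have "I - {x} \<subseteq> E" using less.prems(1) by (auto simp: indep_iff)
    from cl_extensive[OF this] have "I - {x} \<subseteq> cl (I - {x})" .
    then have yI: "y \<notin> I - {x}" using y by blast
    have cardI: "card ?I = card I" using yI x finI by (metis card.insert card.remove finite_Diff)
    have "card (?I - J) < card (I - J)"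
      using x y finI by (intro psubset_card_mono) auto
    moreover have "?I \<subseteq> cl J" using less.prems(3) y(1) cl_extensive[OF less.prems(2)] by blast
    ultimately have "card ?I \<le> card J" using less.hyps ind less.prems(2) by blast
    then show ?thesis using cardI by simp
  qed
qed

lemma fin_indep: "A \<subseteq> E \<Longrightarrow> finite {I. I \<subseteq> A \<and> indep I}"
  using finE by (auto intro: finite_subset[of _ "Pow A"] finite_subset)

lemma indep_empty: "indep {}"
  by (simp add: indep_iff)

lemma basis_ex:
  assumes "A \<subseteq> E"
  obtains I where "I \<subseteq> A" "indep I" "A \<subseteq> cl I"
proof -
  let ?S = "{I. I \<subseteq> A \<and> indep I}"
  have "Max (card ` ?S) \<in> card ` ?S"
    using fin_indep[OF assms] indep_empty by (intro Max_in) auto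
  then obtain I where I: "I \<subseteq> A" "indep I" "card I = Max (card ` ?S)" by auto
  have "x \<in> cl I" if x: "x \<in> A" for x
  proof (rule ccontr)
    assume nx: "x \<notin> cl I"
    have "indep (insert x I)" using indep_insert I nx x assms by blast
    then have "card (insert x I) \<le> Max (card ` ?S)"
      using fin_indep[OF assms] x I by (intro Max_ge) auto
    moreover have "x \<notin> I" using nx cl_extensive[of I] I(2) by (auto simp: indep_iff)
    moreover have "finite I" using I finE assms by (meson finite_subset)
    ultimately show False using I by simp
  qed
  then show thesis using that I by auto
qed

lemma rk_eq_card:
  assumes "indep I" "I \<subseteq> A" "A \<subseteq> cl I"
  shows "rk A = card I"
proof -
  have "A \<subseteq> E" using assms cl_E by blast
  show ?thesis unfolding mrank_def
  proof (rule Max_eqI)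
    show "finite (card ` {I. I \<subseteq> A \<and> indep I})" using fin_indep[OF \<open>A \<subseteq>
        E\<close>] by blast
    show "card I \<in> card ` {I. I \<subseteq> A \<and> indep I}" using assms by blast
    fix k assume "k \<in> card ` {I. I \<subseteq> A \<and> indep I}"
    then obtain J where "J \<subseteq> A" "indep J" "k = card J" by auto
    then show "k \<le> card I" using steinitz[of J I] assms by (auto simp: indep_iff)
  qed
qed

lemma rk_cl [simp]:
  assumes "A \<subseteq> E"
  shows "rk (cl A) = rk A"
proof -
  obtain I where I: "I \<subseteq> A" "indep I" "A \<subseteq> cl I" using basis_ex[OF assms] by blast
  have "rk (cl A) = card I"
    by (rule rk_eq_card[OF I(2) subset_trans[OF I(1) cl_extensive[OF assms]] cl_least[OF I(3)]])
  then show ?thesis using rk_eq_card[OF I(2,1,3)] by simp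
qed

lemma rk_insert:
  assumes "A \<subseteq> E" "x \<in> E" "x \<notin> cl A"
  shows "rk (insert x A) = Suc (rk A)"
proof -
  obtain I where I: "I \<subseteq> A" "indep I" "A \<subseteq> cl I" using basis_ex[OF assms(1)] by blast
  have x: "x \<notin> cl I" using assms(3) cl_mono[OF I(1)] by blast
  have IE: "insert x I \<subseteq> E" using I(1) assms by blast
  have "cl I \<subseteq> cl (insert x I)" by (intro cl_mono) blast
  then have "insert x A \<subseteq> cl (insert x I)" using I(3) cl_extensive[OF IE] by blast
  moreover have "insert x I \<subseteq> insert x A" using I(1) by blast
  ultimately have "rk (insert x A) = card (insert x I)"
    using rk_eq_card[OF indep_insert[OF I(2) assms(2) x]] by simp
  moreover have "x \<notin> I" using x cl_extensive[of I] IE by blast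
  moreover have "finite I" using IE finE by (meson finite_insert finite_subset)
  ultimately show ?thesis using rk_eq_card[OF I(2,1,3)] by simp
qed

lemma rk_mono:
  assumes "A \<subseteq> B" "B \<subseteq> E"
  shows "rk A \<le> rk B"
proof -
  obtain I where I: "I \<subseteq> A" "indep I" "A \<subseteq> cl I" using basis_ex[of A] assms by auto
  obtain J where J: "J \<subseteq> B" "indep J" "B \<subseteq> cl J" using basis_ex[of B] assms by auto
  show ?thesis
    using rk_eq_card[OF I(2,1,3)] rk_eq_card[OF J(2,1,3)] steinitz[OF I(2), of J] I(1) J(1,3) assms
    by (metis subset_trans)
qed

lemma rk_le_imp_cl:
  assumes "A \<subseteq> B" "B \<subseteq> E" "rk B \<le> rk A"
  shows "B \<subseteq> cl A"
proof (rule ccontr)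
  assume "\<not> ?thesis"
  then obtain x where x: "x \<in> B" "x \<notin> cl A" by blast
  have "rk (insert x A) = Suc (rk A)" using rk_insert[of A x] x assms(1,2) by blast
  moreover have "rk (insert x A) \<le> rk B" using x(1) assms(1,2) by (intro rk_mono) auto
  ultimately show False using assms by simp
qed

abbreviation r :: nat where "r \<equiv> omrank E C"

lemma r_eq: "r = rk E" by (simp add: omrank_def)

text \<open>Only \<open>X\<close> and its negative vanish on \<open>z X\<close>, so a single element
  outside \<open>z X\<close> completes it to a spanning set.\<close>

lemma rk_z:
  assumes "X \<in> C"
  shows "Suc (rk (z X)) = r"
proof -
  obtain x where x: "x \<in> E" "X x \<noteq> Zero" using nonzero_point assms by blast
  have nx: "x \<notin> cl (z X)" using x assms by (simp add: cl_z in_z)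
  have "\<not> insert x (z X) \<subseteq> z Y" if "Y \<in> C" for Y
    using z_subset_eq[OF assms that] x by (auto simp: in_z)
  then have "cl (insert x (z X)) = E" by (auto simp: cl_def)
  then have "rk E = rk (insert x (z X))" using rk_cl[of "insert x (z X)"] z_sub[of X] x(1) by auto
  then show ?thesis using rk_insert[OF z_sub x(1) nx] by (simp add: r_eq)
qed

section \<open>Lines and planes: flats of corank two and three\<close>

definition line :: "'a set \<Rightarrow> bool" where
  "line F \<longleftrightarrow> F \<subseteq> E \<and> cl F = F \<and> rk F + 2 = r"

definition plane :: "'a set \<Rightarrow> bool" where
  "plane F \<longleftrightarrow> F \<subseteq> E \<and> cl F = F \<and> rk F + 3 = r"

lemma line_sub: "line F \<Longrightarrow> F \<subseteq> E" by (simp add: line_def)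

lemma line_insert:
  assumes "line F" "x \<in> E" "x \<notin> F" "X \<in> C" "insert x F \<subseteq> z X"
  shows "cl (insert x F) = z X"
proof -
  have "rk (insert x F) = Suc (rk F)" using assms rk_insert by (simp add: line_def)
  then have "rk (insert x F) + 1 = r" using assms by (simp add: line_def)
  then have "z X \<subseteq> cl (insert x F)"
    using rk_le_imp_cl[OF assms(5) z_sub] rk_z[OF assms(4)] by simp
  then show ?thesis using z_cl[OF assms(4,5)] by blast
qed

text \<open>The line and one further element have too small a rank to span \<open>E\<close>, hence
  lie in a hyperplane.\<close>

lemma line_point_ex:
  assumes "line F" "x \<in> E"
  obtains X where "X \<in> C" "F \<subseteq> z X" "X x = Zero"
proof -
  have "rk (insert x F) \<le> Suc (rk F)"
    using assms rk_insert[of F x] by (cases "x \<in> F") (auto simp: line_def insert_absorb)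
  then have "rk (insert x F) < rk E" using assms by (simp add: line_def r_eq)
  moreover have "insert x F \<subseteq> E" using line_sub[OF assms(1)] assms(2) by simp
  ultimately have "\<not> E \<subseteq> cl (insert x F)"
    using rk_mono[OF _ cl_E[of "insert x F"], of E] rk_cl[of "insert x F"] by linarith
  then obtain h where h: "h \<in> E" "h \<notin> cl (insert x F)" by blast
  obtain X where "X \<in> C" "insert x F \<subseteq> z X" using not_clD[OF h] by blast
  then show thesis using that by (auto simp: in_z)
qed

lemma line_point_unique:
  assumes "line F" "x \<in> E" "x \<notin> F" "X \<in> C" "F \<subseteq> z X" "X x = Zero" "Y \<in> C" "F
      \<subseteq> z Y" "Y x = Zero"
  shows "X = Y \<or> X = negv Y"
  using line_insert[OF assms(1-3), of X] line_insert[OF assms(1-3), of Y] assms z_eq_iff[of X Y]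
  by (auto simp: in_z)

lemma line_point_nonzero:
  assumes "line F" "x \<in> E" "x \<notin> F"
  obtains X where "X \<in> C" "F \<subseteq> z X" "X x \<noteq> Zero"
  using assms not_clD[of x F] that by (auto simp: line_def)

lemma line_inter:
  assumes "line F" "X \<in> C" "Y \<in> C" "F \<subseteq> z X" "F \<subseteq> z Y" "X \<noteq> Y" "X
      \<noteq> negv Y"
  shows "z X \<inter> z Y = F"
proof
  show "z X \<inter> z Y \<subseteq> F"
  proof
    fix x assume x: "x \<in> z X \<inter> z Y"
    show "x \<in> F" using line_point_unique[of F x X Y] assms x by (auto simp: in_z)
  qed
qed (use assms in auto)

lemma line_psubset: "line F \<Longrightarrow> X \<in> C \<Longrightarrow> F \<subseteq> z X
    \<Longrightarrow> \<exists>x\<in>z X. x \<notin> F"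
proof (rule ccontr)
  assume a: "line F" "X \<in> C" "F \<subseteq> z X" "\<not> (\<exists>x\<in>z X. x \<notin> F)"
  then have "F = z X" by auto
  then show False using a rk_z[of X] by (simp add: line_def)
qed

lemma lines_eq:
  assumes "line F" "line F'" "F \<subseteq> F'"
  shows "F = F'"
  using rk_le_imp_cl[OF assms(3)] assms by (auto simp: line_def)

lemma plane_line:
  assumes "plane F" "x \<in> E" "x \<notin> F"
  shows "line (cl (insert x F))"
  using rk_insert[of F x] rk_cl[of "insert x F"] assms cl_E
  by (auto simp: line_def plane_def)

text \<open>Here \<open>x\<close> is a coloop of the flat, so its removal leaves a flat of rank one
  less. For the new element this is the old line through a new point.\<close>

lemma point_remove_line:
  assumes "P \<in> C" "x \<in> z P" "x \<notin> cl (z P - {x})"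
  shows "line (z P - {x})"
proof -
  have sub: "z P - {x} \<subseteq> E" using z_sub by auto
  have "cl (z P - {x}) \<subseteq> z P" using z_cl assms by blast
  then have c: "cl (z P - {x}) = z P - {x}" using assms cl_extensive[OF sub] by blast
  have "rk (insert x (z P - {x})) = Suc (rk (z P - {x}))"
    using rk_insert[OF sub _ assms(3)] assms z_sub by blast
  then have "rk (z P) = Suc (rk (z P - {x}))" using assms by (simp add: insert_absorb)
  then show ?thesis using c sub rk_z[OF assms(1)] by (simp add: line_def)
qed

lemma line_remove_plane:
  assumes "line F" "x \<in> F" "x \<notin> cl (F - {x})"
  shows "plane (F - {x})"
proof -
  have sub: "F - {x} \<subseteq> E" using line_sub assms by auto
  have "cl (F - {x}) \<subseteq> F" using assms(1) cl_mono[of "F - {x}" F] by (auto simp: line_def)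
  then have c: "cl (F - {x}) = F - {x}" using assms cl_extensive[OF sub] by blast
  have "rk (insert x (F - {x})) = Suc (rk (F - {x}))"
    using rk_insert[OF sub _ assms(3)] assms line_sub by blast
  then have "rk F = Suc (rk (F - {x}))" using assms by (simp add: insert_absorb)
  then show ?thesis using c sub assms(1) by (simp add: line_def plane_def)
qed

lemma plane_line_through:
  assumes "plane F" "x \<in> E" "x \<notin> F" "line L" "F \<subseteq> L" "x \<in> L"
  shows "L = cl (insert x F)"
  using lines_eq[OF plane_line[OF assms(1-3)] assms(4)] assms cl_mono[of "insert x F" L]
  by (simp add: line_def)

end

section \<open>Signs on a line\<close>

context oriented_matroid
begin

text \<open>The new point vanishes at \<open>e\<close>, where \<open>X\<close> and \<open>Y\<close>
  do not, so it meets each of them only in \<open>F\<close>. Where just one of them vanishes it is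
  therefore nonzero and has to copy the other.\<close>

lemma weak_line_elim:
  assumes F: "line F" and X: "X \<in> C" "F \<subseteq> z X" and Y: "Y \<in> C" "F \<subseteq> z Y"
    and ne: "X \<noteq> Y" "X \<noteq> negv Y" and e: "X e \<noteq> Zero" "Y e = sneg (X e)"
  shows "\<exists>Z\<in>C. F \<subseteq> z Z \<and> Z e = Zero \<and> (\<forall>h. Z h = Zero \<or> Z h = X
      h \<or> Z h = Y h)
    \<and> (\<forall>h\<in>z X. Z h = Y h) \<and> (\<forall>h\<in>z Y. Z h = X h)"
proof -
  have "e \<in> sep X Y" using e by (simp add: sep_def)
  then obtain Z where Z: "Z \<in> C" "Z e = Zero" "\<forall>h. Z h = Zero \<or> Z h = X h \<or> Z h = Y h"
    using weak_elim[OF X(1) Y(1) ne(2)] by blast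
  have FZ: "F \<subseteq> z Z"
  proof
    fix h assume "h \<in> F"
    then have "h \<in> z X" "h \<in> z Y" using X Y by blast+
    then show "h \<in> z Z" using Z(3)[rule_format, of h] by (auto simp: in_z)
  qed
  have zX: "z Z \<inter> z X = F"
    using Z(2) e by (intro line_inter[OF F Z(1) X(1) FZ X(2)]) auto
  have zY: "z Z \<inter> z Y = F"
    using Z(2) e by (intro line_inter[OF F Z(1) Y(1) FZ Y(2)]) auto
  have "Z h = Y h" if "h \<in> z X" for h
    using Z(3)[rule_format, of h] that zX Y(2) by (auto simp: in_z)
  moreover have "Z h = X h" if "h \<in> z Y" for h
    using Z(3)[rule_format, of h] that zY X(2) by (auto simp: in_z)
  ultimately show ?thesis using Z FZ by blast
qed

text \<open>The gain over weak elimination is that common signs survive. If one were lost at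
  \<open>h\<close>, eliminating \<open>h\<close> between \<open>X\<close> and \<open>-Y\<close>
  would give the same point up to sign; but the two results agree on \<open>z Y\<close> and are
  opposite on \<open>z X\<close>, with nonzero entries on both.\<close>

lemma line_elim:
  assumes F: "line F" and X: "X \<in> C" "F \<subseteq> z X" and Y: "Y \<in> C" "F \<subseteq> z Y"
    and ne: "X \<noteq> negv Y" and e: "X e \<noteq> Zero" "Y e = sneg (X e)"
  shows "\<exists>Z\<in>C. F \<subseteq> z Z \<and> Z e = Zero \<and> (\<forall>h. ssum (X h) (Y h) (Z h))"
proof -
  have ne': "X \<noteq> Y" using e by auto
  obtain Z where Z: "Z \<in> C" "F \<subseteq> z Z" "Z e = Zero" "\<forall>h. Z h = Zero \<or> Z h = X h
      \<or> Z h = Y h"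
    "\<forall>h\<in>z X. Z h = Y h" "\<forall>h\<in>z Y. Z h = X h"
    using weak_line_elim[OF F X Y ne' ne e] by blast
  have FXY: "z X \<inter> z Y = F" by (rule line_inter[OF F X(1) Y(1) X(2) Y(2) ne' ne])
  have "ssum (X h) (Y h) (Z h)" for h
  proof (cases "h \<in> E")
    case False
    then show ?thesis using outside[OF X(1)] outside[OF Y(1)] outside[OF Z(1)] by simp
  next
    case hE: True
    have "Z h = X h" if xy: "X h = Y h" "X h \<noteq> Zero"
    proof (rule ccontr)
      assume "Z h \<noteq> X h"
      then have Zh: "Z h = Zero" using Z(4)[rule_format, of h] xy by auto
      have h: "h \<notin> F" using xy X(2) by (auto simp: in_z)
      have ne2: "X \<noteq> negv Y" "X \<noteq> negv (negv Y)" using ne ne' by simp_all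
      obtain W where W: "W \<in> C" "F \<subseteq> z W" "W h = Zero"
        "\<forall>h\<in>z X. W h = negv Y h" "\<forall>h\<in>z Y. W h = X h"
        using weak_line_elim[OF F X negv_C[OF Y(1)] _ ne2, of h] Y(2) xy by auto
      have WZ: "W = Z \<or> W = negv Z"
        using line_point_unique[OF F hE h W(1,2,3) Z(1,2) Zh] .
      obtain k where k: "k \<in> z X" "k \<notin> F" using line_psubset[OF F X] by blast
      obtain j where j: "j \<in> z Y" "j \<notin> F" using line_psubset[OF F Y] by blast
      have "Y k \<noteq> Zero" "X j \<noteq> Zero" using k j FXY by (auto simp: in_z)
      moreover have "W k = sneg (Y k)" "Z k = Y k" "W j = X j" "Z j = X j"
        using W Z k j by auto
      ultimately show False using WZ by auto
    qed
    then show ?thesis using Z(5,6) hE by (auto simp: ssum_def in_z)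
  qed
  then show ?thesis using Z(1-3) by blast
qed

text \<open>Both elements cut the line in the same point. If their relative sign were not constant,
  elimination would produce a point where only one of them vanishes.\<close>

lemma line_parallel:
  assumes F: "line F" and X0: "X0 \<in> C" "F \<subseteq> z X0" and a: "a \<in> E" "a \<notin> F" "X0 a = Zero"
    and b: "b \<in> E" "b \<notin> F" "X0 b = Zero"
  shows "\<exists>c. c \<noteq> Zero \<and> (\<forall>V\<in>C. F \<subseteq> z V \<longrightarrow> V b =
      smult c (V a))"
proof -
  have zero: "V a = Zero \<longleftrightarrow> V b = Zero" if V: "V \<in> C" "F \<subseteq> z V" for V
    using line_point_unique[OF F a(1,2) V _ X0 a(3)] line_point_unique[OF F b(1,2) V _ X0 b(3)]
      a(3) b(3) by auto
  obtain W where W: "W \<in> C" "F \<subseteq> z W" "W a \<noteq> Zero" using line_point_nonzero[OF F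
      a(1,2)] by blast
  then have Wb: "W b \<noteq> Zero" using zero by blast
  have same: "V b = W b" if V: "V \<in> C" "F \<subseteq> z V" "V a = W a" for V
  proof (rule ccontr)
    assume ne: "V b \<noteq> W b"
    have "V b \<noteq> Zero" using zero[OF V(1,2)] V(3) W(3) by simp
    then have Wn: "W b = sneg (V b)" using Wb ne by (cases "V b"; cases "W b") auto
    have "V \<noteq> negv W" using V(3) W(3) by auto
    then obtain Z where Z: "Z \<in> C" "F \<subseteq> z Z" "Z b = Zero" "\<forall>h. ssum (V h) (W h) (Z h)"
      using line_elim[OF F V(1,2) W(1,2) _ \<open>V b \<noteq> Zero\<close> Wn] by blast
    have "ssum (V a) (W a) (Z a)" using Z(4) by blast
    then have "Z a = W a" using V(3) by (simp add: ssum_def)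
    then show False using zero[OF Z(1,2)] Z(3) W(3) by simp
  qed
  have "V b = smult (smult (W a) (W b)) (V a)" if V: "V \<in> C" "F \<subseteq> z V" for V
  proof -
    consider "V a = Zero" | "V a = W a" | "negv V a = W a"
      using W(3) by (cases "V a"; cases "W a") auto
    then show ?thesis
    proof cases
      case 1 then show ?thesis using zero[OF V] by simp
    next
      case 2 then show ?thesis using same[OF V 2] W(3)
        by (cases "W a"; cases "W b") auto
    next
      case 3
      then have "negv V b = W b" using same[of "negv V"] V negv_C by simp
      then have "V b = sneg (W b)" "V a = sneg (W a)" using 3 by (metis negv_apply sneg_sneg)+
      then show ?thesis using W(3) by (cases "W a"; cases "W b") auto
    qed
  qed
  then show ?thesis using W(3) Wb by (intro exI[of _ "smult (W a) (W b)"]) auto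
qed

text \<open>The signs at \<open>a\<close> and \<open>b\<close> identify \<open>Z\<close> as the
  point obtained by eliminating \<open>b\<close> between \<open>X\<close> and
  \<open>Y\<close>.\<close>

lemma line_cone:
  assumes F: "line F" and X: "X \<in> C" "F \<subseteq> z X" and Y: "Y \<in> C" "F \<subseteq> z Y"
    and Z: "Z \<in> C" "F \<subseteq> z Z"
    and a: "X a = Zero" "Z a = Y a" "Y a \<noteq> Zero"
    and b: "b \<in> E" "Z b = Zero" "X b \<noteq> Zero" "Y b = sneg (X b)"
  shows "ssum (X h) (Y h) (Z h)"
proof -
  have "X \<noteq> negv Y" using a by auto
  then obtain W where W: "W \<in> C" "F \<subseteq> z W" "W b = Zero" "\<forall>h. ssum (X h) (Y h) (W h)"
    using line_elim[OF F X Y _ b(3,4)] by blast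
  have bF: "b \<notin> F" using b X by (auto simp: in_z)
  have "ssum (X a) (Y a) (W a)" using W(4) by blast
  then have "W a = Z a" using a by simp
  then have "W = Z"
    using line_point_unique[OF F b(1) bF W(1-3) Z b(2)] a by auto
  then show ?thesis using W(4) by blast
qed

section \<open>Comodular points and the direction between them\<close>

definition comod :: "'a svec \<Rightarrow> 'a svec \<Rightarrow> bool" where
  "comod X Y \<longleftrightarrow> X \<in> C \<and> Y \<in> C \<and> X \<noteq> Y \<and> X \<noteq> negv Y
      \<and> line (z X \<inter> z Y)"

lemma comodI:
  assumes "line F" "X \<in> C" "F \<subseteq> z X" "Y \<in> C" "F \<subseteq> z Y" "X \<noteq> Y" "X
      \<noteq> negv Y"
  shows "comod X Y" "z X \<inter> z Y = F"
  using line_inter[OF assms(1,2,4,3,5-7)] assms by (auto simp: comod_def)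

lemma comod_sym: "comod X Y \<Longrightarrow> comod Y X"
  unfolding comod_def by (metis Int_commute negv_negv)

lemma comod_anchor:
  assumes "comod X Y"
  obtains a where "a \<in> E" "X a = Zero" "Y a \<noteq> Zero"
  using assms line_psubset[of "z X \<inter> z Y" X] that by (auto simp: comod_def in_z)

text \<open>A criterion without ranks, suited to deletions, whose rank function is a different one.
  If \<open>a\<close> and the meet did not span \<open>z X\<close>, a hyperplane through them that
  misses part of \<open>z X\<close> would violate the assumption.\<close>

lemma comod_char:
  assumes X: "X \<in> C" and Y: "Y \<in> C" and ne: "X \<noteq> Y" "X \<noteq> negv Y"
    and V: "\<And>V. V \<in> C \<Longrightarrow> z X \<inter> z Y \<subseteq> z V \<Longrightarrow> V
        \<noteq> X \<Longrightarrow> V \<noteq> negv X \<Longrightarrow> z V \<inter> z X \<subseteq> z Y"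
  shows "comod X Y"
proof -
  let ?F = "z X \<inter> z Y"
  have sub: "?F \<subseteq> E" using z_sub by blast
  have "cl ?F \<subseteq> z X" "cl ?F \<subseteq> z Y" using z_cl X Y by blast+
  then have c: "cl ?F = ?F" using cl_extensive[OF sub] by blast
  obtain a where a: "a \<in> z X" "a \<notin> z Y" using z_subset_eq[OF X Y] ne by blast
  have aE: "a \<in> E" using a z_sub by blast
  have "b \<in> cl (insert a ?F)" if b: "b \<in> z X" for b
  proof (rule ccontr)
    assume nb: "b \<notin> cl (insert a ?F)"
    have "b \<in> E" using b z_sub by blast
    from not_clD[OF this nb] obtain V where W: "V \<in> C" "insert a ?F \<subseteq> z V" "V b \<noteq>
        Zero" by blast
    have "V \<noteq> X" "V \<noteq> negv X" using W b by (auto simp: in_z)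
    from V[OF W(1) _ this] have "z V \<inter> z X \<subseteq> z Y" using W(2) by simp
    then show False using W(2) a by blast
  qed
  moreover have "cl (insert a ?F) \<subseteq> z X" by (intro z_cl[OF X]) (use a in simp)
  ultimately have "cl (insert a ?F) = z X" by (intro subset_antisym subsetI) auto
  moreover have "rk (insert a ?F) = Suc (rk ?F)" using rk_insert[OF sub aE] c a by auto
  ultimately have "rk (z X) = Suc (rk ?F)" using rk_cl[of "insert a ?F"] sub aE by simp
  then show ?thesis using rk_z[OF X] c sub X Y ne by (simp add: comod_def line_def)
qed

lemma comodular_iff: "comodular E C X Y \<longleftrightarrow> comod X Y"
proof (cases "X \<in> C \<and> Y \<in> C")
  case True
  then have X: "X \<in> C" and Y: "Y \<in> C" by auto
  have zc: "zset E (comp X Y) = z X \<inter> z Y" by (auto simp: in_z comp_def split: if_splits)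
  have sub: "z X \<inter> z Y \<subseteq> E" using z_sub by blast
  have "cl (z X \<inter> z Y) \<subseteq> z X" "cl (z X \<inter> z Y) \<subseteq> z Y" using z_cl X Y by blast+
  then have c: "cl (z X \<inter> z Y) = z X \<inter> z Y" using cl_extensive[OF sub] by blast
  have fl: "flat E C (z X \<inter> z Y)"
    unfolding flat_def hyperplanes_def zset_def
    by (rule exI[of _ "{E - supp X, E - supp Y}"]) (use X Y in auto)
  have "comp zerovec X = X" by (auto simp: comp_def zerovec_def)
  then have cov: "comp X Y \<in> covectors C"
    using covectors.compose[OF covectors.compose[OF covectors.zero X] Y] by simp
  show ?thesis
    using X Y c fl cov sub by (auto simp: comodular_def is_edge_def comod_def line_def zc)
next
  case False
  then show ?thesis by (auto simp: comodular_def comod_def)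
qed

text \<open>In a realization, \<^term>\<open>dif G X Y Z\<close> describes the sign vector of
  \<open>G(X) \<cdot> Y - G(Y) \<cdot> X\<close>, the point of the line through \<^term>\<open>X\<close>
      and \<^term>\<open>Y\<close> on which the
  signed element \<^term>\<open>G\<close> vanishes.\<close>

definition dif :: "'a \<times> sign \<Rightarrow> 'a svec \<Rightarrow> 'a svec \<Rightarrow> 'a svec
    \<Rightarrow> bool" where
  "dif G X Y Z \<longleftrightarrow> (Z = zerovec \<or> Z \<in> C) \<and> z X \<inter> z Y \<subseteq> z Z
      \<and> Z (fst G) = Zero
    \<and> (\<forall>h. ssum (smult (ev G X) (Y h)) (sneg (smult (ev G Y) (X h))) (Z h))"

lemma dif_ssum: "dif G X Y Z \<Longrightarrow> ssum (smult (ev G X) (Y h)) (sneg (smult (ev G Y) (X h))) (Z h)"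
  by (simp add: dif_def)

lemma dif_left: "dif G X Y Z \<Longrightarrow> X h = Zero \<Longrightarrow> Z h = smult (ev G X) (Y h)"
  using dif_ssum[of G X Y Z h] by simp

lemma dif_right: "dif G X Y Z \<Longrightarrow> Y h = Zero \<Longrightarrow> Z h = sneg (smult (ev G Y) (X h))"
  using dif_ssum[of G X Y Z h] by simp

lemma dif_zero: "dif G X Y Z \<Longrightarrow> Z (fst G) = Zero"
  by (simp add: dif_def)

lemma dif_sub: "dif G X Y Z \<Longrightarrow> z X \<inter> z Y \<subseteq> z Z"
  by (simp add: dif_def)

lemma dif_negv:
  assumes "dif G X Y Z"
  shows "dif G Y X (negv Z)"
proof -
  have "ssum (smult (ev G Y) (X h)) (sneg (smult (ev G X) (Y h))) (sneg (Z h))" for h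
    using ssum_scale[OF dif_ssum[OF assms, of h], of Neg] ssum_commute by simp
  then show ?thesis using assms negv_C[of Z] by (auto simp: dif_def in_z)
qed

definition scal :: "sign \<Rightarrow> 'a svec \<Rightarrow> 'a svec" where
  "scal s X = (\<lambda>h. smult s (X h))"

lemma scal_cases: "s \<noteq> Zero \<Longrightarrow> scal s X = X \<or> scal s X = negv X"
  by (cases s) (auto simp: scal_def negv_def)

lemma scal_C: "s \<noteq> Zero \<Longrightarrow> X \<in> C \<Longrightarrow> scal s X \<in> C"
  using scal_cases[of s X] negv_C[of X] by auto

lemma z_scal: "s \<noteq> Zero \<Longrightarrow> z (scal s X) = z X"
  using scal_cases[of s X] by auto

text \<open>If \<open>G\<close> is nonzero at both points, \<open>fst G\<close> is eliminated
  between scaled copies of them. Otherwise a summand drops out and the direction is a multiple of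
  one of the points, or zero.\<close>

lemma dif_ex:
  assumes XY: "comod X Y" and G: "snd G \<noteq> Zero"
  shows "\<exists>Z. dif G X Y Z"
proof -
  have X: "X \<in> C" and Y: "Y \<in> C" and F: "line (z X \<inter> z Y)" using XY by (auto simp: comod_def)
  consider "ev G X = Zero" "ev G Y = Zero" | "ev G X = Zero" "ev G Y \<noteq> Zero"
    | "ev G X \<noteq> Zero" "ev G Y = Zero" | "ev G X \<noteq> Zero" "ev G Y \<noteq> Zero" by blast
  then show ?thesis
  proof cases
    case 1
    then have "dif G X Y zerovec" by (auto simp: dif_def in_z)
    then show ?thesis by blast
  next
    case 2
    then have "dif G X Y (scal (sneg (ev G Y)) X)"
      using scal_C[of "sneg (ev G Y)" X] X G
      by (auto simp: dif_def z_scal) (simp_all add: scal_def ev_eq_Zero)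
    then show ?thesis by blast
  next
    case 3
    then have "dif G X Y (scal (ev G X) Y)"
      using scal_C[of "ev G X" Y] Y G
      by (auto simp: dif_def z_scal) (simp_all add: scal_def ev_eq_Zero)
    then show ?thesis by blast
  next
    case 4
    let ?A = "scal (sneg (ev G Y)) X" and ?B = "scal (ev G X) Y"
    have A: "?A \<in> C" "z X \<inter> z Y \<subseteq> z ?A" and B: "?B \<in> C" "z X \<inter> z Y
        \<subseteq> z ?B"
      using scal_C 4 X Y by (auto simp: z_scal)
    have g: "X (fst G) \<noteq> Zero" "Y (fst G) \<noteq> Zero" using 4 G by (auto simp: ev_eq_Zero)
    have "?A \<noteq> negv ?B"
    proof
      assume "?A = negv ?B"
      then have "z ?A = z ?B" by simp
      then have "z X = z Y" using 4 by (simp add: z_scal)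
      then show False using z_eq_iff[OF X Y] XY by (simp add: comod_def)
    qed
    moreover have "?A (fst G) \<noteq> Zero" "?B (fst G) = sneg (?A (fst G))"
      using 4 g by (auto simp: scal_def ev_def)
        (cases "snd G"; cases "X (fst G)"; cases "Y (fst G)"; simp)+
    ultimately obtain Z where Z: "Z \<in> C" "z X \<inter> z Y \<subseteq> z Z" "Z (fst G) = Zero"
      "\<forall>h. ssum (?A h) (?B h) (Z h)"
      using line_elim[OF F A B] by blast
    have "ssum (smult (ev G X) (Y h)) (sneg (smult (ev G Y) (X h))) (Z h)" for h
      using Z(4)[rule_format, of h] ssum_commute by (simp add: scal_def)
    then have "dif G X Y Z" using Z by (simp add: dif_def)
    then show ?thesis by blast
  qed
qed

lemma dif_in_C:
  assumes XY: "comod X Y" and d: "dif G X Y Z" and G: "ev G X \<noteq> Zero \<or> ev G Y \<noteq> Zero"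
  shows "Z \<in> C"
proof -
  obtain a where a: "X a = Zero" "Y a \<noteq> Zero" using comod_anchor[OF XY] by blast
  obtain b where b: "Y b = Zero" "X b \<noteq> Zero" using comod_anchor[OF comod_sym[OF XY]] by blast
  have "Z a \<noteq> Zero \<or> Z b \<noteq> Zero"
    using dif_left[OF d a(1)] dif_right[OF d b(1)] a b G by auto
  then have "Z \<noteq> zerovec" by auto
  then show ?thesis using d by (simp add: dif_def)
qed

text \<open>The line and the zero at \<open>fst G\<close> fix the direction up to sign; an element
  vanishing at \<open>X\<close> but not at \<open>Y\<close> fixes the sign.\<close>

lemma dif_unique:
  assumes XY: "comod X Y" and G: "fst G \<in> E" "snd G \<noteq> Zero" and Z: "dif G X Y Z" and W: "dif G X Y W"
  shows "Z = W"
proof (cases "ev G X = Zero \<or> ev G Y = Zero")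
  case True
  then have "Z h = W h" for h
    using dif_ssum[OF Z, of h] dif_ssum[OF W, of h] by auto
  then show ?thesis by auto
next
  case False
  then have ZW: "Z \<in> C" "W \<in> C" using dif_in_C[OF XY] Z W by auto
  obtain a where a: "X a = Zero" "Y a \<noteq> Zero" using comod_anchor[OF XY] by blast
  have "fst G \<notin> z X \<inter> z Y" using False G by (auto simp: in_z ev_eq_Zero)
  then have "Z = W \<or> Z = negv W"
    using line_point_unique[of "z X \<inter> z Y" "fst G" Z W] XY G ZW dif_sub Z W dif_zero
    by (simp add: comod_def)
  moreover have "Z a = W a" "Z a \<noteq> Zero"
    using dif_left[OF Z a(1)] dif_left[OF W a(1)] a False by auto
  ultimately show ?thesis by auto
qed

text \<open>In a realization both sides have the sign of \<open>H(X) G(Y) - H(Y) G(X)\<close>. This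
  is what lets the reversal of a walk exchange the two elements of a program. Unless
  \<open>Z\<close> and \<open>W\<close> agree up to sign, \<open>W\<close> lies in the cone of
  \<open>Z\<close> and \<open>-X\<close>, or of \<open>Z\<close> and \<open>Y\<close>.\<close>

lemma dif_swap:
  assumes XY: "comod X Y" and G: "fst G \<in> E" "snd G \<noteq> Zero" and H: "fst H \<in> E" "snd H
      \<noteq> Zero"
    and pos: "ev G X = Pos" "ev G Y = Pos" "ev H X = Pos" "ev H Y = Pos"
    and Z: "dif G X Y Z" and W: "dif H X Y W"
  shows "ev G W = sneg (ev H Z)"
proof -
  let ?F = "z X \<inter> z Y"
  have X: "X \<in> C" "?F \<subseteq> z X" and Y: "Y \<in> C" "?F \<subseteq> z Y" and F: "line ?F"
    using XY by (auto simp: comod_def)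
  have ZC: "Z \<in> C" "?F \<subseteq> z Z" and WC: "W \<in> C" "?F \<subseteq> z W"
    using dif_in_C[OF XY Z] dif_in_C[OF XY W] dif_sub[OF Z] dif_sub[OF W] pos by auto
  obtain a where a: "X a = Zero" "Y a \<noteq> Zero" using comod_anchor[OF XY] by blast
  obtain b where b: "Y b = Zero" "X b \<noteq> Zero" using comod_anchor[OF comod_sym[OF XY]] by blast
  have g: "Z (fst G) = Zero" and f: "W (fst H) = Zero" using dif_zero Z W by auto
  have fX: "X (fst H) \<noteq> Zero" "Y (fst H) \<noteq> Zero" using pos H by (auto simp: ev_def)
  show ?thesis
  proof (cases "ev H Z")
    case Zero
    have "fst H \<notin> ?F" using fX by (simp add: in_z)
    then have "Z = W \<or> Z = negv W"
      using line_point_unique[OF F H(1) _ ZC _ WC f] Zero H by (simp add: ev_eq_Zero)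
    then show ?thesis using g Zero by (auto simp: ev_def)
  next
    case Pos
    have "Z (fst H) = X (fst H)" using Pos pos H
      by (cases "snd H"; cases "Z (fst H)"; cases "X (fst H)") (auto simp: ev_def)
    then have "ssum (negv X (fst G)) (Z (fst G)) (W (fst G))"
      using dif_left[OF Z a(1)] dif_left[OF W a(1)] a pos f fX H
      by (intro line_cone[OF F negv_C[OF X(1)] _ ZC WC, of a "fst H"]) auto
    then have "W (fst G) = sneg (X (fst G))" using g by simp
    then show ?thesis using Pos pos by (simp add: ev_def)
  next
    case Neg
    have "Z (fst H) = sneg (Y (fst H))" using Neg pos H
      by (cases "snd H"; cases "Z (fst H)"; cases "Y (fst H)") (auto simp: ev_def)
    then have "ssum (Y (fst G)) (Z (fst G)) (W (fst G))"
      using dif_right[OF Z b(1)] dif_right[OF W b(1)] b pos f fX H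
      by (intro line_cone[OF F Y ZC WC, of b "fst H"]) auto
    then have "W (fst G) = Y (fst G)" using g by simp
    then show ?thesis using Neg pos by (simp add: ev_def)
  qed
qed

end

section \<open>Cyclic relations\<close>

text \<open>Every edge lies on a closed walk. Relations of this kind can be mapped, refined and
  restricted without keeping track of the indices of a particular cycle.\<close>

definition cyclic_rel :: "('b \<times> 'b) set \<Rightarrow> bool" where
  "cyclic_rel R \<longleftrightarrow> (\<forall>(x, y)\<in>R. (y, x) \<in> R\<^sup>*)"

definition cyc :: "('b \<times> 'b) set \<Rightarrow> ('b \<times> 'b) set" where
  "cyc R = {(x, y) \<in> R. (y, x) \<in> R\<^sup>*}"

lemma cyclic_relD: "cyclic_rel R \<Longrightarrow> (x, y) \<in> R \<Longrightarrow> (y, x) \<in> R\<^sup>*"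
  by (auto simp: cyclic_rel_def)

text \<open>Each edge of a return path lies on the same closed walk, hence belongs to
  \<open>cyc R\<close> too.\<close>

lemma cyclic_cyc: "cyclic_rel (cyc R)"
proof -
  have path: "(a, b) \<in> (cyc R)\<^sup>*" if "(a, b) \<in> R\<^sup>*" "(b, a) \<in> R\<^sup>*" for a b
    using that
  proof (induction rule: rtrancl_induct)
    case (step y w)
    have "(w, y) \<in> R\<^sup>*" using step by (meson rtrancl_trans)
    then have "(y, w) \<in> cyc R" using step by (simp add: cyc_def)
    moreover have "(y, a) \<in> R\<^sup>*" using step by (meson converse_rtrancl_into_rtrancl)
    ultimately show ?case using step.IH by (meson rtrancl.rtrancl_into_rtrancl)
  qed simp
  then show ?thesis by (auto simp: cyclic_rel_def cyc_def)
qed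

lemma cyc_subset: "cyc R \<subseteq> R"
  by (auto simp: cyc_def)

lemma cyclic_rel_converse: "cyclic_rel R \<Longrightarrow> cyclic_rel (R\<inverse>)"
  by (auto simp: cyclic_rel_def rtrancl_converse)

lemma cyclic_rel_back:
  assumes "cyclic_rel R" "(x, y) \<in> R\<^sup>*"
  shows "(y, x) \<in> R\<^sup>*"
  using assms(2)
proof (induction rule: rtrancl_induct)
  case (step y w)
  then show ?case using cyclic_relD[OF assms(1)] by (meson rtrancl_trans)
qed simp

text \<open>The walk leads back, so a property that is never lost is never gained either.\<close>

lemma cyclic_invariant:
  assumes R: "cyclic_rel R" and mono: "\<And>x y. (x, y) \<in> R \<Longrightarrow> Q x \<Longrightarrow> Q
      y" and xy: "(x, y) \<in> R"
  shows "Q x \<longleftrightarrow> Q y"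
proof -
  have "Q b" if "(a, b) \<in> R\<^sup>*" "Q a" for a b
    using that by (induction rule: rtrancl_induct) (auto intro: mono)
  then show ?thesis using mono[OF xy] cyclic_relD[OF R xy] by blast
qed

lemma cyclic_restrict:
  assumes R: "cyclic_rel R" and mono: "\<And>x y. (x, y) \<in> R \<Longrightarrow> Q x \<Longrightarrow> Q y"
  shows "cyclic_rel {(x, y) \<in> R. Q x}"
proof -
  have "(a, b) \<in> {(x, y) \<in> R. Q x}\<^sup>* \<and> Q b" if "(a, b) \<in> R\<^sup>*" "Q a" for a b
    using that
  proof (induction rule: rtrancl_induct)
    case (step y w)
    then show ?case using mono[of y w] by (auto intro: rtrancl.rtrancl_into_rtrancl)
  qed simp
  then show ?thesis using mono cyclic_relD[OF R] by (fastforce simp: cyclic_rel_def)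
qed

text \<open>A step may become a whole path, and in particular may collapse to a point.\<close>

lemma cyclic_path:
  assumes R: "cyclic_rel R" and map: "\<And>x y. (x, y) \<in> R \<Longrightarrow> (\<phi> x, \<phi> y)
      \<in> S\<^sup>*" and xy: "(x, y) \<in> R\<^sup>*"
  shows "(\<phi> y, \<phi> x) \<in> S\<^sup>*"
proof -
  have "(\<phi> a, \<phi> b) \<in> S\<^sup>*" if "(a, b) \<in> R\<^sup>*" for a b
    using that by (induction rule: rtrancl_induct) (auto intro: rtrancl_trans map)
  then show ?thesis using cyclic_rel_back[OF R xy] by blast
qed

text \<open>Directed cycles demand distinct vertices; a repetition is cut out by restarting the list
  at the old occurrence.\<close>

lemma rtrancl_distinct_path:
  assumes "(b, a) \<in> R\<^sup>*"
  shows "\<exists>xs. xs \<noteq> [] \<and> distinct xs \<and> hd xs = b \<and> last xs = a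
    \<and> (\<forall>i. Suc i < length xs \<longrightarrow> (xs ! i, xs ! Suc i) \<in> R)"
  using assms
proof (induction rule: converse_rtrancl_induct)
  case base
  show ?case by (intro exI[of _ "[a]"]) simp
next
  case (step x y)
  then obtain xs where xs: "xs \<noteq> []" "distinct xs" "hd xs = y" "last xs = a"
    "\<forall>i. Suc i < length xs \<longrightarrow> (xs ! i, xs ! Suc i) \<in> R" by blast
  show ?case
  proof (cases "x \<in> set xs")
    case True
    then obtain i where i: "i < length xs" "xs ! i = x" by (auto simp: in_set_conv_nth)
    then show ?thesis using xs
      by (intro exI[of _ "drop i xs"]) (auto simp: hd_drop_conv_nth)
  next
    case False
    have "((x # xs) ! i, (x # xs) ! Suc i) \<in> R" if "Suc i < length (x # xs)" for i
      using that xs step(1) by (cases i) (auto simp: hd_conv_nth)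
    then show ?thesis using xs False by (intro exI[of _ "x # xs"]) auto
  qed
qed

section \<open>Directed cycles\<close>

context oriented_matroid
begin

text \<open>Conformality is left out so that walks survive the maps applied to them;
  \<open>conformal_refine\<close> restores it.\<close>

definition RelU :: "'a \<Rightarrow> 'a \<Rightarrow> ('a svec \<times> 'a svec) set" where
  "RelU g f = {(X, Y). comod X Y \<and> X g = Pos \<and> Y g = Pos \<and> (\<exists>Z. dif (g, Pos) X Y Z
      \<and> Z f \<noteq> Neg)}"

lemma ev_Pos [simp]: "ev (g, Pos) X = X g"
  by (simp add: ev_def)

text \<open>Outside \<open>sep (negv X) Y\<close> the composition is the only value that the sum of
  signs permits, so the elimination in the definition of a program is the direction.\<close>

lemma elim_eq_dif:
  assumes XY: "comod X Y" and g: "g \<in> E" "X g = Pos" "Y g = Pos" and Z: "dif (g, Pos) X Y Z"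
  shows "elim C (negv X) Y g = Z"
  unfolding elim_def
proof (rule the_equality)
  have ss: "Z h = comp (negv X) Y h" if "h \<notin> sep (negv X) Y" for h
    using dif_ssum[OF Z, of h] that g
    by (cases "X h"; cases "Y h") (auto simp: comp_def sep_def ssum_def)
  show "Z \<in> C \<and> Z g = Zero \<and> (\<forall>h. h \<notin> sep (negv X) Y \<longrightarrow> Z h =
      comp (negv X) Y h)"
    using dif_in_C[OF XY Z] dif_zero[OF Z] g ss by auto
next
  fix W assume W: "W \<in> C \<and> W g = Zero \<and> (\<forall>h. h \<notin> sep (negv X) Y
      \<longrightarrow> W h = comp (negv X) Y h)"
  have "ssum (Y h) (sneg (X h)) (W h)" for h
    using W by (cases "X h"; cases "Y h") (auto simp: comp_def sep_def ssum_def)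
  moreover have "z X \<inter> z Y \<subseteq> z W"
    using W by (auto simp: in_z comp_def sep_def)
  ultimately have "dif (g, Pos) X Y W" using W g by (simp add: dif_def)
  then show "W = Z" using dif_unique[OF XY, of "(g, Pos)"] g Z by auto
qed

lemma arrow_sign_eq:
  "comod X Y \<Longrightarrow> g \<in> E \<Longrightarrow> X g = Pos \<Longrightarrow> Y g = Pos
      \<Longrightarrow> dif (g, Pos) X Y Z \<Longrightarrow> arrow_sign C g f X Y = Z f"
  by (simp add: arrow_sign_def elim_eq_dif)

lemma sep_finite: "X \<in> C \<Longrightarrow> finite (sep X Y)"
  using supp_E[of X] finE by (auto simp: sep_def supp_def intro: finite_subset)

text \<open>Eliminating \<open>h\<close> gives a point between \<open>X\<close> and
  \<open>Y\<close>. On their line the point with \<open>g\<close> zero is unique up to sign, and an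
  element vanishing at one end shows that both halves have the same sign as the whole.\<close>

lemma dif_between:
  assumes XY: "comod X Y" and g: "g \<in> E" "X g = Pos" "Y g = Pos" and Z: "dif (g, Pos) X Y Z"
    and h: "h \<in> sep X Y"
  obtains V where "V g = Pos" "comod X V" "comod V Y" "dif (g, Pos) X V Z" "dif (g, Pos) V Y Z"
    "sep X V \<subset> sep X Y" "sep V Y \<subset> sep X Y"
proof -
  let ?F = "z X \<inter> z Y"
  have X: "X \<in> C" "?F \<subseteq> z X" and Y: "Y \<in> C" "?F \<subseteq> z Y" and F: "line ?F" and ne:
      "X \<noteq> negv Y" "X \<noteq> Y"
    using XY by (auto simp: comod_def)
  have hs: "X h \<noteq> Zero" "Y h = sneg (X h)" using h by (auto simp: sep_def)
  obtain V where V: "V \<in> C" "?F \<subseteq> z V" "V h = Zero" "\<forall>k. ssum (X k) (Y k) (V k)"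
    using line_elim[OF F X Y ne(1) hs] by blast
  have Vg: "V g = Pos" using V(4)[rule_format, of g] g by (simp add: ssum_def)
  have neV: "X \<noteq> V" "X \<noteq> negv V" "V \<noteq> Y" "V \<noteq> negv Y" using V(3) hs by auto
  note XV = comodI[OF F X V(1,2) neV(1,2)] and VY = comodI[OF F V(1,2) Y neV(3,4)]
  have ZC: "Z \<in> C" using dif_in_C[OF XY Z] g by simp
  have gF: "g \<notin> ?F" using g by (simp add: in_z)
  obtain W where W: "dif (g, Pos) X V W" using dif_ex[OF XV(1), of "(g, Pos)"] by auto
  have WC: "W \<in> C" using dif_in_C[OF XV(1) W] g by simp
  obtain a where a: "X a = Zero" "Y a \<noteq> Zero" using comod_anchor[OF XY] by blast
  have "W a = Z a" "Z a \<noteq> Zero"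
    using dif_left[OF Z a(1)] dif_left[OF W a(1)] V(4)[rule_format, of a] a g by auto
  then have "W = Z"
    using line_point_unique[OF F g(1) gF WC _ _ ZC] dif_sub[OF Z] dif_sub[OF W] XV(2)
      dif_zero[OF Z] dif_zero[OF W] by auto
  then have d1: "dif (g, Pos) X V Z" using W by simp
  obtain W where W: "dif (g, Pos) V Y W" using dif_ex[OF VY(1), of "(g, Pos)"] by auto
  have WC: "W \<in> C" using dif_in_C[OF VY(1) W] g by simp
  obtain a where a: "Y a = Zero" "X a \<noteq> Zero" using comod_anchor[OF comod_sym[OF XY]] by blast
  have "W a = Z a" "Z a \<noteq> Zero"
    using dif_right[OF Z a(1)] dif_right[OF W a(1)] V(4)[rule_format, of a] a g by auto
  then have "W = Z"
    using line_point_unique[OF F g(1) gF WC _ _ ZC] dif_sub[OF Z] dif_sub[OF W] VY(2)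
      dif_zero[OF Z] dif_zero[OF W] by auto
  then have d2: "dif (g, Pos) V Y Z" using W by simp
  have "k \<in> sep X Y" if "k \<in> sep X V \<or> k \<in> sep V Y" for k
    using V(4)[rule_format, of k] that
    by (cases "X k"; cases "Y k"; cases "V k") (auto simp: sep_def ssum_def)
  moreover have "h \<notin> sep X V" "h \<notin> sep V Y" using V(3) hs by (auto simp: sep_def)
  ultimately have "sep X V \<subset> sep X Y" "sep V Y \<subset> sep X Y" using h by blast+
  then show thesis using that Vg XV(1) VY(1) d1 d2 by blast
qed

lemma conformal_refine:
  assumes "comod X Y" "g \<in> E" "X g = Pos" "Y g = Pos" "dif (g, Pos) X Y Z"
  shows "(X, Y) \<in> {(A, B). comod A B \<and> A g = Pos \<and> B g = Pos \<and> conformal A B \<and> dif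
      (g, Pos) A B Z}\<^sup>+"
  using assms
proof (induction "card (sep X Y)" arbitrary: X Y rule: less_induct)
  case less
  show ?case
  proof (cases "sep X Y = {}")
    case True
    then show ?thesis using less.prems by (intro r_into_trancl) (simp add: conformal_def)
  next
    case False
    then obtain h where h: "h \<in> sep X Y" by blast
    obtain V where V: "V g = Pos" "comod X V" "comod V Y" "dif (g, Pos) X V Z" "dif (g, Pos) V Y Z"
      "sep X V \<subset> sep X Y" "sep V Y \<subset> sep X Y"
      by (rule dif_between[OF less.prems h])
    have fin: "finite (sep X Y)" using less.prems(1) sep_finite by (simp add: comod_def)
    show ?thesis
      using less.hyps[OF psubset_card_mono[OF fin V(6)] V(2) less.prems(2,3) V(1,4)]
        less.hyps[OF psubset_card_mono[OF fin V(7)] V(3) less.prems(2) V(1) less.prems(4) V(5)]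
      by (rule trancl_trans)
  qed
qed

definition CRel :: "'a \<Rightarrow> 'a \<Rightarrow> ('a svec \<times> 'a svec) set" where
  "CRel g f = {(X, Y). (X, Y) \<in> RelU g f \<and> conformal X Y}"

lemma CRel_edge:
  assumes "(X, Y) \<in> CRel g f" "g \<in> E"
  shows "cg_edge E C g X Y \<and> arrow_sign C g f X Y \<in> {Pos, Zero}"
proof -
  obtain Z where Z: "comod X Y" "X g = Pos" "Y g = Pos" "conformal X Y" "dif (g, Pos) X Y Z" "Z f \<noteq> Neg"
    using assms by (auto simp: CRel_def RelU_def)
  then have "arrow_sign C g f X Y = Z f" using arrow_sign_eq assms by simp
  moreover have "Z f \<in> {Pos, Zero}" using Z(6) by (cases "Z f") auto
  ultimately show ?thesis
    using Z by (auto simp: cg_edge_def cg_vertex_def comodular_iff comod_def)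
qed

lemma RelU_subset_CRel:
  assumes "g \<in> E" shows "(RelU g f)\<^sup>* \<subseteq> (CRel g f)\<^sup>*"
proof -
  have "RelU g f \<subseteq> (CRel g f)\<^sup>*"
  proof clarify
    fix X Y assume "(X, Y) \<in> RelU g f"
    then obtain Z where Z: "comod X Y" "X g = Pos" "Y g = Pos" "dif (g, Pos) X Y Z" "Z f \<noteq> Neg"
      by (auto simp: RelU_def)
    have "{(A, B). comod A B \<and> A g = Pos \<and> B g = Pos \<and> conformal A B \<and> dif (g, Pos) A B
        Z} \<subseteq> CRel g f"
      using Z(5) by (auto simp: CRel_def RelU_def)
    then show "(X, Y) \<in> (CRel g f)\<^sup>*"
      using conformal_refine[OF Z(1) assms Z(2-4)]
      by (meson trancl_into_rtrancl trancl_mono)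
  qed
  then show ?thesis using rtrancl_subset_rtrancl by blast
qed

lemma directed_cycle_from_path:
  assumes AB: "(A, B) \<in> CRel g f" and str: "arrow_sign C g f A B = Pos" and BA: "(B, A) \<in> (CRel g
      f)\<^sup>*"
    and g: "g \<in> E"
  shows "\<exists>P n. directed_cycle E C g f P n"
proof -
  obtain xs where xs: "xs \<noteq> []" "distinct xs" "hd xs = B" "last xs = A"
    "\<forall>i. Suc i < length xs \<longrightarrow> (xs ! i, xs ! Suc i) \<in> CRel g f"
    using rtrancl_distinct_path[OF BA] by blast
  \<comment> \<open>The list \<open>xs\<close> runs from \<open>B\<close> to \<open>A\<close>, so
    prefixing \<open>A\<close> closes the cycle at index \<open>n\<close>; the shift by one is due
    to cycles being indexed from 1.\<close>
  define P where "P i = (A # xs) ! (i - 1)" for i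
  define n where "n = Suc (length xs)"
  have n: "2 \<le> n" using xs(1) by (cases xs) (auto simp: n_def)
  have P1: "P 1 = A" by (simp add: P_def)
  have Pn: "P n = A" using xs(1,4) by (simp add: P_def n_def last_conv_nth nth_Cons' )
  have edge: "(P i, P (Suc i)) \<in> CRel g f" if i: "i \<in> {1..<n}" for i
  proof -
    obtain j where j: "i = Suc j" using i by (cases i) auto
    show ?thesis
    proof (cases j)
      case 0
      then show ?thesis using AB xs(1,3) j by (simp add: P_def hd_conv_nth)
    next
      case (Suc k)
      then have "Suc k < length xs" using i j by (simp add: n_def)
      then show ?thesis using xs(5) j Suc by (simp add: P_def)
    qed
  qed
  have inj: "inj_on P {1..n-1}"
  proof (rule inj_onI)
    fix i j assume ij: "i \<in> {1..n-1}" "j \<in> {1..n-1}" "P i = P j"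
    \<comment> \<open>The first \<open>n - 1\<close> vertices are a rotation of \<open>xs\<close>,
      hence distinct.\<close>
    have "xs = butlast xs @ [A]" using xs(1,4) append_butlast_last_id[of xs] by simp
    then have ys: "distinct (A # butlast xs)" using xs(2) by (metis distinct.simps(2) distinct_append
      distinct1_rotate rotate1.simps(2))
    have P': "P k = (A # butlast xs) ! (k - 1)" if k: "k \<in> {1..n-1}" for k
    proof -
      have "k - 1 < length (A # butlast xs)" using k xs(1) by (auto simp: n_def)
      then show ?thesis by (cases "k - 1") (simp_all add: P_def nth_butlast)
    qed
    have "i - 1 < length (A # butlast xs)" "j - 1 < length (A # butlast xs)"
      using ij xs(1) by (auto simp: n_def)
    then have "i - 1 = j - 1" using ij(3) P'[OF ij(1)] P'[OF ij(2)] nth_eq_iff_index_eq[OF ys] by simp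
    then show "i = j" using ij by auto
  qed
  have "arrow_sign C g f (P 1) (P (Suc 1)) = Pos"
    using str xs(1,3) by (simp add: P_def hd_conv_nth)
  moreover have "(1::nat) \<in> {1..<n}" using n by simp
  ultimately have "\<exists>i\<in>{1..<n}. arrow_sign C g f (P i) (P (Suc i)) = Pos" by (rule bexI)
  moreover have "\<forall>i\<in>{1..<n}. cg_edge E C g (P i) (P (Suc i)) \<and> arrow_sign C g f (P i) (P
      (Suc i)) \<in> {Pos, Zero}"
    using CRel_edge[OF edge g] by (rule ballI)
  moreover have "P n = P 1" using P1 Pn by simp
  ultimately have "directed_cycle E C g f P n"
    unfolding directed_cycle_def using n inj by (intro conjI)
  then show ?thesis by blast
qed

lemma euclidean_program_acyclic:
  assumes eu: "euclidean_program E C g f" and g: "g \<in> E" and XY: "(X, Y) \<in> cyc (RelU g f)"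
    and Z: "dif (g, Pos) X Y Z"
  shows "Z f = Zero"
proof (rule ccontr)
  assume nz: "Z f \<noteq> Zero"
  have XY': "(X, Y) \<in> RelU g f" "(Y, X) \<in> (RelU g f)\<^sup>*" using XY by (auto simp: cyc_def)
  then obtain W where W: "comod X Y" "X g = Pos" "Y g = Pos" "dif (g, Pos) X Y W" "W f \<noteq> Neg"
    by (auto simp: RelU_def)
  have "Z = W" using dif_unique[OF W(1), of "(g, Pos)"] g Z W(4) by auto
  then have Zf: "Z f = Pos" using nz W(5) by (cases "Z f") auto
  let ?S = "{(A, B). comod A B \<and> A g = Pos \<and> B g = Pos \<and> conformal A B \<and> dif (g, Pos) A
      B Z}"
  have sub: "?S \<subseteq> CRel g f" using Zf by (auto simp: CRel_def RelU_def)
  \<comment> \<open>The first conformal piece has the direction of the whole edge and inherits its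
    strict orientation.\<close>
  obtain V where V: "(X, V) \<in> ?S" "(V, Y) \<in> ?S\<^sup>*"
    using tranclD[OF conformal_refine[OF W(1) g W(2,3) Z]] by (elim exE conjE)
  have "(V, Y) \<in> (CRel g f)\<^sup>*" using V(2) rtrancl_mono[OF sub] by blast
  moreover have "(Y, X) \<in> (CRel g f)\<^sup>*" using XY'(2) RelU_subset_CRel[OF g] by blast
  ultimately have "(V, X) \<in> (CRel g f)\<^sup>*" by (rule rtrancl_trans)
  moreover have "arrow_sign C g f X V = Pos" using V(1) Zf arrow_sign_eq[of X V g Z f] g by auto
  moreover have "(X, V) \<in> CRel g f" using V(1) sub by blast
  ultimately show False
    using directed_cycle_from_path g eu by (auto simp: euclidean_program_def)
qed

lemma acyclic_euclidean_program:
  assumes ac: "\<And>X Y Z. (X, Y) \<in> cyc (RelU g f) \<Longrightarrow> dif (g, Pos) X Y Z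
      \<Longrightarrow> Z f = Zero"
    and g: "g \<in> E"
  shows "euclidean_program E C g f"
  unfolding euclidean_program_def
proof clarify
  fix P n assume "directed_cycle E C g f P n"
  then have d: "P n = P 1" and e: "\<And>i. i \<in> {1..<n} \<Longrightarrow> cg_edge E C g (P i) (P (Suc i))
           \<and> arrow_sign C g f (P i) (P (Suc i)) \<in> {Pos, Zero}"
    and s: "\<exists>i\<in>{1..<n}. arrow_sign C g f (P i) (P (Suc i)) = Pos"
    unfolding directed_cycle_def by (elim conjE; blast)+
  have edge: "(P i, P (Suc i)) \<in> RelU g f" if i: "i \<in> {1..<n}" for i
  proof -
    have c: "comod (P i) (P (Suc i))" "P i g = Pos" "P (Suc i) g = Pos"
      using e[OF i] by (auto simp: cg_edge_def cg_vertex_def comodular_iff)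
    obtain Z where Z: "dif (g, Pos) (P i) (P (Suc i)) Z" using dif_ex[OF c(1), of "(g, Pos)"] by auto
    then have "Z f \<noteq> Neg" using e[OF i] arrow_sign_eq[OF c(1) g c(2,3) Z, of f] by auto
    then show ?thesis using c Z by (auto simp: RelU_def)
  qed
  have path: "(P i, P j) \<in> (RelU g f)\<^sup>*" if "1 \<le> i" "i \<le> j" "j \<le> n" for i j
    using that(2,3)
  proof (induction j rule: dec_induct)
    case (step k)
    then show ?case using edge[of k] that(1) by (auto intro: rtrancl.rtrancl_into_rtrancl)
  qed simp
  obtain i where i: "i \<in> {1..<n}" "arrow_sign C g f (P i) (P (Suc i)) = Pos" using s by blast
  have "(P (Suc i), P n) \<in> (RelU g f)\<^sup>*" "(P 1, P i) \<in> (RelU g f)\<^sup>*" using i path by auto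
  then have "(P (Suc i), P i) \<in> (RelU g f)\<^sup>*" using d by (metis rtrancl_trans)
  then have "(P i, P (Suc i)) \<in> cyc (RelU g f)" using edge[OF i(1)] by (simp add: cyc_def)
  moreover have c: "comod (P i) (P (Suc i))" "P i g = Pos" "P (Suc i) g = Pos"
    using edge[OF i(1)] by (auto simp: RelU_def)
  moreover obtain Z where Z: "dif (g, Pos) (P i) (P (Suc i)) Z" using dif_ex[OF c(1), of "(g, Pos)"] by auto
  ultimately show False using ac[OF _ Z] arrow_sign_eq[OF c(1) g c(2,3) Z, of f] i(2) by simp
qed

lemma euclidean_OM_acyclic:
  assumes eu: "euclidean_OM E C" and g: "g \<in> E" and f: "f \<in> E" and XY: "(X, Y) \<in> cyc (RelU g f)"
    and Z: "dif (g, Pos) X Y Z"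
  shows "Z f = Zero"
proof -
  have c: "comod X Y" "X g = Pos" "Y g = Pos" using XY by (auto simp: cyc_def RelU_def)
  consider "g = f" | "g \<noteq> f" "is_coloop C f" | "g \<noteq> f" "\<not> is_coloop C f" by blast
  then show ?thesis
  proof cases
    case 1 then show ?thesis using dif_zero[OF Z] by simp
  next
    case 2
    then obtain Q where Q: "Q \<in> C" "supp Q = {f}" by (auto simp: is_coloop_def)
    \<comment> \<open>A vertex nonzero at the coloop \<open>f\<close> would be, up to sign, the
      cocircuit supported on \<open>f\<close> alone, which vanishes at \<open>g\<close>.\<close>
    have "V f = Zero" if V: "V \<in> C" "V g = Pos" for V
    proof (rule ccontr)
      assume "V f \<noteq> Zero"
      then have "Q = V \<or> Q = negv V" using supp_subset_eq[OF Q(1) V(1)] Q(2) by (simp add: supp_def)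
      then have "supp V = {f}" using Q(2) by (metis supp_negv)
      moreover have "g \<in> supp V" using V by (simp add: supp_def)
      ultimately show False using 2 by simp
    qed
    then have "X f = Zero" "Y f = Zero" using c by (auto simp: comod_def)
    then show ?thesis using dif_ssum[OF Z, of f] by simp
  next
    case 3
    have "X \<in> C" "X g \<noteq> Zero" using c by (auto simp: comod_def)
    then have "\<not> is_loop C g" unfolding is_loop_def by blast
    then have "euclidean_program E C g f"
      using eu om 3 g f by (auto simp: euclidean_OM_def is_program_def)
    then show ?thesis using euclidean_program_acyclic g XY Z by blast
  qed
qed

end

section \<open>Acyclicity for signed elements\<close>

context oriented_matroid
begin

text \<open>The predicate \<open>Ed\<close> restricts the admissible edges; the levels of the
  induction differ only in this predicate.\<close>

definition RelG :: "('a svec \<Rightarrow> 'a svec \<Rightarrow> bool) \<Rightarrow> 'a \<times> sign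
    \<Rightarrow> 'a \<times> sign \<Rightarrow> ('a svec \<times> 'a svec) set" where
  "RelG Ed G H = {(X, Y). comod X Y \<and> Ed X Y \<and> ev G X = Pos \<and> ev G Y = Pos
     \<and> (\<exists>Z. dif G X Y Z \<and> ev H Z \<noteq> Neg)}"

definition acyc :: "('a svec \<Rightarrow> 'a svec \<Rightarrow> bool) \<Rightarrow> 'a \<times> sign
    \<Rightarrow> 'a \<times> sign \<Rightarrow> bool" where
  "acyc Ed G H \<longleftrightarrow> (\<forall>X Y Z. (X, Y) \<in> cyc (RelG Ed G H) \<longrightarrow> dif
      G X Y Z \<longrightarrow> ev H Z = Zero)"

lemma cyc_mono: "R \<subseteq> S \<Longrightarrow> cyc R \<subseteq> cyc S"
  using rtrancl_mono[of R S] by (auto simp: cyc_def)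

lemma acyc_mono:
  assumes "acyc Ed G H" "\<And>X Y. Ed' X Y \<Longrightarrow> Ed X Y"
  shows "acyc Ed' G H"
proof -
  have "RelG Ed' G H \<subseteq> RelG Ed G H" using assms(2) by (auto simp: RelG_def)
  from cyc_mono[OF this] show ?thesis using assms(1) unfolding acyc_def by blast
qed

lemma cyclic_in_cyc:
  assumes R: "cyclic_rel R" and map: "\<And>x y. (x, y) \<in> R \<Longrightarrow> (\<phi> x, \<phi> y)
      \<in> S\<^sup>*"
    and xy: "(x, y) \<in> R" "(\<phi> x, \<phi> y) \<in> S"
  shows "(\<phi> x, \<phi> y) \<in> cyc S"
  using cyclic_path[where \<phi> = \<phi>, OF R map r_into_rtrancl[OF xy(1)]] xy(2) by (simp add: cyc_def)

text \<open>Acyclicity is applied to the image of a cyclic relation under \<open>\<phi>\<close>.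
  Collapsing steps do no harm, and \<open>s = Neg\<close> covers a map that reverses heights, since
  the reversed relation is cyclic as well.\<close>

lemma acycD:
  assumes ac: "acyc Ed G H" and sym: "\<And>X Y. Ed X Y \<Longrightarrow> Ed Y X" and R: "cyclic_rel R" and
      s: "s \<noteq> Zero"
    and map: "\<And>x y. (x, y) \<in> R \<Longrightarrow> \<phi> x \<noteq> \<phi> y \<Longrightarrow>
        comod (\<phi> x) (\<phi> y) \<and> Ed (\<phi> x) (\<phi> y)
      \<and> ev G (\<phi> x) = Pos \<and> ev G (\<phi> y) = Pos \<and> (\<exists>Z. dif G (\<phi> x)
          (\<phi> y) Z \<and> smult s (ev H Z) \<noteq> Neg)"
    and xy: "(x, y) \<in> R" "\<phi> x \<noteq> \<phi> y" and Z: "dif G (\<phi> x) (\<phi> y) Z"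
  shows "ev H Z = Zero"
proof (cases "s = Pos")
  case True
  have edge: "(\<phi> x, \<phi> y) \<in> RelG Ed G H" if "(x, y) \<in> R" "\<phi> x \<noteq> \<phi> y" for x y
    using map[OF that] True by (simp add: RelG_def)
  have path: "(\<phi> x, \<phi> y) \<in> (RelG Ed G H)\<^sup>*" if "(x, y) \<in> R" for x y
    using edge[OF that] by (cases "\<phi> x = \<phi> y") auto
  have "(\<phi> x, \<phi> y) \<in> cyc (RelG Ed G H)"
    by (rule cyclic_in_cyc[where \<phi> = \<phi>, OF R path xy(1) edge[OF xy]])
  then show ?thesis using ac Z unfolding acyc_def by blast
next
  case False
  then have sN: "s = Neg" using s by (cases s) auto
  have edge: "(\<phi> y, \<phi> x) \<in> RelG Ed G H" if xy: "(x, y) \<in> R" "\<phi> x \<noteq> \<phi> y"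
      for x y
  proof -
    obtain Z where Z: "dif G (\<phi> x) (\<phi> y) Z" "smult s (ev H Z) \<noteq> Neg" using map[OF xy] by blast
    have "ev H (negv Z) \<noteq> Neg" using Z(2) sN by simp
    then show ?thesis using map[OF xy] dif_negv[OF Z(1)] comod_sym sym by (auto simp: RelG_def)
  qed
  have path: "(\<phi> x, \<phi> y) \<in> (RelG Ed G H)\<^sup>*" if "(x, y) \<in> R\<inverse>" for x y
    using edge[of y x] that by (cases "\<phi> x = \<phi> y") auto
  have yx: "(y, x) \<in> R\<inverse>" using xy by simp
  have "(\<phi> y, \<phi> x) \<in> cyc (RelG Ed G H)"
    by (rule cyclic_in_cyc[where \<phi> = \<phi>, OF cyclic_rel_converse[OF R] path yx edge[OF xy]])
  then have "ev H (negv Z) = Zero" using ac dif_negv[OF Z] unfolding acyc_def by blast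
  then show ?thesis by simp
qed

lemma comod_scal: "s \<noteq> Zero \<Longrightarrow> comod X Y \<Longrightarrow> comod (scal s X) (scal s Y)"
proof (cases s)
  case Neg
  assume "comod X Y"
  moreover have "scal s V = negv V" for V using Neg by (simp add: scal_def negv_def)
  ultimately show ?thesis using negv_C[of X] negv_C[of Y] by (simp add: comod_def) (metis negv_negv)
qed (simp_all add: scal_def)

lemma dif_scal:
  assumes d: "dif (g, s) X Y Z" and s: "s \<noteq> Zero"
  shows "dif (g, Pos) (scal s X) (scal s Y) (scal s Z)"
proof -
  have "ssum (smult (scal s X g) (scal s Y h)) (sneg (smult (scal s Y g) (scal s X h))) (scal s Z h)" for h
    using ssum_scale[OF dif_ssum[OF d, of h], of s] s
    by (cases s) (simp_all add: scal_def ev_def)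
  moreover have "scal s Z = zerovec \<or> scal s Z \<in> C"
  proof (cases "Z = zerovec")
    case True then show ?thesis by (simp add: scal_def zerovec_def)
  next
    case False then show ?thesis using d scal_C[OF s] by (simp add: dif_def)
  qed
  moreover have "z (scal s X) \<inter> z (scal s Y) \<subseteq> z (scal s Z)"
    using dif_sub[OF d] by (simp add: z_scal[OF s])
  moreover have "scal s Z g = Zero" using dif_zero[OF d] by (simp add: scal_def)
  ultimately show ?thesis by (simp add: dif_def)
qed

text \<open>Scaling every point by \<open>s\<close> turns the reoriented \<open>g\<close> into
  \<open>g\<close> and multiplies directions by \<open>s\<close>; the remaining sign is absorbed in
  \<open>acycD\<close>.\<close>

lemma acyc_signed:
  assumes ac: "acyc Ed (g, Pos) (f, Pos)" and sym: "\<And>X Y. Ed X Y \<Longrightarrow> Ed Y X"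
    and sc: "\<And>X Y. Ed X Y \<Longrightarrow> Ed (negv X) (negv Y)" and st: "s \<noteq> Zero" "t
        \<noteq> Zero"
  shows "acyc Ed (g, s) (f, t)"
  unfolding acyc_def
proof (intro allI impI)
  fix X Y Z assume XY: "(X, Y) \<in> cyc (RelG Ed (g, s) (f, t))" and Z: "dif (g, s) X Y Z"
  have cm: "comod X Y" using XY by (auto simp: cyc_def RelG_def)
  have "ev (f, Pos) (scal s Z) = Zero"
  proof (rule acycD[where \<phi> = "scal s" and s = "smult s t", OF ac sym cyclic_cyc[of "RelG Ed (g, s)
      (f, t)"] _ _ XY])
    show "smult s t \<noteq> Zero" using st by simp
    have "comod (scal s X) (scal s Y)" by (rule comod_scal[OF st(1) cm])
    then show "scal s X \<noteq> scal s Y" by (simp add: comod_def)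
    show "dif (g, Pos) (scal s X) (scal s Y) (scal s Z)" by (rule dif_scal[OF Z st(1)])
    fix X Y assume "(X, Y) \<in> cyc (RelG Ed (g, s) (f, t))"
    then obtain Z where *: "comod X Y" "Ed X Y" "ev (g, s) X = Pos" "ev (g, s) Y = Pos"
      "dif (g, s) X Y Z" "ev (f, t) Z \<noteq> Neg" by (auto simp: cyc_def RelG_def)
    have Ed: "Ed (scal s X) (scal s Y)"
      using *(2) sc[OF *(2)] st(1) by (cases s) (simp_all add: scal_def negv_def)
    have ev: "ev (g, Pos) (scal s V) = ev (g, s) V" for V by (simp add: ev_def scal_def)
    have "smult (smult s t) (ev (f, Pos) (scal s Z)) = ev (f, t) Z"
      using st by (cases s; cases t; cases "Z f") (simp_all add: ev_def scal_def)
    then show "comod (scal s X) (scal s Y) \<and> Ed (scal s X) (scal s Y) \<and> ev (g, Pos) (scal s X) = Pos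
        \<and> ev (g, Pos) (scal s Y) = Pos \<and> (\<exists>Z. dif (g, Pos) (scal s X) (scal s Y) Z
        \<and> smult (smult s t) (ev (f, Pos) Z) \<noteq> Neg)"
      using * Ed ev comod_scal[OF st(1) *(1)] dif_scal[OF *(5) st(1)] by auto
  qed
  then show "ev (f, t) Z = Zero" using st by (simp add: ev_def scal_def)
qed

end

section \<open>Single-element extensions\<close>

locale extension = oriented_matroid E C for E :: "'a set" and C +
  fixes p :: 'a and D :: "'a svec set" and \<sigma> :: "'a svec \<Rightarrow> sign"
  assumes pE: "p \<in> E" and omD: "OM (E - {p}) D" and del: "deletion C p = D"
    and lift: "Y \<in> D \<Longrightarrow> Y(p := \<sigma> Y) \<in> C"
begin

sublocale old: oriented_matroid "E - {p}" D
  by unfold_locales (rule omD)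

text \<open>A flat with \<^term>\<open>p \<in> A \<longrightarrow> p \<in> cl (A - {p})\<close> has the
    same corank in the old oriented matroid;
  the other flats are those created by \<^term>\<open>p\<close>.\<close>

definition goodS :: "'a set \<Rightarrow> 'a set \<Rightarrow> bool" where
  "goodS S A \<longleftrightarrow> (p \<in> A \<longrightarrow> p \<in> cl (A - {p}) \<or> S \<subseteq> A)"

definition EdS :: "'a set \<Rightarrow> 'a svec \<Rightarrow> 'a svec \<Rightarrow> bool" where
  "EdS S X Y \<longleftrightarrow> goodS S (z X) \<and> goodS S (z Y) \<and> goodS S (z X \<inter> z Y)"

definition oldset :: "'a set \<Rightarrow> bool" where
  "oldset A \<longleftrightarrow> (p \<in> A \<longrightarrow> p \<in> cl (A - {p}))"

definition Edold :: "'a svec \<Rightarrow> 'a svec \<Rightarrow> bool" where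
  "Edold X Y \<longleftrightarrow> oldset (z X) \<and> oldset (z Y) \<and> oldset (z X \<inter> z Y)"

lemma old_z: "old.z (X(p := s)) = z X - {p}"
  by (auto simp: in_z old.in_z split: if_splits)

lemma z_upd: "A - {p} \<subseteq> z (V(p := s)) \<longleftrightarrow> A - {p} \<subseteq> z V"
  by (auto simp: subset_iff in_z)

lemma old_p: "V \<in> D \<Longrightarrow> V p = Zero"
  using old.outside by simp

text \<open>If some restriction had strictly smaller support, \<open>min\<close> would make the full
  supports nested, hence equal.\<close>

lemma restrictI:
  assumes X: "X \<in> C" and nz: "\<exists>h. h \<noteq> p \<and> X h \<noteq> Zero"
    and min: "\<And>Y. Y \<in> C \<Longrightarrow> supp Y - {p} \<subseteq> supp X \<Longrightarrow>
        \<exists>h. h \<noteq> p \<and> Y h \<noteq> Zero \<Longrightarrow> supp Y \<subseteq> supp X"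
  shows "X(p := Zero) \<in> D"
proof -
  have supp': "supp (Y(p := Zero)) = supp Y - {p}" for Y :: "'a svec" by (auto simp: supp_def)
  have "\<not> supp (Y(p := Zero)) \<subset> supp (X(p := Zero))" if Y: "Y \<in> C" "Y(p := Zero) \<noteq>
      zerovec" for Y
  proof
    assume a: "supp (Y(p := Zero)) \<subset> supp (X(p := Zero))"
    have "\<exists>h. h \<noteq> p \<and> Y h \<noteq> Zero" using Y(2) by (auto simp: fun_eq_iff split:
        if_splits)
    then have "supp Y \<subseteq> supp X" using min[OF Y(1)] a supp' by auto
    then have "supp Y = supp X" using supp_subset_eq[OF Y(1) X] by (metis supp_negv)
    then show False using a supp' by simp
  qed
  moreover have "X(p := Zero) \<noteq> zerovec" using nz by (auto simp: fun_eq_iff)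
  ultimately show ?thesis using X unfolding del[symmetric] deletion_def Let_def by blast
qed

text \<open>The lift of the restriction has its support inside that of \<open>X\<close>, so it is
  \<open>X\<close> or its negative; a nonzero entry away from \<open>p\<close> decides for
  \<open>X\<close>.\<close>

lemma restrict_nonzero:
  assumes X: "X \<in> C" "X p \<noteq> Zero" and nz: "\<exists>h. h \<noteq> p \<and> X h \<noteq> Zero"
  shows "X(p := Zero) \<in> D" "\<sigma> (X(p := Zero)) = X p"
proof -
  show D: "X(p := Zero) \<in> D"
    by (rule restrictI[OF X(1) nz]) (use X(2) in \<open>auto simp: supp_def\<close>)
  let ?V = "X(p := \<sigma> (X(p := Zero)))"
  have V: "?V \<in> C" using lift[OF D] by simp
  have "supp ?V \<subseteq> supp X" using X(2) by (auto simp: supp_def)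
  then have "?V = X \<or> ?V = negv X" by (rule supp_subset_eq[OF V X(1)])
  moreover have "?V \<noteq> negv X"
  proof
    assume "?V = negv X"
    moreover obtain h where "h \<noteq> p" "X h \<noteq> Zero" using nz by blast
    ultimately have "X h = sneg (X h)" by (metis fun_upd_other negv_apply)
    then show False using \<open>X h \<noteq> Zero\<close> by simp
  qed
  ultimately have "?V = X" by blast
  then show "\<sigma> (X(p := Zero)) = X p" by (metis fun_upd_same)
qed

lemma restrict_old_zero:
  assumes X: "X \<in> C" "X p = Zero" "p \<in> cl (z X - {p})"
  shows "X \<in> D" "\<sigma> X = Zero"
proof -
  have upd: "X(p := Zero) = X" using X(2) by (simp add: fun_upd_idem)
  have nz: "\<exists>h. h \<noteq> p \<and> X h \<noteq> Zero" using nonzero_point[OF X(1)] X(2) by metis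
  have "X(p := Zero) \<in> D"
  proof (rule restrictI[OF X(1) nz])
    fix Y assume Y: "Y \<in> C" "supp Y - {p} \<subseteq> supp X"
    have "z X - {p} \<subseteq> z Y" using Y(2) by (auto simp: zset_def)
    then have "p \<in> z Y" using z_cl[OF Y(1)] X(3) by blast
    then show "supp Y \<subseteq> supp X" using Y(2) by (auto simp: zset_def)
  qed
  then show D: "X \<in> D" using upd by simp
  have V: "X(p := \<sigma> X) \<in> C" using lift[OF D] .
  have "z X - {p} \<subseteq> z (X(p := \<sigma> X))" using z_upd by blast
  then have "p \<in> z (X(p := \<sigma> X))" using z_cl[OF V] X(3) by blast
  then show "\<sigma> X = Zero" by (simp add: in_z)
qed

text \<open>An old point through the meet lifts to a point through the meet, where \<open>H\<close>
  takes care of the element \<open>p\<close>. So the criterion \<open>comod_char\<close> for the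
  deletion can be checked on the line of the extension.\<close>

lemma transfer_comod:
  assumes XY: "comod X Y" and XD: "X(p := Zero) \<in> D" and YD: "Y(p := Zero) \<in> D"
    and H: "\<And>V. V \<in> D \<Longrightarrow> (z X \<inter> z Y) - {p} \<subseteq> z V \<Longrightarrow>
        p \<in> z X \<inter> z Y \<Longrightarrow> \<sigma> V = Zero"
  shows "old.comod (X(p := Zero)) (Y(p := Zero))"
proof -
  have X: "X \<in> C" and Y: "Y \<in> C" and F: "line (z X \<inter> z Y)" and ne: "X \<noteq> Y" "X
      \<noteq> negv Y"
    using XY by (auto simp: comod_def)
  have diffp: "\<not> (supp X - {p} = supp Y - {p})"
  proof
    assume "supp X - {p} = supp Y - {p}"
    then have "supp X \<subseteq> supp Y \<or> supp Y \<subseteq> supp X" by blast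
    then have "X = Y \<or> X = negv Y" using supp_subset_eq[OF X Y] supp_subset_eq[OF Y X] by (metis negv_negv)
    then show False using ne by blast
  qed
  have supp': "supp (Y(p := Zero)) = supp Y - {p}" for Y :: "'a svec" by (auto simp: supp_def)
  show ?thesis
  proof (rule old.comod_char[OF XD YD])
    show "X(p := Zero) \<noteq> Y(p := Zero)" using diffp supp' by metis
    show "X(p := Zero) \<noteq> negv (Y(p := Zero))" using diffp supp' supp_negv by metis
    fix V assume V: "V \<in> D" "old.z (X(p := Zero)) \<inter> old.z (Y(p := Zero)) \<subseteq> old.z V"
      "V \<noteq> X(p := Zero)" "V \<noteq> negv (X(p := Zero))"
    let ?V = "V(p := \<sigma> V)"
    have VC: "?V \<in> C" using lift[OF V(1)] .
    have VV: "?V(p := Zero) = V" using old_p[OF V(1)] by (simp add: fun_upd_idem)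
    have zV: "old.z V = z ?V - {p}" using old_z[of ?V Zero] VV by simp
    have sub: "(z X \<inter> z Y) - {p} \<subseteq> z ?V" using V(2) zV old_z by auto
    have "(z X \<inter> z Y) - {p} \<subseteq> z V" using sub z_upd by blast
    from H[OF V(1) this] have "p \<in> z X \<inter> z Y \<Longrightarrow> p \<in> z ?V" by (auto simp: in_z)
    then have FV: "z X \<inter> z Y \<subseteq> z ?V" using sub by blast
    have "?V \<noteq> X" using V(3) VV by auto
    moreover have "?V \<noteq> negv X"
    proof
      assume "?V = negv X"
      then have "V = (negv X)(p := Zero)" using VV by simp
      also have "\<dots> = negv (X(p := Zero))" by (auto simp: fun_eq_iff)
      finally show False using V(4) by simp
    qed
    ultimately have "z ?V \<inter> z X = z X \<inter> z Y" using line_inter[OF F VC X FV] by simp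
    then show "old.z V \<inter> old.z (X(p := Zero)) \<subseteq> old.z (Y(p := Zero))" using zV old_z by auto
  qed
qed

lemma transfer_dif:
  assumes Z: "dif (g, Pos) X Y Z" and g: "g \<noteq> p" and ZD: "Z(p := Zero) \<in> D"
  shows "old.dif (g, Pos) (X(p := Zero)) (Y(p := Zero)) (Z(p := Zero))"
proof -
  have "ssum (smult (X g) (Y h)) (sneg (smult (Y g) (X h))) (Z h)" for h
    using dif_ssum[OF Z, of h] by simp
  then show ?thesis
    using g ZD dif_sub[OF Z] dif_zero[OF Z] by (auto simp: old.dif_def old_z)
qed

lemma transfer_acyc:
  assumes eu: "euclidean_OM (E - {p}) D" and gf: "g \<in> E - {p}" "f \<in> E - {p}"
    and tr: "\<And>X Y Z. comod X Y \<Longrightarrow> Ed X Y \<Longrightarrow> X g = Pos \<Longrightarrow>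
        Y g = Pos \<Longrightarrow> dif (g, Pos) X Y Z \<Longrightarrow>
      X(p := Zero) \<in> D \<and> Y(p := Zero) \<in> D \<and> Z(p := Zero) \<in> D \<and>
      (\<forall>V\<in>D. (z X \<inter> z Y) - {p} \<subseteq> z V \<longrightarrow> p \<in> z X \<inter> z
          Y \<longrightarrow> \<sigma> V = Zero)"
  shows "acyc Ed (g, Pos) (f, Pos)"
  unfolding acyc_def
proof (intro allI impI)
  let ?r = "\<lambda>X::'a svec. X(p := Zero)" and ?R = "RelG Ed (g, Pos) (f, Pos)"
  fix X Y Z assume XY: "(X, Y) \<in> cyc ?R" and Z: "dif (g, Pos) X Y Z"
  have edge: "(?r X, ?r Y) \<in> old.RelU g f" if XY: "(X, Y) \<in> ?R" for X Y
  proof -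
    obtain Z where *: "comod X Y" "Ed X Y" "X g = Pos" "Y g = Pos" "dif (g, Pos) X Y Z" "Z f \<noteq> Neg"
      using XY by (auto simp: RelG_def)
    note t = tr[OF *(1-5)]
    have "old.comod (?r X) (?r Y)" using transfer_comod[OF *(1)] t by blast
    moreover have "old.dif (g, Pos) (?r X) (?r Y) (?r Z)" using transfer_dif[OF *(5)] t gf by blast
    ultimately show ?thesis using * gf by (auto simp: old.RelU_def)
  qed
  have cR: "(x, y) \<in> cyc ?R \<Longrightarrow> (x, y) \<in> ?R" for x y using cyc_subset[of ?R] by blast
  have "(?r X, ?r Y) \<in> cyc (old.RelU g f)"
    by (rule cyclic_in_cyc[where \<phi> = ?r, OF cyclic_cyc _ XY edge]) (use edge cR XY in blast)+
  moreover have "old.dif (g, Pos) (?r X) (?r Y) (?r Z)"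
    using transfer_dif[OF Z] tr[OF _ _ _ _ Z] cR[OF XY] gf by (auto simp: RelG_def)
  ultimately have "?r Z f = Zero" using old.euclidean_OM_acyclic[OF eu gf] by blast
  then show "ev (f, Pos) Z = Zero" using gf by simp
qed

lemma Edold_negv: "Edold X Y \<Longrightarrow> Edold (negv X) (negv Y)"
  by (simp add: Edold_def)

lemma Edold_sym: "Edold X Y \<Longrightarrow> Edold Y X"
  by (simp add: Edold_def Int_commute)

lemma EdS_sym: "EdS S X Y \<Longrightarrow> EdS S Y X"
  by (simp add: EdS_def Int_commute)

text \<open>If \<open>p\<close> is on the old line, it is spanned there without itself; otherwise
  the line and \<open>fst G\<close> span the direction without \<open>p\<close>.\<close>

lemma oldset_dif:
  assumes XY: "comod X Y" and F: "oldset (z X \<inter> z Y)" and g: "fst G \<in> E - {p}" "snd G \<noteq> Zero"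
    and X: "ev G X = Pos" and Z: "dif G X Y Z"
  shows "Z \<in> C" "oldset (z Z)"
proof -
  let ?F = "z X \<inter> z Y"
  show ZC: "Z \<in> C" using dif_in_C[OF XY Z] X by simp
  have gF: "fst G \<notin> ?F" using X g by (auto simp: in_z ev_def)
  have lF: "line ?F" using XY by (simp add: comod_def)
  show "oldset (z Z)"
    unfolding oldset_def
  proof
    assume p: "p \<in> z Z"
    have sub: "insert (fst G) ?F \<subseteq> z Z" using dif_sub[OF Z] dif_zero[OF Z] g by (auto simp: in_z)
    show "p \<in> cl (z Z - {p})"
    proof (cases "p \<in> ?F")
      case True
      then have "p \<in> cl (?F - {p})" using F by (simp add: oldset_def)
      moreover have "?F - {p} \<subseteq> z Z - {p}" using sub by blast
      ultimately show ?thesis using cl_mono[of "?F - {p}" "z Z - {p}"] by blast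
    next
      case False
      have "cl (insert (fst G) ?F) = z Z" using line_insert[OF lF _ gF ZC sub] g by blast
      moreover have "insert (fst G) ?F \<subseteq> z Z - {p}" using sub False g by auto
      ultimately show ?thesis using cl_mono[of "insert (fst G) ?F" "z Z - {p}"] p by blast
    qed
  qed
qed

end

text \<open>Excludes that \<open>p\<close> is a coloop; that case is
  \<open>euclidean_coloop\<close>.\<close>

locale nondegenerate_extension = extension +
  assumes nocoloop: "X \<in> C \<Longrightarrow> \<exists>h. h \<noteq> p \<and> X h \<noteq> Zero"
begin

lemma restrict_old:
  assumes "X \<in> C" "oldset (z X)"
  shows "X(p := Zero) \<in> D" "\<sigma> (X(p := Zero)) = X p"
proof -
  have "X(p := Zero) \<in> D \<and> \<sigma> (X(p := Zero)) = X p"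
  proof (cases "X p = Zero")
    case True
    then have "p \<in> cl (z X - {p})" using assms pE by (simp add: oldset_def in_z)
    from restrict_old_zero[OF assms(1) True this] True show ?thesis by (simp add: fun_upd_idem)
  next
    case False
    then show ?thesis using restrict_nonzero[OF assms(1) False nocoloop[OF assms(1)]] by blast
  qed
  then show "X(p := Zero) \<in> D" "\<sigma> (X(p := Zero)) = X p" by auto
qed

text \<open>Walks through old points along old lines restrict to walks of the deletion, directions
  included.\<close>

lemma acyc_old:
  assumes eu: "euclidean_OM (E - {p}) D" and G: "fst G \<in> E - {p}" "snd G \<noteq> Zero"
    and H: "fst H \<in> E - {p}" "snd H \<noteq> Zero"
  shows "acyc Edold G H"
proof -
  have "acyc Edold (fst G, Pos) (fst H, Pos)"
  proof (rule transfer_acyc[OF eu G(1) H(1)])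
    fix X Y Z assume *: "comod X Y" "Edold X Y" "X (fst G) = Pos" "Y (fst G) = Pos"
      "dif (fst G, Pos) X Y Z"
    have X: "X \<in> C" "Y \<in> C" using *(1) by (auto simp: comod_def)
    have o: "oldset (z X)" "oldset (z Y)" "oldset (z X \<inter> z Y)" using *(2) by (auto simp: Edold_def)
    have Z: "Z \<in> C" "oldset (z Z)" using oldset_dif[OF *(1) o(3) _ _ _ *(5)] G *(3) by auto
    have "\<sigma> V = Zero" if V: "V \<in> D" "(z X \<inter> z Y) - {p} \<subseteq> z V" "p \<in> z X
        \<inter> z Y" for V
    proof -
      let ?V = "V(p := \<sigma> V)"
      have VC: "?V \<in> C" using lift[OF V(1)] .
      have "(z X \<inter> z Y) - {p} \<subseteq> z ?V" using V(2) z_upd by blast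
      then have "p \<in> z ?V" using z_cl[OF VC] o(3) V(3) unfolding oldset_def by blast
      then show ?thesis by (simp add: in_z)
    qed
    then show "X(p := Zero) \<in> D \<and> Y(p := Zero) \<in> D \<and> Z(p := Zero) \<in> D \<and>
      (\<forall>V\<in>D. (z X \<inter> z Y) - {p} \<subseteq> z V \<longrightarrow> p \<in> z X \<inter> z
          Y \<longrightarrow> \<sigma> V = Zero)"
      using restrict_old(1)[OF X(1) o(1)] restrict_old(1)[OF X(2) o(2)] restrict_old(1)[OF Z] by blast
  qed
  then have "acyc Edold (fst G, snd G) (fst H, snd H)"
    by (rule acyc_signed) (use G(2) H(2) Edold_sym Edold_negv in auto)
  then show ?thesis by simp
qed

end

section \<open>The geometry near the new element\<close>

context oriented_matroid
begin

lemma ev_ssum: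
  assumes "dif G X Y Z"
  shows "ssum (smult (ev G X) (ev H Y)) (sneg (smult (ev G Y) (ev H X))) (ev H Z)"
  using ssum_scale[OF dif_ssum[OF assms, of "fst H"], of "snd H"]
  by (cases "snd H") (simp_all add: ev_def)

lemma point_eqI:
  assumes "line F" "x \<in> E" "x \<notin> F" "X \<in> C" "F \<subseteq> z X" "X x = Zero" "Y \<in> C" "F
      \<subseteq> z Y" "Y x = Zero"
    and a: "X a = Y a" "Y a \<noteq> Zero"
  shows "X = Y"
  using line_point_unique[OF assms(1-9)] a by (metis negv_apply sneg_eq_self(2))

lemma point_zero:
  assumes "line F" "x \<in> E" "x \<notin> F" "X \<in> C" "F \<subseteq> z X" "X x = Zero" "Y \<in> C" "F
      \<subseteq> z Y" "Y x = Zero"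
    and a: "Y a = Zero"
  shows "X a = Zero"
  using line_point_unique[OF assms(1-9)] a by (metis negv_apply sneg_eq_iff(1))

lemma line_parallel_ev:
  assumes F: "line F" and X0: "X0 \<in> C" "F \<subseteq> z X0"
    and A: "fst A \<in> E" "fst A \<notin> F" "X0 (fst A) = Zero" "snd A \<noteq> Zero"
    and B: "fst B \<in> E" "fst B \<notin> F" "X0 (fst B) = Zero" "snd B \<noteq> Zero"
  shows "\<exists>c. c \<noteq> Zero \<and> (\<forall>V\<in>C. F \<subseteq> z V \<longrightarrow> ev B V =
      smult c (ev A V))"
proof -
  obtain c where c: "c \<noteq> Zero" "\<forall>V\<in>C. F \<subseteq> z V \<longrightarrow> V (fst B) =
      smult c (V (fst A))"
    using line_parallel[OF F X0 A(1-3) B(1-3)] by blast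
  have "ev B V = smult (smult c (smult (snd A) (snd B))) (ev A V)" if V: "V \<in> C" "F \<subseteq> z V" for V
  proof -
    have "V (fst B) = smult c (V (fst A))" using c(2) V by blast
    then show ?thesis using A(4) B(4)
      by (cases c; cases "snd A"; cases "snd B") (simp_all add: ev_def)
  qed
  then show ?thesis using c(1) A(4) B(4)
    by (intro exI[of _ "smult c (smult (snd A) (snd B))"]) auto
qed

lemma parallel_eq:
  assumes F: "line F" and X0: "X0 \<in> C" "F \<subseteq> z X0"
    and A: "fst A \<in> E" "fst A \<notin> F" "X0 (fst A) = Zero" "snd A \<noteq> Zero"
    and B: "fst B \<in> E" "fst B \<notin> F" "X0 (fst B) = Zero" "snd B \<noteq> Zero"
    and V: "V \<in> C" "F \<subseteq> z V" and W: "W \<in> C" "F \<subseteq> z W" and eq: "ev A V = ev A W"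
  shows "ev B V = ev B W"
proof -
  obtain c where "\<forall>V\<in>C. F \<subseteq> z V \<longrightarrow> ev B V = smult c (ev A V)"
    using line_parallel_ev[OF F X0 A B] by blast
  then have "ev B V = smult c (ev A V)" "ev B W = smult c (ev A W)" using V W by blast+
  then show ?thesis using eq by simp
qed

lemma signed_point_ex:
  assumes "line F" "x \<in> E" and nz: "\<And>V. V \<in> C \<Longrightarrow> F \<subseteq> z V
      \<Longrightarrow> V x = Zero \<Longrightarrow> ev G V \<noteq> Zero"
  obtains V where "V \<in> C" "F \<subseteq> z V" "V x = Zero" "ev G V = Pos"
proof -
  obtain V where V: "V \<in> C" "F \<subseteq> z V" "V x = Zero" by (rule line_point_ex[OF assms(1,2)])
  show thesis
  proof (cases "ev G V")
    case Pos then show thesis using that V by blast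
  next
    case Zero then show thesis using nz[OF V] by simp
  next
    case Neg
    then have "ev G (negv V) = Pos" by simp
    then show thesis using that[of "negv V"] V negv_C[OF V(1)] by simp
  qed
qed

end

section \<open>New points and their old neighbours\<close>

locale lex_step = nondegenerate_extension +
  fixes T :: "'a set" and e :: 'a and \<alpha> :: sign
  assumes eE: "e \<in> E" and ep: "e \<noteq> p" and TE: "T \<subseteq> E - {p}" and \<alpha>: "\<alpha>
      \<noteq> Zero"
    and sep_ep: "X \<in> C \<Longrightarrow> T \<subseteq> z X \<Longrightarrow> X e \<noteq> Zero
        \<Longrightarrow> X p \<noteq> Zero \<Longrightarrow> X p = smult \<alpha> (X e)"
    and new_p: "X \<in> C \<Longrightarrow> T \<subseteq> z X \<Longrightarrow> X e \<noteq> Zero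
        \<Longrightarrow> X p = Zero \<Longrightarrow> p \<notin> cl (z X - {p})"
begin

definition bad :: "'a svec \<Rightarrow> bool" where
  "bad P \<longleftrightarrow> P \<in> C \<and> T \<subseteq> z P \<and> P p = Zero \<and> P e \<noteq> Zero"

text \<open>A bad point \<^term>\<open>P\<close> lies infinitesimally close to the old point
    \<^term>\<open>X\<close> in which the old
  line \<^term>\<open>z P - {p}\<close> meets \<^term>\<open>e\<close>.\<close>

definition near :: "'a svec \<Rightarrow> 'a svec \<Rightarrow> bool" where
  "near P X \<longleftrightarrow> X \<in> C \<and> z P - {p} \<subseteq> z X \<and> X e = Zero \<and> X p =
      sneg (smult \<alpha> (P e))
     \<and> (\<forall>h. h \<noteq> p \<longrightarrow> X h \<noteq> Zero \<longrightarrow> P h = X h)"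

lemma pz: "X p = Zero \<longleftrightarrow> p \<in> z X"
  using pE by (simp add: in_z)

lemma bad_line: "bad P \<Longrightarrow> line (z P - {p})"
  using point_remove_line[of P p] new_p[of P] pE by (simp add: bad_def in_z)

lemma bad_e: "bad P \<Longrightarrow> e \<notin> z P - {p}"
  by (simp add: bad_def in_z)

lemma bad_points:
  assumes P: "bad P" and Q: "Q \<in> C" "z P - {p} \<subseteq> z Q" "Q p = Zero"
  shows "Q = P \<or> Q = negv P"
proof -
  have "z P \<subseteq> z Q" using Q pz by blast
  then show ?thesis using z_subset_eq[of P Q] P Q by (metis bad_def negv_negv)
qed

lemma near_C: "near P X \<Longrightarrow> X \<in> C" by (simp add: near_def)
lemma near_sub: "near P X \<Longrightarrow> z P - {p} \<subseteq> z X" by (simp add: near_def)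
lemma near_e: "near P X \<Longrightarrow> X e = Zero" by (simp add: near_def)
lemma near_p: "near P X \<Longrightarrow> X p = sneg (smult \<alpha> (P e))" by (simp add: near_def)
lemma near_sign: "near P X \<Longrightarrow> h \<noteq> p \<Longrightarrow> X h \<noteq> Zero
    \<Longrightarrow> P h = X h" by (simp add: near_def)

lemma near_ev: "near P X \<Longrightarrow> fst G \<noteq> p \<Longrightarrow> ev G X \<noteq> Zero
    \<Longrightarrow> ev G P = ev G X"
  using near_sign[of P X "fst G"] by (auto simp: ev_def)

lemma near_self: "P \<in> C \<Longrightarrow> P p = Zero \<Longrightarrow> P e = Zero \<Longrightarrow>
    near P P"
  by (auto simp: near_def)

text \<open>Heuristically \<open>p\<close> is \<open>\<alpha> e\<close> plus an infinitesimal. Since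
  \<open>p\<close> vanishes at \<open>P\<close>, the infinitesimal part there is
  \<open>- \<alpha> P e\<close>; at the neighbour, where \<open>e\<close> vanishes, this part is all
  that is left of \<open>p\<close>. Hence the sign required of \<open>X p\<close>.\<close>

lemma near_ex:
  assumes P: "P \<in> C" "T \<subseteq> z P" "P p = Zero"
  shows "\<exists>X. near P X"
proof (cases "P e = Zero")
  case True
  then show ?thesis using near_self[OF P(1,3)] by blast
next
  case False
  then have b: "bad P" using P by (simp add: bad_def)
  let ?L = "z P - {p}"
  have L: "line ?L" by (rule bad_line[OF b])
  \<comment> \<open>If \<open>V\<close> vanished at \<open>p\<close> too, it would be
    \<open>P\<close> up to sign, but \<open>P e\<close> is nonzero.\<close>
  have "V p \<noteq> Zero" if V: "V \<in> C" "?L \<subseteq> z V" "V e = Zero" for V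
    using bad_points[OF b V(1,2)] V(3) False by auto
  then have "ev (p, sneg (smult \<alpha> (P e))) V \<noteq> Zero" if "V \<in> C" "?L \<subseteq> z V" "V e
      = Zero" for V
    using that False \<alpha> by (simp add: ev_def)
  then obtain X where X: "X \<in> C" "?L \<subseteq> z X" "X e = Zero" "ev (p, sneg (smult \<alpha> (P e)))
      X = Pos"
    using signed_point_ex[OF L eE] by blast
  have Xp: "X p = sneg (smult \<alpha> (P e))"
    using X(4) False \<alpha> by (cases \<alpha>; cases "P e"; cases "X p") (simp_all add: ev_def)
  have "P h = X h" if h: "h \<noteq> p" "X h \<noteq> Zero" for h
  proof (rule ccontr)
    assume ne: "P h \<noteq> X h"
    have hE: "h \<in> E" using outside[OF X(1)] h by blast
    have "P h \<noteq> Zero" using X(2) h hE by (auto simp: in_z)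
    then have Ph: "P h = sneg (X h)" using ne h by (cases "P h"; cases "X h") auto
    \<comment> \<open>Eliminating \<open>h\<close> gives a point of the old line with the sign of
      \<open>P\<close> at \<open>e\<close> and that of \<open>X\<close> at \<open>p\<close>, which
      \<open>sep_ep\<close> forbids.\<close>
    have "X \<noteq> negv P" using X(3) False by auto
    then obtain Q where Q: "Q \<in> C" "?L \<subseteq> z Q" "\<forall>k. ssum (X k) (P k) (Q k)"
      using line_elim[OF L X(1,2) P(1) _ _ h(2) Ph] by blast
    have "Q e = P e" "Q p = X p" using Q(3)[rule_format, of e] Q(3)[rule_format, of p] X(3) P(3) by auto
    moreover have "T \<subseteq> z Q" using P(2) Q(2) TE by blast
    ultimately have "X p = smult \<alpha> (P e)" using sep_ep[OF Q(1)] False Xp \<alpha> by auto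
    then show False using Xp False \<alpha> by auto
  qed
  then have "near P X" using X Xp by (auto simp: near_def)
  then show ?thesis by blast
qed

lemma near_zero:
  assumes "near P X" "P \<in> C" "P p = Zero" "P e = Zero"
  shows "X = P"
proof -
  have Xp: "X p = Zero" using near_p[OF assms(1)] assms(4) by simp
  have "z P \<subseteq> z X" using near_sub[OF assms(1)] Xp pz by blast
  then have "P = X \<or> P = negv X" using z_subset_eq[OF assms(2) near_C[OF assms(1)]] by blast
  moreover obtain h where h: "X h \<noteq> Zero" using nonzero_point[OF near_C[OF assms(1)]] by blast
  then have "P h = X h" using near_sign[OF assms(1)] Xp by metis
  ultimately show ?thesis using h by (metis negv_apply sneg_eq_self(2))
qed

lemma near_unique:
  assumes "near P X" "near P Y" "P \<in> C" "T \<subseteq> z P" "P p = Zero"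
  shows "X = Y"
proof (cases "P e = Zero")
  case True
  then show ?thesis using near_zero assms by blast
next
  case False
  then have b: "bad P" using assms by (simp add: bad_def)
  have "X p = Y p" "Y p \<noteq> Zero" using near_p[OF assms(1)] near_p[OF assms(2)] False \<alpha> by auto
  then show ?thesis
    using point_eqI[OF bad_line[OF b] eE bad_e[OF b] near_C[OF assms(1)] near_sub[OF assms(1)]
      near_e[OF assms(1)] near_C[OF assms(2)] near_sub[OF assms(2)] near_e[OF assms(2)]] by blast
qed

lemma near_bad_p: "bad P \<Longrightarrow> near P X \<Longrightarrow> X p \<noteq> Zero"
  using near_p[of P X] \<alpha> by (simp add: bad_def)

lemma near_comod:
  assumes "bad P" "near P X"
  shows "comod X P" "z X \<inter> z P = z P - {p}"
proof -
  have "P p = Zero" "P \<in> C" using assms(1) by (auto simp: bad_def)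
  then have "X \<noteq> P" "X \<noteq> negv P" using near_bad_p[OF assms] by auto
  then show "comod X P" "z X \<inter> z P = z P - {p}"
    using comodI[OF bad_line[OF assms(1)] near_C[OF assms(2)] near_sub[OF assms(2)] \<open>P \<in>
        C\<close>] by auto
qed

end

section \<open>The rank three picture around a new line\<close>

locale bad_plane = lex_step +
  fixes F :: "'a set"
  assumes F: "line F" and pF: "p \<in> F" and TF: "T \<subseteq> F" and eF: "e \<notin> F"
begin

abbreviation "F0 \<equiv> F - {p}"

text \<open>In the contraction of \<open>F0\<close>, of rank three, this is the line cut out by the
  element \<open>x\<close>; the points are the cocircuits vanishing on \<open>F0\<close>.\<close>

definition K :: "'a \<Rightarrow> 'a set" where "K x = cl (insert x F0)"

lemma on_F: "V \<in> C \<Longrightarrow> F \<subseteq> z V \<Longrightarrow> T \<subseteq> z V \<and> V p =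
    Zero"
  using pF TF pz by blast

text \<open>Some point of \<open>F\<close> is off \<open>e\<close>. It is new, so even the rest of
  its zero set does not span \<open>p\<close>.\<close>

lemma p_F0: "p \<notin> cl F0"
proof -
  obtain V where V: "V \<in> C" "F \<subseteq> z V" "V e \<noteq> Zero" using line_point_nonzero[OF F eE
      eF] by blast
  have "p \<notin> cl (z V - {p})" using new_p[OF V(1) _ V(3)] on_F[OF V(1,2)] by blast
  moreover have "cl F0 \<subseteq> cl (z V - {p})" using V(2) by (intro cl_mono) blast
  ultimately show ?thesis by blast
qed

lemma plane0: "plane F0"
  by (rule line_remove_plane[OF F pF p_F0])

lemma F0E: "F0 \<subseteq> E" using line_sub[OF F] by blast

lemma K_line: "x \<in> E \<Longrightarrow> x \<notin> F \<Longrightarrow> line (K x)"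
  unfolding K_def using plane0 pF by (intro plane_line) auto

lemma K_in: "x \<in> E \<Longrightarrow> x \<in> K x"
  unfolding K_def using cl_extensive[of "insert x F0"] F0E by blast

lemma K_p:
  assumes "x \<in> E" "x \<notin> F"
  shows "p \<notin> K x"
proof
  assume "p \<in> K x"
  then have "x \<in> cl (insert p F0)" unfolding K_def by (rule exchange[OF F0E assms(1) _ p_F0])
  moreover have "insert p F0 = F" using pF by blast
  ultimately show False using assms F by (simp add: line_def)
qed

lemma K_sub: "V \<in> C \<Longrightarrow> F0 \<subseteq> z V \<Longrightarrow> V x = Zero \<Longrightarrow>
    x \<in> E \<Longrightarrow> K x \<subseteq> z V"
  unfolding K_def by (intro z_cl) (auto simp: in_z)

lemma K_unique: "line L \<Longrightarrow> F0 \<subseteq> L \<Longrightarrow> x \<in> L \<Longrightarrow> x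
    \<in> E \<Longrightarrow> x \<notin> F \<Longrightarrow> L = K x"
  unfolding K_def using plane_line_through[OF plane0] by auto

lemma K_eq: "y \<in> K x \<Longrightarrow> x \<in> E \<Longrightarrow> x \<notin> F \<Longrightarrow> y
    \<notin> F \<Longrightarrow> K x = K y"
  using K_unique[OF K_line, of x y] cl_E[of "insert x F0"] cl_extensive[of "insert x F0"] F0E
  by (auto simp: K_def)

lemma F0_K: "x \<in> E \<Longrightarrow> F0 \<subseteq> K x"
  unfolding K_def using cl_extensive[of "insert x F0"] F0E by blast

lemma near_K: "P \<in> C \<Longrightarrow> F \<subseteq> z P \<Longrightarrow> near P X \<Longrightarrow> K
    e \<subseteq> z X"
  using near_C near_sub[of P X] near_e by (intro K_sub eE) auto

lemma bad_K: "bad P \<Longrightarrow> F \<subseteq> z P \<Longrightarrow> x \<in> z P \<Longrightarrow> x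
    \<notin> F \<Longrightarrow> z P - {p} = K x"
  using pF z_sub by (intro K_unique bad_line) auto

lemma anchor:
  assumes "P \<in> C" "F \<subseteq> z P" "Q \<in> C" "F \<subseteq> z Q" "P \<noteq> Q" "P \<noteq> negv Q"
  obtains a where "a \<in> E" "a \<noteq> p" "a \<notin> F" "P a = Zero" "Q a \<noteq> Zero"
proof -
  obtain a where a: "a \<in> z P" "a \<notin> F" using line_psubset[OF F assms(1,2)] by blast
  then have "a \<notin> z Q" using line_inter[OF F assms(1,3,2,4-6)] by blast
  then show thesis using that[of a] a pF by (auto simp: in_z)
qed

text \<open>The direction from \<^term>\<open>P\<close> to \<^term>\<open>Q\<close> is infinitesimally
    close to the one between
  the neighbouring old points.\<close>
lemma near_dif:
  assumes P: "P \<in> C" "F \<subseteq> z P" "near P X" and Q: "Q \<in> C" "F \<subseteq> z Q" "near Q X'"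
    and ne: "P \<noteq> Q" and G: "fst G \<in> E" "fst G \<noteq> p" "snd G \<noteq> Zero" "ev G P = Pos"
        "ev G Q = Pos"
    and Z: "dif G P Q Z" and X: "comod X X'" and Z0: "dif G X X' Z0"
    and nz: "ev G X \<noteq> Zero \<or> ev G X' \<noteq> Zero"
  shows "near Z Z0"
proof -
  have ne': "P \<noteq> negv Q" using G by auto
  note PQ = comodI[OF F P(1,2) Q(1,2) ne ne']
  have ZC: "Z \<in> C" using dif_in_C[OF PQ(1) Z] G by simp
  have FZ: "F \<subseteq> z Z" using dif_sub[OF Z] PQ(2) by simp
  obtain W where W: "near Z W" using near_ex[OF ZC] on_F[OF ZC FZ] by blast
  let ?L = "K e"
  have L: "line ?L" by (rule K_line[OF eE eF])
  have LX: "?L \<subseteq> z X" "?L \<subseteq> z X'" "?L \<subseteq> z W" using near_K P Q W ZC FZ by blast+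
  have ZC0: "Z0 \<in> C" using dif_in_C[OF X Z0] nz by blast
  have LZ0: "?L \<subseteq> z Z0" using dif_sub[OF Z0] LX by blast
  have gL: "fst G \<notin> ?L" using nz LX by (auto simp: in_z ev_def)
  have Wg: "W (fst G) = Zero"
    using near_sign[OF W G(2)] dif_zero[OF Z] by auto
  \<comment> \<open>Only the sign remains open. It is read off at \<open>p\<close> if one of
    \<open>P\<close> and \<open>Q\<close> is on \<open>e\<close>, and otherwise at an element where
    one end and its neighbour vanish but the other neighbour does not.\<close>
  have "W = Z0 \<or> W = negv Z0"
    by (rule line_point_unique[OF L G(1) gL near_C[OF W] LX(3) Wg ZC0 LZ0 dif_zero[OF Z0]])
  moreover have "W \<noteq> negv Z0"
  proof
    assume WZ: "W = negv Z0"
    have contra: False if "h \<noteq> p" "Z0 h \<noteq> Zero" "Z h = Z0 h" for h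
      using near_sign[OF W that(1)] that(2,3) WZ by auto
    have GX: "ev G X = Pos \<or> ev G X = Zero" "ev G X' = Pos \<or> ev G X' = Zero"
      using near_ev[OF P(3) G(2)] near_ev[OF Q(3) G(2)] G by auto
    consider "P e = Zero" | "Q e = Zero" | "P e \<noteq> Zero" "Q e \<noteq> Zero" by blast
    then show False
    proof cases
      case 1
      then have Qe: "Q e \<noteq> Zero" using PQ(2) eF eE by (auto simp: in_z)
      have XP: "X = P" using near_zero[OF P(3,1) _ 1] on_F[OF P(1,2)] by blast
      have "Z e = Q e" using dif_left[OF Z 1] G by simp
      moreover have "Z0 p = X' p" using dif_left[OF Z0, of p] XP on_F[OF P(1,2)] G by simp
      ultimately have "W p = Z0 p" "W p \<noteq> Zero" using near_p[OF W] near_p[OF Q(3)] Qe \<alpha> by auto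
      then show False using WZ by auto
    next
      case 2
      then have Pe: "P e \<noteq> Zero" using PQ(2) eF eE by (auto simp: in_z)
      have XQ: "X' = Q" using near_zero[OF Q(3,1) _ 2] on_F[OF Q(1,2)] by blast
      have "Z e = sneg (P e)" using dif_right[OF Z 2] G by simp
      moreover have "Z0 p = sneg (X p)" using dif_right[OF Z0, of p] XQ on_F[OF Q(1,2)] G by simp
      ultimately have "W p = Z0 p" "W p \<noteq> Zero" using near_p[OF W] near_p[OF P(3)] Pe \<alpha> by auto
      then show False using WZ by auto
    next
      case 3
      have b: "bad P" "bad Q" using 3 P Q on_F by (auto simp: bad_def)
      have XC: "X \<in> C" "X' \<in> C" "X \<noteq> X'" "X \<noteq> negv X'" using X by (auto simp: comod_def)
      show False
      proof (cases "ev G X = Pos")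
        case True
        \<comment> \<open>Otherwise both neighbours would be the point of the old line of
          \<open>P\<close> on \<open>e\<close>, hence equal up to sign.\<close>
        have "\<not> z P - {p} \<subseteq> z X'"
          using line_point_unique[OF bad_line[OF b(1)] eE bad_e[OF b(1)] XC(1) near_sub[OF P(3)] near_e[OF
              P(3)] XC(2) _ near_e[OF Q(3)]] XC by blast
        then obtain h where h: "h \<in> z P" "h \<noteq> p" "h \<notin> z X'" by blast
        have "h \<in> z X" using h near_sub[OF P(3)] by blast
        then have Xh: "X h = Zero" and Ph: "P h = Zero" and X'h: "X' h \<noteq> Zero" using h by (auto
            simp: in_z)
        show False
          using contra[OF h(2)] dif_left[OF Z0 Xh] dif_left[OF Z Ph] near_sign[OF Q(3) h(2) X'h] X'h True G
          by simp
      next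
        case False
        then have GX': "ev G X' = Pos" using GX nz by blast
        have "\<not> z Q - {p} \<subseteq> z X"
          using line_point_unique[OF bad_line[OF b(2)] eE bad_e[OF b(2)] XC(1) _ near_e[OF P(3)] XC(2)
              near_sub[OF Q(3)] near_e[OF Q(3)]] XC by blast
        then obtain h where h: "h \<in> z Q" "h \<noteq> p" "h \<notin> z X" by blast
        have "h \<in> z X'" using h near_sub[OF Q(3)] by blast
        then have Xh: "X' h = Zero" and Qh: "Q h = Zero" and X'h: "X h \<noteq> Zero" using h by (auto
            simp: in_z)
        show False
          using contra[OF h(2)] dif_right[OF Z0 Xh] dif_right[OF Z Qh] near_sign[OF P(3) h(2) X'h] X'h GX' G
          by simp
      qed
    qed
  qed
  ultimately show ?thesis using W by blast
qed

lemma dif_K: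
  assumes "dif G A B Z" "F0 \<subseteq> z A" "F0 \<subseteq> z B" "Z \<in> C" "fst G \<in> E"
  shows "K (fst G) \<subseteq> z Z"
  using dif_sub[OF assms(1)] assms dif_zero[OF assms(1)] by (intro K_sub) auto

text \<open>Displacements from a common neighbour add up: the one to \<open>Q\<close> is the one to
  \<open>P\<close> followed by the step from \<open>P\<close> to \<open>Q\<close>. All three
  directions lie on the line of \<open>fst G\<close>, where the signs at \<open>a\<close> and
  \<open>b\<close> put \<open>U'\<close> into the cone of the other two.\<close>

lemma near_dif_same:
  assumes P: "bad P" "F \<subseteq> z P" "near P X" and Q: "bad Q" "F \<subseteq> z Q" "near Q X"
    and ne: "P \<noteq> Q" and G: "fst G \<in> E" "fst G \<noteq> p" "snd G \<noteq> Zero" "ev G P = Pos"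
        "ev G Q = Pos" "ev G X = Pos"
    and Z: "dif G P Q Z" and U: "dif G X P U" and U': "dif G X Q U'"
  shows "ssum (U h) (Z h) (U' h)"
proof -
  have PC: "P \<in> C" "Q \<in> C" using P Q by (auto simp: bad_def)
  have ne': "P \<noteq> negv Q" using G by auto
  note PQ = comodI[OF F PC(1) P(2) PC(2) Q(2) ne ne']
  have ZC: "Z \<in> C" using dif_in_C[OF PQ(1) Z] G by simp
  have UC: "U \<in> C" using dif_in_C[OF near_comod(1)[OF P(1,3)] U] G by simp
  have UC': "U' \<in> C" using dif_in_C[OF near_comod(1)[OF Q(1,3)] U'] G by simp
  have gF: "fst G \<notin> F" using G P(2) by (auto simp: in_z ev_def)
  have F0: "F0 \<subseteq> z P" "F0 \<subseteq> z Q" "F0 \<subseteq> z X" using P Q near_sub[OF P(3)] by blast+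
  have L: "line (K (fst G))" by (rule K_line[OF G(1) gF])
  obtain a where a: "a \<in> E" "a \<noteq> p" "P a = Zero" "Q a \<noteq> Zero"
    by (rule anchor[OF PC(1) P(2) PC(2) Q(2) ne ne'])
  have "Q \<noteq> P" "Q \<noteq> negv P" using ne ne' by auto
  then obtain b where b: "b \<in> E" "b \<noteq> p" "Q b = Zero" "P b \<noteq> Zero"
    by (rule anchor[OF PC(2) Q(2) PC(1) P(2)])
  have Xa: "X a = Zero" using a near_sub[OF P(3)] by (auto simp: in_z)
  have Xb: "X b = Zero" using b near_sub[OF Q(3)] by (auto simp: in_z)
  have ua: "U a = Zero" "U' a = Q a" "Z a = Q a"
    using dif_left[OF U Xa] dif_left[OF U' Xa] dif_left[OF Z a(3)] a G by auto
  have ub: "U b = P b" "U' b = Zero" "Z b = sneg (P b)"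
    using dif_left[OF U Xb] dif_left[OF U' Xb] dif_right[OF Z b(3)] b G by auto
  show ?thesis
    by (rule line_cone[OF L UC dif_K[OF U F0(3,1) UC G(1)] ZC dif_K[OF Z F0(1,2) ZC G(1)]
      UC' dif_K[OF U' F0(3,2) UC' G(1)], of a b]) (use ua ub a b in auto)
qed

text \<open>\<open>Z0\<close> is where the lines of \<open>e\<close> and \<open>fst G\<close> meet.
  If \<open>H\<close> vanishes there as well, it cuts the line of \<open>fst G\<close> in the same
  point as \<open>e\<close>, unless it contains that line.\<close>

lemma near_dif_parallel:
  assumes G: "fst G \<in> E" "fst G \<notin> F"
    and Z0: "Z0 \<in> C" "K e \<subseteq> z Z0" "K (fst G) \<subseteq> z Z0" "ev H Z0 = Zero" and eK: "e
        \<notin> K (fst G)"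
    and H: "fst H \<in> E" "snd H \<noteq> Zero"
  shows "fst H \<in> K (fst G) \<or> (\<exists>c. c \<noteq> Zero \<and> (\<forall>V\<in>C. K (fst G)
      \<subseteq> z V \<longrightarrow> ev H V = smult c (ev (e, \<alpha>) V)))"
proof (cases "fst H \<in> K (fst G)")
  case False
  have "Z0 e = Zero" using Z0(2) K_in[OF eE] by (auto simp: in_z)
  then show ?thesis
    using line_parallel_ev[OF K_line[OF G] Z0(1,3), of "(e, \<alpha>)" H] eE eK \<alpha> H False Z0(4)
    by (auto simp: ev_eq_Zero)
qed simp

end

section \<open>Moving new points to old ones\<close>

context extension
begin

definition EdQ :: "'a set \<Rightarrow> 'a \<times> sign \<Rightarrow> 'a svec \<Rightarrow> 'a svec
    \<Rightarrow> bool" where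
  "EdQ S H X Y \<longleftrightarrow> EdS S X Y \<and> ev H X = Pos \<and> ev H Y = Pos"

lemma goodS_notin: "p \<notin> A \<Longrightarrow> goodS S A"
  by (simp add: goodS_def)

lemma goodS_sub: "S \<subseteq> A \<Longrightarrow> goodS S A"
  by (simp add: goodS_def)

end

section \<open>Replacing an edge by arcs of the next level\<close>

locale lex_edge = lex_step +
  fixes G H :: "'a \<times> sign"
  assumes G: "fst G \<in> E" "fst G \<noteq> p" "snd G \<noteq> Zero" and H: "fst H \<in> E" "fst H
      \<noteq> p" "snd H \<noteq> Zero"
begin

abbreviation S where "S \<equiv> insert e T"

text \<open>The closed quadrant without its apex: the height \<open>H / G\<close> makes sense here,
  with infinity allowed, and neighbours may fall on the boundary.\<close>

definition quad :: "'a svec \<Rightarrow> bool" where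
  "quad X \<longleftrightarrow> ev G X \<noteq> Neg \<and> ev H X \<noteq> Neg \<and> \<not> (ev G X = Zero
      \<and> ev H X = Zero)"

definition arc :: "'a svec \<Rightarrow> 'a svec \<Rightarrow> sign \<Rightarrow> bool" where
  "arc A B s \<longleftrightarrow> quad A \<and> quad B \<and>
     ((A = B \<and> s = Zero) \<or> (comod A B \<and> EdS S A B \<and> (\<exists>Z. dif G A B Z \<and> ev H
         Z = s)))"

definition nr :: "'a svec \<Rightarrow> 'a svec" where
  "nr P = (if bad P then SOME X. near P X else P)"

text \<open>If \<^term>\<open>nr P\<close> vanishes on \<^term>\<open>G\<close> and
    \<^term>\<open>H\<close>, it carries no information; all points of
  the old line through \<^term>\<open>P\<close> then have the same height, and \<open>yy P\<close> is one
      of them.\<close>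

definition zc :: "'a svec \<Rightarrow> bool" where
  "zc P \<longleftrightarrow> bad P \<and> ev G (nr P) = Zero \<and> ev H (nr P) = Zero"

text \<open>Depends on the zero set only, so that neighbours equal up to sign select the same
  element; \<open>edge_two_pencils\<close> relies on this.\<close>

definition hx :: "'a set \<Rightarrow> 'a" where
  "hx A = (SOME h. h \<in> E \<and> h \<noteq> p \<and> h \<notin> A)"

definition yy :: "'a svec \<Rightarrow> 'a svec" where
  "yy P = (SOME Y. Y \<in> C \<and> z P - {p} \<subseteq> z Y \<and> Y (hx (z (nr P))) = Zero \<and> ev G Y
      = Pos)"

definition \<phi> :: "'a svec \<Rightarrow> 'a svec" where
  "\<phi> P = (if zc P then yy P else nr P)"

definition uu :: "'a svec \<Rightarrow> 'a svec" where
  "uu P = (SOME U. dif G (nr P) P U)"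

text \<open>The sign of the infinitesimal change of height from \<^term>\<open>nr P\<close> to
    \<^term>\<open>P\<close>.\<close>

definition aval :: "'a svec \<Rightarrow> sign" where
  "aval P = (if bad P \<and> ev G (nr P) = Pos then ev H (uu P) else Zero)"

text \<open>Equality of first-order heights, the situation in which the infinitesimal terms of both
  ends can be compared.\<close>

definition conf :: "'a svec \<Rightarrow> 'a svec \<Rightarrow> bool" where
  "conf P Q \<longleftrightarrow> bad P \<and> bad Q \<and>
     (nr P = nr Q \<or> (comod (nr P) (nr Q) \<and> (\<forall>Z. dif G (nr P) (nr Q) Z \<longrightarrow> ev
         H Z = Zero)))"

text \<open>Only the middle arc may change the height, and only in the sense \<open>d\<close> of the
  original edge. If it does not, and the height is finite, the infinitesimal terms have to account
  for \<open>d\<close>.\<close>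

definition edgeOK :: "'a svec \<Rightarrow> 'a svec \<Rightarrow> sign \<Rightarrow> bool" where
  "edgeOK P Q d \<longleftrightarrow> (\<exists>A B s. arc (\<phi> P) A Zero \<and> arc A B s \<and> arc B
      (\<phi> Q) Zero \<and> (s = Zero \<or> s = d)
     \<and> (s = Zero \<and> ev G (\<phi> P) = Pos \<and> ev G (\<phi> Q) = Pos \<longrightarrow>
          ssum (aval P) d (aval Q) \<and> (aval P \<noteq> Zero \<and> aval Q \<noteq> Zero
              \<longrightarrow> conf P Q)))"

definition vert :: "'a svec \<Rightarrow> bool" where
  "vert P \<longleftrightarrow> P \<in> C \<and> ev G P = Pos \<and> ev H P = Pos"

lemma arc_refl: "quad A \<Longrightarrow> arc A A Zero"
  by (simp add: arc_def)

lemma arc_sym: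
  assumes "arc A B s"
  shows "arc B A (sneg s)"
proof (cases "A = B \<and> s = Zero")
  case True
  then show ?thesis using assms by (auto simp: arc_def)
next
  case False
  then obtain Z where "comod A B" "EdS S A B" "dif G A B Z" "ev H Z = s" "quad A" "quad B"
    using assms by (auto simp: arc_def)
  then show ?thesis using comod_sym[of A B] EdS_sym[of S A B] dif_negv[of G A B Z]
    unfolding arc_def by (metis ev_negv)
qed

lemma ssum_sneg_swap: "ssum a d b \<Longrightarrow> ssum b (sneg d) a"
  by (cases a; cases b; cases d) (auto simp: ssum_def)

lemma conf_sym:
  assumes "conf P Q"
  shows "conf Q P"
proof -
  have "ev H Z = Zero" if "\<forall>Z. dif G (nr P) (nr Q) Z \<longrightarrow> ev H Z = Zero" "dif G (nr Q)
      (nr P) Z" for Z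
    using that(1) dif_negv[OF that(2)] by auto
  then show ?thesis using assms comod_sym[of "nr P" "nr Q"] unfolding conf_def by metis
qed

lemma edgeOK_sym:
  assumes "edgeOK P Q d"
  shows "edgeOK Q P (sneg d)"
proof -
  obtain A B s where *: "arc (\<phi> P) A Zero" "arc A B s" "arc B (\<phi> Q) Zero" "s = Zero \<or> s = d"
    "s = Zero \<and> ev G (\<phi> P) = Pos \<and> ev G (\<phi> Q) = Pos \<longrightarrow>
          ssum (aval P) d (aval Q) \<and> (aval P \<noteq> Zero \<and> aval Q \<noteq> Zero
              \<longrightarrow> conf P Q)"
    using assms unfolding edgeOK_def by (elim exE conjE)
  show ?thesis
    unfolding edgeOK_def
    by (rule exI[of _ B], rule exI[of _ A], rule exI[of _ "sneg s"])
      (use arc_sym[OF *(1)] arc_sym[OF *(2)] arc_sym[OF *(3)] *(4,5) conf_sym ssum_sneg_swap in auto)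
qed

lemma nr_bad:
  assumes "bad P"
  shows "near P (nr P)"
  using someI_ex[OF near_ex[of P]] assms by (simp add: nr_def bad_def)

lemma nr_near:
  assumes "bad P \<or> P \<in> C \<and> P p = Zero \<and> P e = Zero"
  shows "near P (nr P)"
  using nr_bad[of P] near_self[of P] assms by (auto simp: nr_def)

lemma uu_dif: "bad P \<Longrightarrow> dif G (nr P) P (uu P)"
  unfolding uu_def using someI_ex[OF dif_ex[OF near_comod(1)[OF _ nr_bad] G(3)]] by blast

lemma quad_vert: "vert P \<Longrightarrow> quad P"
  by (simp add: vert_def quad_def)

lemma nr_quad:
  assumes "vert P" "\<not> zc P"
  shows "quad (nr P)"
proof (cases "bad P")
  case True
  then have n: "near P (nr P)" by (rule nr_bad)
  show ?thesis
    using near_ev[OF n G(2)] near_ev[OF n H(2)] assms True unfolding quad_def zc_def vert_def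
    by (metis sign.distinct(1,3,5))
qed (use assms quad_vert in \<open>simp add: nr_def\<close>)

lemma hx_prop:
  assumes "X \<in> C"
  shows "hx (z X) \<in> E" "hx (z X) \<noteq> p" "X (hx (z X)) \<noteq> Zero"
proof -
  obtain h where "h \<noteq> p" "X h \<noteq> Zero" using nocoloop[OF assms] by blast
  then have "h \<in> E \<and> h \<noteq> p \<and> h \<notin> z X" using outside[OF assms] by (auto simp: in_z)
  then have "hx (z X) \<in> E \<and> hx (z X) \<noteq> p \<and> hx (z X) \<notin> z X" unfolding hx_def by
      (rule someI)
  then show "hx (z X) \<in> E" "hx (z X) \<noteq> p" "X (hx (z X)) \<noteq> Zero" by (auto simp: in_z)
qed

lemma vert_line_notin:
  assumes "vert P" "L \<subseteq> z P"
  shows "fst G \<notin> L" "fst H \<notin> L"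
  using assms by (auto simp: vert_def in_z ev_def)

lemma zc_nr:
  assumes "zc P"
  shows "near P (nr P)" "nr P \<in> C" "z P - {p} \<subseteq> z (nr P)" "nr P (fst G) = Zero" "nr P (fst H)
      = Zero"
    "line (z P - {p})"
  using assms nr_bad[of P] near_C[of P] near_sub[of P] bad_line[of P] G H
  by (auto simp: zc_def ev_eq_Zero)

text \<open>Both elements cut the old line of \<open>P\<close> in the neighbour, so they are
  parallel there; their values at \<open>P\<close> make the factor positive.\<close>

lemma zc_par:
  assumes P: "zc P" "vert P" and V: "V \<in> C" "z P - {p} \<subseteq> z V"
  shows "ev H V = ev G V"
proof -
  note n = zc_nr[OF P(1)]
  have gf: "fst G \<notin> z P - {p}" "fst H \<notin> z P - {p}" using vert_line_notin[OF P(2)] by blast+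
  obtain c where c: "\<forall>V\<in>C. z P - {p} \<subseteq> z V \<longrightarrow> ev H V = smult c (ev G V)"
    using line_parallel_ev[OF n(6,2,3) G(1) gf(1) n(4) G(3) H(1) gf(2) n(5) H(3)] by blast
  have "ev H P = smult c (ev G P)" using c P(2) by (auto simp: vert_def)
  moreover have "ev H P = Pos" "ev G P = Pos" using P(2) by (auto simp: vert_def)
  ultimately have "c = Pos" by simp
  then show ?thesis using c V by simp
qed

lemma yy_prop:
  assumes P: "zc P" "vert P"
  shows "yy P \<in> C" "z P - {p} \<subseteq> z (yy P)" "yy P (hx (z (nr P))) = Zero" "ev G (yy P) = Pos"
    "ev H (yy P) = Pos" "p \<notin> z (yy P)"
proof -
  note n = zc_nr[OF P(1)]
  note h = hx_prop[OF n(2)]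
  have hL: "hx (z (nr P)) \<notin> z P - {p}" using n(3) h(3) by (auto simp: in_z)
  have "ev G V \<noteq> Zero" if V: "V \<in> C" "z P - {p} \<subseteq> z V" "V (hx (z (nr P))) = Zero" for V
  proof
    assume "ev G V = Zero"
    then have Vg: "V (fst G) = Zero" using G by (simp add: ev_eq_Zero)
    have gL: "fst G \<notin> z P - {p}" using vert_line_notin[OF P(2)] by blast
    show False using point_zero[OF n(6) G(1) gL n(2,3,4) V(1,2) Vg V(3)] h(3) by simp
  qed
  then obtain Y where "Y \<in> C" "z P - {p} \<subseteq> z Y" "Y (hx (z (nr P))) = Zero" "ev G Y = Pos"
    using signed_point_ex[OF n(6) h(1)] by blast
  then have "yy P \<in> C \<and> z P - {p} \<subseteq> z (yy P) \<and> yy P (hx (z (nr P))) = Zero \<and>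
      ev G (yy P) = Pos"
    unfolding yy_def by (intro someI[where P = "\<lambda>Y. Y \<in> C \<and> z P - {p} \<subseteq> z Y
        \<and> Y (hx (z (nr P))) = Zero \<and> ev G Y = Pos"]) auto
  then show y: "yy P \<in> C" "z P - {p} \<subseteq> z (yy P)" "yy P (hx (z (nr P))) = Zero" "ev G (yy P) =
      Pos" by auto
  show "ev H (yy P) = Pos" using zc_par[OF P y(1,2)] y(4) by simp
  show "p \<notin> z (yy P)"
  proof
    assume "p \<in> z (yy P)"
    then have "yy P = P \<or> yy P = negv P"
      using bad_points[of P "yy P"] P(1) y(1,2) pz unfolding zc_def by blast
    then have "P (hx (z (nr P))) = Zero" using y(3) by (metis negv_apply sneg_eq_iff(1))
    then show False using hL h(1,2) by (simp add: in_z)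
  qed
qed

lemma \<phi>_quad: "vert P \<Longrightarrow> quad (\<phi> P)"
  using nr_quad[of P] yy_prop(4,5)[of P] by (auto simp: \<phi>_def quad_def)

text \<open>A direction on \<open>L\<close> is zero or, up to sign, the point \<open>X\<close>,
  where \<open>H\<close> vanishes too; so all points of \<open>L\<close> have the same
  height.\<close>

lemma arc_pencil:
  assumes L: "line L" "fst G \<notin> L" and X: "X \<in> C" "L \<subseteq> z X" "X (fst G) = Zero" "X (fst
      H) = Zero"
    and A: "A \<in> C" "L \<subseteq> z A" "quad A" "goodS S (z A)" and B: "B \<in> C" "L \<subseteq> z B"
        "quad B" "goodS S (z B)"
    and ne: "A \<noteq> negv B" and p: "p \<notin> L"
  shows "arc A B Zero"
proof (cases "A = B")
  case True
  then show ?thesis using arc_refl A by simp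
next
  case False
  note c = comodI[OF L(1) A(1,2) B(1,2) False ne]
  obtain Z where Z: "dif G A B Z" using dif_ex[OF c(1) G(3)] by blast
  have "Z (fst H) = Zero"
  proof (cases "Z = zerovec")
    case False
    then have ZC: "Z \<in> C" using Z by (simp add: dif_def)
    have "L \<subseteq> z Z" using dif_sub[OF Z] c(2) by simp
    then show ?thesis using point_zero[OF L(1) G(1) L(2) ZC _ dif_zero[OF Z] X(1-3) X(4)] by blast
  qed simp
  then have "ev H Z = Zero" by (simp add: ev_def)
  moreover have "EdS S A B" using A(4) B(4) c(2) goodS_notin[OF p] by (simp add: EdS_def)
  ultimately show ?thesis using c(1) Z A(3) B(3) unfolding arc_def by blast
qed

lemma quad_negv: "quad A \<Longrightarrow> quad B \<Longrightarrow> A \<noteq> negv B"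
  by (cases "ev G B"; cases "ev H B") (auto simp: quad_def)

text \<open>Only \<open>P\<close> moves, and it moves along the line it shares with
  \<open>Q\<close>, so the direction is kept. If \<open>P\<close> moves onto \<open>Q\<close>, the
  height change becomes infinitesimal and is recorded by \<open>aval P\<close>.\<close>

lemma edge_old_line:
  assumes P: "bad P" "vert P" and Q: "vert Q" "\<not> bad Q" "goodS S (z Q)"
    and PQ: "comod P Q" and F: "z P \<inter> z Q = z P - {p}" and Z: "dif G P Q Z"
  shows "edgeOK P Q (ev H Z)"
proof -
  let ?L = "z P - {p}" and ?X = "nr P"
  have L: "line ?L" by (rule bad_line[OF P(1)])
  have gL: "fst G \<notin> ?L" using vert_line_notin[OF P(2)] by blast
  have LQ: "?L \<subseteq> z Q" using F by blast
  have QC: "Q \<in> C" and GQ: "ev G Q = Pos" "ev H Q = Pos" and GP: "ev G P = Pos"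
    using P(2) Q(1) by (auto simp: vert_def)
  have nQ: "nr Q = Q" "\<not> zc Q" "\<phi> Q = Q" "aval Q = Zero" using Q(2) by (auto simp: nr_def zc_def
      \<phi>_def aval_def)
  have n: "near P ?X" by (rule nr_bad[OF P(1)])
  have ZC: "Z \<in> C" "?L \<subseteq> z Z" using dif_in_C[OF PQ Z] GP dif_sub[OF Z] F by auto
  have qQ: "quad Q" by (rule quad_vert[OF Q(1)])
  show ?thesis
  proof (cases "zc P")
    case True
    note nP = zc_nr[OF True] and y = yy_prop[OF True P(2)]
    have \<phi>: "\<phi> P = yy P" "aval P = Zero" using True by (auto simp: \<phi>_def aval_def zc_def)
    have qy: "quad (yy P)" using y by (simp add: quad_def)
    have a: "arc (yy P) Q Zero"
      by (rule arc_pencil[OF L gL nP(2-5) y(1,2) qy goodS_notin[OF y(6)] QC LQ qQ Q(3) quad_negv[OF qy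
          qQ]]) simp
    have "Z (fst H) = Zero"
      using point_zero[OF L G(1) gL ZC dif_zero[OF Z] nP(2-5)] .
    then have "ev H Z = Zero" by (simp add: ev_def)
    then show ?thesis unfolding edgeOK_def
      using a arc_refl[OF qy] arc_refl[OF qQ] \<phi> nQ by (intro exI[of _ "yy P"] exI[of _ Q] exI[of _
          Zero]) simp
  next
    case False
    have \<phi>: "\<phi> P = ?X" using False by (simp add: \<phi>_def)
    have qX: "quad ?X" by (rule nr_quad[OF P(2) False])
    have LX: "?L \<subseteq> z ?X" by (rule near_sub[OF n])
    have XC: "?X \<in> C" by (rule near_C[OF n])
    show ?thesis
    proof (cases "?X = Q")
      case True
      have GX: "ev G ?X = Pos" using True GQ by simp
      have "dif G ?X P (negv Z)" using dif_negv[OF Z] True by simp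
      then have "uu P = negv Z"
        using dif_unique[OF near_comod(1)[OF P(1) n] G(1,3) uu_dif[OF P(1)]] by blast
      then have "aval P = sneg (ev H Z)" using GX P(1) by (simp add: aval_def)
      moreover have "ssum (sneg d) d Zero" for d by (cases d) (auto simp: ssum_def)
      ultimately show ?thesis unfolding edgeOK_def
        using arc_refl[OF qQ] \<phi> nQ True by (intro exI[of _ Q] exI[of _ Q] exI[of _ Zero]) simp
    next
      case XQ: False
      note c = comodI[OF L XC LX QC LQ XQ quad_negv[OF qX qQ]]
      obtain Z0 where Z0: "dif G ?X Q Z0" using dif_ex[OF c(1) G(3)] by blast
      have Z0C: "Z0 \<in> C" "?L \<subseteq> z Z0" using dif_in_C[OF c(1) Z0] GQ dif_sub[OF Z0] c(2) by auto
      obtain h where h: "h \<in> z Q" "h \<notin> z P - {p}" using line_psubset[OF L QC LQ] by blast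
      have hp: "h \<noteq> p" using h F by (metis IntI bad_def P(1) pz)
      have "h \<notin> z ?X" "h \<in> E" using h c(2) z_sub[of Q] by blast+
      then have Xh: "?X h \<noteq> Zero" by (simp add: in_z)
      have Qh: "Q h = Zero" using h by (simp add: in_z)
      have "Z0 h = Z h" "Z h \<noteq> Zero"
        using dif_right[OF Z0 Qh] dif_right[OF Z Qh] near_sign[OF n hp Xh] GQ Xh by auto
      then have "Z0 = Z"
        by (rule point_eqI[OF L G(1) gL Z0C dif_zero[OF Z0] ZC dif_zero[OF Z]])
      then have Zd: "dif G ?X Q Z" using Z0 by simp
      have "p \<notin> z ?X" using near_bad_p[OF P(1) n] pz by blast
      then have "EdS S ?X Q" using Q(3) goodS_notin c(2) by (auto simp: EdS_def)
      then have a: "arc ?X Q (ev H Z)" using c(1) Zd qX qQ unfolding arc_def by blast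
      have "aval P = Zero" if d: "ev H Z = Zero"
      proof (cases "ev G ?X = Pos")
        case True
        have UC: "uu P \<in> C" using dif_in_C[OF near_comod(1)[OF P(1) n] uu_dif[OF P(1)]] GP by simp
        have LU: "?L \<subseteq> z (uu P)" using dif_sub[OF uu_dif[OF P(1)]] near_comod(2)[OF P(1) n] by simp
        have "Z (fst H) = Zero" using d H by (simp add: ev_eq_Zero)
        then have "uu P (fst H) = Zero"
          by (rule point_zero[OF L G(1) gL UC LU dif_zero[OF uu_dif[OF P(1)]] ZC dif_zero[OF Z]])
        then show ?thesis by (simp add: aval_def ev_def)
      qed (simp add: aval_def)
      then show ?thesis unfolding edgeOK_def
        using a arc_refl[OF qX] arc_refl[OF qQ] \<phi> nQ
        by (intro exI[of _ ?X] exI[of _ Q] exI[of _ "ev H Z"]) simp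
    qed
  qed
qed

end

section \<open>Edges on new lines\<close>

locale bad_edge = lex_edge E C p D \<sigma> T e \<alpha> G H + bad_plane E C p D \<sigma> T e \<alpha> F
  for E :: "'a set" and C p D \<sigma> T e \<alpha> G H F +
  fixes P Q Z :: "'a svec"
  assumes vP: "vert P" and vQ: "vert Q" and PQ: "comod P Q" and FPQ: "F = z P \<inter> z Q"
    and Z: "dif G P Q Z"
begin

lemma PC: "P \<in> C" "Q \<in> C" "P \<noteq> Q" "P \<noteq> negv Q"
  using PQ by (auto simp: comod_def)

lemma Q_ne: "Q \<noteq> P" "Q \<noteq> negv P"
  using PC by auto

lemma GPQ: "ev G P = Pos" "ev G Q = Pos" "ev H P = Pos" "ev H Q = Pos"
  using vP vQ by (auto simp: vert_def)

lemma Fz: "F \<subseteq> z P" "F \<subseteq> z Q"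
  using FPQ by blast+

lemma gF: "fst G \<notin> F" "fst H \<notin> F"
  using vert_line_notin[OF vP Fz(1)] by blast+

lemma ZC: "Z \<in> C"
  using dif_in_C[OF PQ Z] GPQ by simp

lemma F0z: "F0 \<subseteq> z P" "F0 \<subseteq> z Q"
  using Fz by blast+

lemma KZ: "K (fst G) \<subseteq> z Z"
  by (rule dif_K[OF Z F0z ZC G(1)])

lemma nrP: "near P (nr P)"
  using on_F[OF PC(1) Fz(1)] PC by (intro nr_near) (auto simp: bad_def)

lemma nrQ: "near Q (nr Q)"
  using on_F[OF PC(2) Fz(2)] PC by (intro nr_near) (auto simp: bad_def)

lemma bad_iff: "bad P \<longleftrightarrow> P e \<noteq> Zero" "bad Q \<longleftrightarrow> Q e \<noteq> Zero"
  using on_F[OF PC(1) Fz(1)] on_F[OF PC(2) Fz(2)] PC by (auto simp: bad_def)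

lemma one_bad: "bad P \<or> bad Q"
  using bad_iff FPQ eF eE by (auto simp: in_z)

lemma Kg: "line (K (fst G))" "p \<notin> K (fst G)"
  by (rule K_line[OF G(1) gF(1)], rule K_p[OF G(1) gF(1)])

lemma Ke: "line (K e)" "p \<notin> K e" "e \<in> K e"
  by (rule K_line[OF eE eF], rule K_p[OF eE eF], rule K_in[OF eE])

lemma Knr: "K e \<subseteq> z (nr P)" "K e \<subseteq> z (nr Q)"
  by (rule near_K[OF PC(1) Fz(1) nrP], rule near_K[OF PC(2) Fz(2) nrQ])

lemma S_good: "F0 \<subseteq> z V \<Longrightarrow> V e = Zero \<Longrightarrow> goodS S (z V)"
  using TF TE eE by (intro goodS_sub) (auto simp: in_z)

lemma nr_good: "goodS S (z (nr P))" "goodS S (z (nr Q))"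
  using near_e[OF nrP] near_e[OF nrQ] near_sub[OF nrP] near_sub[OF nrQ] F0z
  by (intro S_good; blast)+

lemma uu_K:
  assumes "bad V" "F \<subseteq> z V" "V \<in> C" "ev G V = Pos"
  shows "uu V \<in> C" "K (fst G) \<subseteq> z (uu V)"
proof -
  note n = nr_bad[OF assms(1)]
  show U: "uu V \<in> C" using dif_in_C[OF near_comod(1)[OF assms(1) n] uu_dif[OF assms(1)]] assms by simp
  have "F0 \<subseteq> z V" "F0 \<subseteq> z (nr V)" using assms near_sub[OF n] by blast+
  then show "K (fst G) \<subseteq> z (uu V)" using dif_K[OF uu_dif[OF assms(1)] _ _ U G(1)] by blast
qed

text \<open>All directions involved lie on the line of \<open>fst G\<close>, and here
  \<open>H\<close> contains that line.\<close>

lemma aval_zero: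
  assumes "fst H \<in> K (fst G)"
  shows "aval P = Zero" "aval Q = Zero" "ev H Z = Zero"
proof -
  have zero: "ev H V = Zero" if "K (fst G) \<subseteq> z V" for V
    using that assms by (auto simp: in_z ev_def)
  show "aval P = Zero" "aval Q = Zero" using uu_K(2) zero PC Fz GPQ unfolding aval_def by auto
  show "ev H Z = Zero" by (rule zero[OF KZ])
qed

lemma e_notin_Kg: "ev G (nr P) = Pos \<Longrightarrow> e \<notin> K (fst G)"
proof
  assume GX: "ev G (nr P) = Pos" and "e \<in> K (fst G)"
  then have "K (fst G) = K e" using K_eq G(1) gF(1) eF by blast
  then have "fst G \<in> z (nr P)" using K_in[OF G(1)] Knr(1) by blast
  then show False using GX by (simp add: in_z ev_def)
qed

lemma uu_e: "bad V \<Longrightarrow> ev G (nr V) = Pos \<Longrightarrow> ev (e, s) (uu V) = ev (e, s) V"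
  using dif_left[OF uu_dif near_e[OF nr_bad]] by (simp add: ev_def)

lemma ssum_parallel: "ssum q (sneg s) t \<Longrightarrow> ssum (smult c s) (smult c t) (smult c q)"
  by (cases q; cases s; cases t; cases c) (auto simp: ssum_def)

text \<open>Equal neighbours are settled by \<open>near_dif_same\<close>. Distinct ones lie on the
  line of \<open>e\<close>, and their direction is the neighbour of \<open>Z\<close> unless
  \<open>G\<close> vanishes at both. If its height is zero, \<open>H\<close> is zero or proportional
  to \<open>e\<close> on the line of \<open>fst G\<close>, and the identity of infinitesimal terms
  reduces to \<open>e(Z) = e(Q) - e(P)\<close>.\<close>

lemma edge_near:
  assumes nz: "\<not> zc P" "\<not> zc Q"
  shows "edgeOK P Q (ev H Z)"
proof -
  have \<phi>: "\<phi> P = nr P" "\<phi> Q = nr Q" using nz by (auto simp: \<phi>_def)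
  have q: "quad (nr P)" "quad (nr Q)" using nr_quad vP vQ nz by auto
  show ?thesis
  proof (cases "nr P = nr Q")
    case True
    \<comment> \<open>Equal neighbours have equal signs at \<open>p\<close>, so the two ends are off
      \<open>e\<close> together.\<close>
    have "sneg (smult \<alpha> (P e)) = sneg (smult \<alpha> (Q e))" using near_p[OF nrP] near_p[OF nrQ]
        True by simp
    then have "P e = Zero \<longleftrightarrow> Q e = Zero" using \<alpha> smult_eq_Zero[of \<alpha>] by
        (metis sneg_inject)
    then have b: "bad P" "bad Q" using one_bad bad_iff by auto
    have "ssum (aval P) (ev H Z) (aval Q)" if GX: "ev G (nr P) = Pos"
    proof -
      have nQ: "near Q (nr P)" using nrQ True by simp
      have U: "dif G (nr P) P (uu P)" "dif G (nr P) Q (uu Q)" using uu_dif[OF b(1)] uu_dif[OF b(2)] True by auto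
      have "ssum (uu P (fst H)) (Z (fst H)) (uu Q (fst H))"
        by (rule near_dif_same[OF b(1) Fz(1) nrP b(2) Fz(2) nQ PC(3) G GPQ(1,2) GX Z U])
      then show ?thesis using ssum_scale[of _ _ _ "snd H"] GX True b by (simp add: aval_def ev_def)
    qed
    then show ?thesis unfolding edgeOK_def
      using \<phi> True b arc_refl[OF q(1)]
      by (intro exI[of _ "nr P"] exI[of _ "nr P"] exI[of _ Zero]) (simp add: conf_def)
  next
    case False
    have XC: "nr P \<in> C" "nr Q \<in> C" using near_C nrP nrQ by auto
    note c = comodI[OF Ke(1) XC(1) Knr(1) XC(2) Knr(2) False quad_negv[OF q]]
    obtain Z0 where Z0: "dif G (nr P) (nr Q) Z0" using dif_ex[OF c(1) G(3)] by blast
    have "EdS S (nr P) (nr Q)" using nr_good c(2) goodS_notin[OF Ke(2)] by (simp add: EdS_def)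
    then have a: "arc (nr P) (nr Q) (ev H Z0)" using c(1) q Z0 unfolding arc_def by blast
    have s: "ev H Z0 = Zero \<or> ev H Z0 = ev H Z"
    proof (cases "ev G (nr P) = Zero \<and> ev G (nr Q) = Zero")
      case True then show ?thesis using ev_ssum[OF Z0, of H] by simp
    next
      case nz: False
      have "near Z Z0"
        by (rule near_dif[OF PC(1) Fz(1) nrP PC(2) Fz(2) nrQ PC(3) G GPQ(1,2) Z c(1) Z0]) (use nz in blast)
      then show ?thesis using near_ev[OF _ H(2)] by metis
    qed
    have fin: "ssum (aval P) (ev H Z) (aval Q) \<and> (aval P \<noteq> Zero \<and> aval Q \<noteq> Zero
        \<longrightarrow> conf P Q)"
      if s0: "ev H Z0 = Zero" and GX: "ev G (nr P) = Pos" "ev G (nr Q) = Pos"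
    proof -
      have Z0C: "Z0 \<in> C" using dif_in_C[OF c(1) Z0] GX by simp
      have KZ0: "K e \<subseteq> z Z0" using dif_sub[OF Z0] c(2) by simp
      have F0n: "F0 \<subseteq> z (nr P)" "F0 \<subseteq> z (nr Q)" using F0_K[OF eE] Knr by blast+
      have KgZ0: "K (fst G) \<subseteq> z Z0" by (rule dif_K[OF Z0 F0n Z0C G(1)])
      have eK: "e \<notin> K (fst G)" by (rule e_notin_Kg[OF GX(1)])
      have cf: "conf P Q" if "aval P \<noteq> Zero" "aval Q \<noteq> Zero"
      proof -
        have "bad P" "bad Q" using that by (auto simp: aval_def split: if_splits)
        moreover have "ev H W = Zero" if "dif G (nr P) (nr Q) W" for W
          using dif_unique[OF c(1) G(1,3) Z0 that] s0 by simp
        ultimately show ?thesis using c(1) by (auto simp: conf_def)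
      qed
      consider "fst H \<in> K (fst G)" | c where "c \<noteq> Zero"
        "\<forall>V\<in>C. K (fst G) \<subseteq> z V \<longrightarrow> ev H V = smult c (ev (e, \<alpha>) V)"
        using near_dif_parallel[OF G(1) gF(1) Z0C KZ0 KgZ0 s0 eK H(1,3)] by blast
      then show ?thesis
      proof cases
        case 1
        then show ?thesis using aval_zero by simp
      next
        case (2 c)
        have av: "aval V = smult c (ev (e, \<alpha>) V)"
          if V: "V \<in> C" "F \<subseteq> z V" "ev G V = Pos" "ev G (nr V) = Pos" "bad V
              \<longleftrightarrow> V e \<noteq> Zero" for V
        proof (cases "bad V")
          case True
          show ?thesis using True V 2(2) uu_e[OF True V(4)] uu_K[OF True V(2,1,3)] by (simp add: aval_def)
        next
          case False then show ?thesis using V(5) by (simp add: aval_def ev_def)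
        qed
        have "ev H Z = smult c (ev (e, \<alpha>) Z)" using 2(2) ZC KZ by blast
        moreover have "ssum (ev (e, \<alpha>) Q) (sneg (ev (e, \<alpha>) P)) (ev (e, \<alpha>) Z)"
          using ev_ssum[OF Z, of "(e, \<alpha>)"] GPQ by simp
        ultimately show ?thesis
          using ssum_parallel[of _ _ _ c] cf av[OF PC(1) Fz(1) GPQ(1) GX(1) bad_iff(1)]
            av[OF PC(2) Fz(2) GPQ(2) GX(2) bad_iff(2)] by simp
      qed
    qed
    show ?thesis unfolding edgeOK_def
      using a s fin \<phi> arc_refl[OF q(1)] arc_refl[OF q(2)]
      by (intro exI[of _ "nr P"] exI[of _ "nr Q"] exI[of _ "ev H Z0"]) simp
  qed
qed

text \<open>\<open>X\<close> is the point of the line of \<open>fst G\<close> where both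
  \<open>a\<close> and \<open>H\<close> vanish, so they are parallel there unless \<open>H\<close>
  contains the line; the sign of \<open>H\<close> is then read off at \<open>a\<close>.\<close>

lemma pencil_sign:
  assumes X: "X \<in> C" "F0 \<subseteq> z X" "X (fst G) = Zero" "X (fst H) = Zero"
    and a: "a \<in> E" "a \<notin> K (fst G)" "X a = Zero"
    and V: "V \<in> C" "K (fst G) \<subseteq> z V" and W: "W \<in> C" "K (fst G) \<subseteq> z W" and eq:
        "V a = W a"
  shows "ev H V = ev H W" "fst H \<notin> K (fst G) \<Longrightarrow> V a \<noteq> Zero \<Longrightarrow>
      ev H V \<noteq> Zero"
proof -
  have KX: "K (fst G) \<subseteq> z X" by (rule K_sub[OF X(1-3) G(1)])
  show "ev H V = ev H W"
  proof (cases "fst H \<in> K (fst G)")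
    case True
    then have "V (fst H) = Zero" "W (fst H) = Zero" using V W by (auto simp: in_z)
    then show ?thesis by (simp add: ev_def)
  next
    case False
    then show ?thesis
      using parallel_eq[OF Kg(1) X(1) KX _ _ _ _ H(1) _ X(4) H(3) V W, of "(a, Pos)"] a eq by simp
  qed
  assume f: "fst H \<notin> K (fst G)" and nz: "V a \<noteq> Zero"
  show "ev H V \<noteq> Zero"
  proof
    assume "ev H V = Zero"
    then have "V (fst H) = Zero" using H by (simp add: ev_eq_Zero)
    then have "V a = Zero" using point_zero[OF Kg(1) H(1) f V _ X(1) KX X(4) a(3)] by blast
    then show False using nz by simp
  qed
qed

text \<open>\<open>yy P\<close> and \<open>nr Q\<close> need not lie on a common line. The detour
  follows the line of \<open>h\<close> to its intersection \<open>B\<close> with the line of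
  \<open>e\<close>, and then the latter. On the second piece the height is constant, by the pencil
  through \<open>nr P\<close> or because the whole line is at infinity.\<close>

lemma edge_pencil:
  assumes zP: "zc P" and zQ: "\<not> zc Q"
  shows "edgeOK P Q (ev H Z)"
proof -
  let ?X = "nr P" and ?X' = "nr Q" and ?L = "z P - {p}" and ?Y = "yy P"
  define h where "h = hx (z ?X)"
  note n = zc_nr[OF zP]
  note h = hx_prop[OF n(2), folded h_def]
  note y = yy_prop[OF zP vP, folded h_def]
  have b: "bad P" using zP by (simp add: zc_def)
  have \<phi>: "\<phi> P = ?Y" "\<phi> Q = ?X'" "aval P = Zero" using zP zQ by (auto simp: \<phi>_def
      aval_def zc_def)
  have XC': "?X' \<in> C" by (rule near_C[OF nrQ])
  have qX': "quad ?X'" by (rule nr_quad[OF vQ zQ])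
  have qY: "quad ?Y" using y by (simp add: quad_def)
  have F0L: "F0 \<subseteq> ?L" using Fz by blast
  have F0X: "F0 \<subseteq> z ?X" using F0L n(3) by blast
  have F0Y: "F0 \<subseteq> z ?Y" using F0L y(2) by blast
  have hF: "h \<notin> F" using F0X h by (auto simp: in_z)
  have M: "line (K h)" "p \<notin> K h" using K_line[OF h(1) hF] K_p[OF h(1) hF] by auto
  have YM: "K h \<subseteq> z ?Y" by (rule K_sub[OF y(1) F0Y y(3) h(1)])
  obtain a where a: "a \<in> E" "a \<noteq> p" "a \<notin> F" "P a = Zero" "Q a \<noteq> Zero"
    by (rule anchor[OF PC(1) Fz(1) PC(2) Fz(2) PC(3,4)])
  have aL: "a \<in> ?L" using a by (simp add: in_z)
  have Xa: "?X a = Zero" and Ya: "?Y a = Zero" using aL n(3) y(2) by (auto simp: in_z)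
  have LK: "?L = K a" using bad_K[OF b Fz(1) _ a(3)] aL by blast
  have gL: "fst G \<notin> ?L" using vert_line_notin[OF vP] by blast
  have aKg: "a \<notin> K (fst G)" using K_eq[OF _ G(1) gF(1) a(3)] K_in[OF G(1)] LK gL by blast
  have aKe: "a \<notin> K e" using K_eq[OF _ eE eF a(3)] K_in[OF eE] LK bad_e[OF b] by blast
  have XX': "\<not> (?X' = ?X \<or> ?X' = negv ?X)"
    using qX' n(4,5) by (auto simp: quad_def ev_def)
  have X'a: "?X' a \<noteq> Zero"
    using line_point_unique[OF Ke(1) a(1) aKe XC' Knr(2) _ n(2) Knr(1) Xa] XX' by blast
  have Qa: "Q a = ?X' a" by (rule near_sign[OF nrQ a(2) X'a])
  have Za: "Z a = Q a" using dif_left[OF Z a(4)] GPQ by simp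
  have only: "\<not> (V x = Zero \<and> x \<in> E \<and> x \<notin> K e \<and> ?X x = Zero)" if V: "V \<in>
      C" "K e \<subseteq> z V" "V h = Zero" for V x
    using point_zero[OF Ke(1) _ _ n(2) Knr(1) _ V(1,2) _ V(3)] h(3) by blast
  have YB: "comod ?Y B" "z ?Y \<inter> z B = K h" if B: "B \<in> C" "K e \<subseteq> z B" "B h = Zero"
      "quad B" for B
  proof -
    have F0B: "F0 \<subseteq> z B" using F0_K[OF eE] B(2) by blast
    have BM: "K h \<subseteq> z B" by (rule K_sub[OF B(1) F0B B(3) h(1)])
    have "?Y \<noteq> B"
    proof
      assume "?Y = B"
      then have "?Y e = Zero" using B(2) Ke(3) by (auto simp: in_z)
      then show False
        using point_zero[OF n(6) eE bad_e[OF b] n(2,3) near_e[OF nrP] y(1,2) _ y(3)] h(3) by blast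
    qed
    then show "comod ?Y B" "z ?Y \<inter> z B = K h"
      using comodI[OF M(1) y(1) YM B(1) BM _ quad_negv[OF qY B(4)]] by auto
  qed
  have EdB: "EdS S ?Y B" if B: "B \<in> C" "K e \<subseteq> z B" "B h = Zero" "quad B" for B
  proof -
    have "goodS S (z B)" using F0_K[OF eE] B(2) Ke(3) by (intro S_good) (auto simp: in_z)
    then show ?thesis using YB(2)[OF B] goodS_notin[OF M(2)] goodS_notin[OF y(6)] by (simp add: EdS_def)
  qed
  have gdB: "goodS S (z B)" if "K e \<subseteq> z B" for B
    using F0_K[OF eE] that Ke(3) by (intro S_good) (auto simp: in_z)
  show ?thesis
  proof (cases "fst G \<in> K e")
    case False
    have "?X' (fst G) \<noteq> Zero"
      using line_point_unique[OF Ke(1) G(1) False XC' Knr(2) _ n(2) Knr(1) n(4)] XX' by blast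
    then have GX': "ev G ?X' = Pos" using qX' G(3) by (cases "ev G ?X'") (auto simp: quad_def ev_eq_Zero)
    have "ev G V \<noteq> Zero" if V: "V \<in> C" "K e \<subseteq> z V" "V h = Zero" for V
      using only[OF V, of "fst G"] G False n(4) by (simp add: ev_eq_Zero)
    then obtain B where B: "B \<in> C" "K e \<subseteq> z B" "B h = Zero" "ev G B = Pos"
      using signed_point_ex[OF Ke(1) h(1)] by blast
    have eqG: "ev G B = ev G ?X'" using B(4) GX' by simp
    have "ev (a, Pos) B = ev (a, Pos) ?X'"
      by (rule parallel_eq[OF Ke(1) n(2) Knr(1) G(1) False n(4) G(3) _ _ _ _ B(1,2) XC' Knr(2) eqG])
        (use a aKe Xa in auto)
    then have Ba: "B a = ?X' a" by simp
    have "ev H B \<noteq> Neg"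
    proof (cases "fst H \<in> K e")
      case True
      then have "B (fst H) = Zero" using B(2) by (auto simp: in_z)
      then show ?thesis by (simp add: ev_def)
    next
      case fK: False
      have "ev H B = ev H ?X'"
        by (rule parallel_eq[OF Ke(1) n(2) Knr(1) G(1) False n(4) G(3) H(1) fK n(5) H(3) B(1,2) XC' Knr(2) eqG])
      then show ?thesis using qX' by (simp add: quad_def)
    qed
    then have qB: "quad B" using B(4) by (simp add: quad_def)
    note c = YB[OF B(1-3) qB]
    obtain W where W: "dif G ?Y B W" using dif_ex[OF c(1) G(3)] by blast
    have WC: "W \<in> C" using dif_in_C[OF c(1) W] B(4) by simp
    have F0B: "F0 \<subseteq> z B" using F0_K[OF eE] B(2) by blast
    have KW: "K (fst G) \<subseteq> z W" by (rule dif_K[OF W F0Y F0B WC G(1)])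
    have Wa: "Z a = W a" using dif_left[OF W Ya] y(4) Ba Za Qa by simp
    have ZW: "ev H Z = ev H W"
      by (rule pencil_sign(1)[OF n(2) F0X n(4,5) a(1) aKg Xa ZC KZ WC KW Wa])
    then have arc1: "arc ?Y B (ev H Z)" using c(1) EdB[OF B(1-3) qB] W qY qB unfolding arc_def by metis
    have arc2: "arc B ?X' Zero"
      by (rule arc_pencil[OF Ke(1) False n(2) Knr(1) n(4,5) B(1,2) qB gdB[OF B(2)] XC' Knr(2) qX' nr_good(2)
        quad_negv[OF qB qX'] Ke(2)])
    have "aval Q = Zero" if d: "ev H Z = Zero"
    proof -
      have "fst H \<in> K (fst G)"
        using pencil_sign(2)[OF n(2) F0X n(4,5) a(1) aKg Xa ZC KZ WC KW Wa] d Za a(5) by auto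
      then show ?thesis by (rule aval_zero)
    qed
    then show ?thesis unfolding edgeOK_def
      using arc_refl[OF qY] arc1 arc2 \<phi> by (intro exI[of _ ?Y] exI[of _ B] exI[of _ "ev H Z"]) simp
  next
    case True
    \<comment> \<open>Now the line of \<open>e\<close> is at infinity: \<open>B\<close> and
      \<open>nr Q\<close> have \<open>G\<close> zero and \<open>H\<close> positive, and the step to
      \<open>B\<close> is strictly upward.\<close>
    have KK: "K e = K (fst G)" by (rule K_eq[OF True eE eF gF(1)])
    have GX': "ev G ?X' = Zero" using True Knr(2) by (auto simp: in_z ev_def)
    then have HX': "ev H ?X' = Pos" using qX' by (cases "ev H ?X'") (auto simp: quad_def)
    have fK: "fst H \<notin> K e" using HX' Knr(2) by (auto simp: in_z ev_def)
    have "ev H V \<noteq> Zero" if V: "V \<in> C" "K e \<subseteq> z V" "V h = Zero" for V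
      using only[OF V, of "fst H"] H fK n(5) by (simp add: ev_eq_Zero)
    then obtain B where B: "B \<in> C" "K e \<subseteq> z B" "B h = Zero" "ev H B = Pos"
      using signed_point_ex[OF Ke(1) h(1)] by blast
    have GB: "ev G B = Zero" using True B(2) by (auto simp: in_z ev_def)
    have qB: "quad B" using B(4) GB by (simp add: quad_def)
    note c = YB[OF B(1-3) qB]
    obtain W where W: "dif G ?Y B W" using dif_ex[OF c(1) G(3)] by blast
    have HW: "ev H W = Pos" using ev_ssum[OF W, of H] GB B(4) y(4) by simp
    have "ev H Z = ev H ?X'"
      by (rule parallel_eq[OF Ke(1) n(2) Knr(1) _ _ _ _ H(1) fK n(5) H(3) ZC _ XC' Knr(2), of "(a, Pos)"])
        (use a aKe Xa KZ KK Za Qa in auto)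
    then have HZ: "ev H Z = Pos" using HX' by simp
    have arc1: "arc ?Y B Pos" using c(1) EdB[OF B(1-3) qB] W HW qY qB unfolding arc_def by blast
    have arc2: "arc B ?X' Zero"
    proof (cases "B = ?X'")
      case True then show ?thesis using arc_refl[OF qB] by simp
    next
      case ne: False
      note c' = comodI[OF Ke(1) B(1,2) XC' Knr(2) ne quad_negv[OF qB qX']]
      obtain V where V: "dif G B ?X' V" using dif_ex[OF c'(1) G(3)] by blast
      have "ev H V = Zero" using ev_ssum[OF V, of H] GB GX' by simp
      moreover have "EdS S B ?X'" using c'(2) gdB[OF B(2)] nr_good(2) goodS_notin[OF Ke(2)] by (simp add:
          EdS_def)
      ultimately show ?thesis using c'(1) V qB qX' unfolding arc_def by blast
    qed
    show ?thesis unfolding edgeOK_def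
      using arc_refl[OF qY] arc1 arc2 \<phi> HZ by (intro exI[of _ ?Y] exI[of _ B] exI[of _ Pos]) simp
  qed
qed

text \<open>If the neighbours agree up to sign, both auxiliary points vanish at the same
  \<open>h\<close> and are joined by its line. Otherwise \<open>G\<close> and \<open>H\<close> both
  contain the line of \<open>e\<close>, no height changes, and the path turns at the intersection of
  the two old lines.\<close>

lemma edge_two_pencils:
  assumes zP: "zc P" and zQ: "zc Q"
  shows "edgeOK P Q (ev H Z)"
proof -
  let ?X = "nr P" and ?X' = "nr Q" and ?Y = "yy P" and ?Y' = "yy Q" and ?L = "z P - {p}" and ?L' = "z Q - {p}"
  define h where "h = hx (z ?X)"
  note n = zc_nr[OF zP] and n' = zc_nr[OF zQ]
  note h = hx_prop[OF n(2), folded h_def]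
  note y = yy_prop[OF zP vP, folded h_def] and y' = yy_prop[OF zQ vQ]
  have b: "bad P" "bad Q" using zP zQ by (auto simp: zc_def)
  have \<phi>: "\<phi> P = ?Y" "\<phi> Q = ?Y'" "aval P = Zero" "aval Q = Zero"
    using zP zQ by (auto simp: \<phi>_def aval_def zc_def)
  have qY: "quad ?Y" "quad ?Y'" using y y' by (auto simp: quad_def)
  have F0L: "F0 \<subseteq> ?L" "F0 \<subseteq> ?L'" using Fz by blast+
  have F0X: "F0 \<subseteq> z ?X" "F0 \<subseteq> z ?X'" using F0L n(3) n'(3) by blast+
  have F0Y: "F0 \<subseteq> z ?Y" "F0 \<subseteq> z ?Y'" using F0L y(2) y'(2) by blast+
  obtain a where a: "a \<in> E" "a \<noteq> p" "a \<notin> F" "P a = Zero" "Q a \<noteq> Zero"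
    by (rule anchor[OF PC(1) Fz(1) PC(2) Fz(2) PC(3,4)])
  obtain b' where b': "b' \<in> E" "b' \<noteq> p" "b' \<notin> F" "Q b' = Zero" "P b' \<noteq> Zero"
    by (rule anchor[OF PC(2) Fz(2) PC(1) Fz(1) Q_ne])
  have aL: "a \<in> ?L" using a by (simp add: in_z)
  have bL: "b' \<in> ?L'" using b' by (simp add: in_z)
  have gL: "fst G \<notin> ?L" "fst G \<notin> ?L'" using vert_line_notin[OF vP] vert_line_notin[OF vQ] by
      blast+
  have LK: "?L = K a" using bad_K[OF b(1) Fz(1) _ a(3)] aL by blast
  have LK': "?L' = K b'" using bad_K[OF b(2) Fz(2) _ b'(3)] bL by blast
  have b'L: "b' \<notin> ?L" using b' by (simp add: in_z)
  have Xa: "?X a = Zero" and Ya: "?Y a = Zero" using aL n(3) y(2) by (auto simp: in_z)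
  have Xb: "?X' b' = Zero" and Yb: "?Y' b' = Zero" using bL n'(3) y'(2) by (auto simp: in_z)
  show ?thesis
  proof (cases "z ?X = z ?X'")
    case True
    have hF: "h \<notin> F" using F0X(1) h by (auto simp: in_z)
    have M: "line (K h)" "p \<notin> K h" using K_line[OF h(1) hF] K_p[OF h(1) hF] by auto
    have y'h: "?Y' h = Zero" using y'(3) True by (simp add: h_def)
    have YM: "K h \<subseteq> z ?Y" "K h \<subseteq> z ?Y'"
      using K_sub[OF y(1) F0Y(1) y(3) h(1)] K_sub[OF y'(1) F0Y(2) y'h h(1)] by auto
    have Xb': "?X b' = Zero" using True Xb b'(1) in_z by blast
    have "?Y \<noteq> ?Y'"
    proof
      assume "?Y = ?Y'"
      then have "?Y b' = Zero" using Yb by simp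
      then show False using point_zero[OF n(6) b'(1) b'L n(2,3) Xb' y(1,2) _ y(3)] h(3) by blast
    qed
    note c = comodI[OF M(1) y(1) YM(1) y'(1) YM(2) this quad_negv[OF qY]]
    obtain W where W: "dif G ?Y ?Y' W" using dif_ex[OF c(1) G(3)] by blast
    have WC: "W \<in> C" using dif_in_C[OF c(1) W] y(4) by simp
    have KW: "K (fst G) \<subseteq> z W" by (rule dif_K[OF W F0Y WC G(1)])
    have X'a: "?X' a = Zero" using True Xa a(1) in_z by blast
    have aL': "a \<notin> ?L'" using a by (simp add: in_z)
    have eqG: "ev G ?Y' = ev G Q" using y'(4) GPQ by simp
    have "ev (a, Pos) ?Y' = ev (a, Pos) Q"
      by (rule parallel_eq[OF n'(6) n'(2,3) G(1) gL(2) n'(4) G(3) _ _ _ _ y'(1,2) PC(2) _ eqG])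
        (use a aL' X'a in auto)
    then have "?Y' a = Q a" by simp
    then have Wa: "Z a = W a" using dif_left[OF W Ya] dif_left[OF Z a(4)] y(4) GPQ by simp
    have aKg: "a \<notin> K (fst G)" using K_eq[OF _ G(1) gF(1) a(3)] K_in[OF G(1)] LK gL by blast
    have "ev H Z = ev H W"
      by (rule pencil_sign(1)[OF n(2) F0X(1) n(4,5) a(1) aKg Xa ZC KZ WC KW Wa])
    moreover have "EdS S ?Y ?Y'"
      using c(2) goodS_notin[OF M(2)] goodS_notin[OF y(6)] goodS_notin[OF y'(6)] by (simp add: EdS_def)
    ultimately have arc1: "arc ?Y ?Y' (ev H Z)" using c(1) W qY unfolding arc_def by metis
    then show ?thesis unfolding edgeOK_def
      using arc_refl[OF qY(1)] arc_refl[OF qY(2)] \<phi>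
      by (intro exI[of _ ?Y] exI[of _ ?Y'] exI[of _ "ev H Z"]) simp
  next
    case False
    then have XX': "?X \<noteq> ?X'" "?X \<noteq> negv ?X'" by auto
    have Kz: "z ?X \<inter> z ?X' = K e" by (rule line_inter[OF Ke(1) n(2) n'(2) Knr XX'])
    have gf: "fst G \<in> K e" "fst H \<in> K e"
      using n(4,5) n'(4,5) G H Kz[symmetric] by (auto simp: in_z)
    have KK: "K e = K (fst G)" by (rule K_eq[OF gf(1) eE eF gF(1)])
    have "Z (fst H) = Zero" using gf(2) KK KZ by (auto simp: in_z)
    then have d: "ev H Z = Zero" by (simp add: ev_def)
    have "?X b' \<noteq> Zero"
    proof
      assume Xb': "?X b' = Zero"
      have "?L' \<subseteq> z ?X" using K_sub[OF n(2) F0X(1) Xb' b'(1)] LK' by simp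
      from line_point_unique[OF n'(6) eE bad_e[OF b(2)] n(2) this near_e[OF nrP] n'(2,3) near_e[OF nrQ]]
      show False using XX' by blast
    qed
    have "ev G V \<noteq> Zero" if V: "V \<in> C" "?L \<subseteq> z V" "V b' = Zero" for V
    proof
      assume "ev G V = Zero"
      then have Vg: "V (fst G) = Zero" using G by (simp add: ev_eq_Zero)
      show False using point_zero[OF n(6) G(1) gL(1) n(2,3,4) V(1,2) Vg V(3)] \<open>?X b' \<noteq>
          Zero\<close> by blast
    qed
    then obtain B where B: "B \<in> C" "?L \<subseteq> z B" "B b' = Zero" "ev G B = Pos"
      using signed_point_ex[OF n(6) b'(1)] by blast
    have F0B: "F0 \<subseteq> z B" using F0L B(2) by blast
    have LB': "?L' \<subseteq> z B" using K_sub[OF B(1) F0B B(3) b'(1)] LK' by simp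
    have HB: "ev H B = Pos" using zc_par[OF zP vP B(1,2)] B(4) by simp
    have qB: "quad B" using B(4) HB by (simp add: quad_def)
    have pB: "p \<notin> z B"
    proof
      assume "p \<in> z B"
      then have "B = P \<or> B = negv P" using bad_points[OF b(1) B(1,2)] pz by blast
      then have "P b' = Zero" using B(3) by (metis negv_apply sneg_eq_iff(1))
      then show False using b'(5) by simp
    qed
    have arc1: "arc ?Y B Zero"
      by (rule arc_pencil[OF n(6) gL(1) n(2,3,4,5) y(1,2) qY(1) goodS_notin[OF y(6)] B(1,2) qB
          goodS_notin[OF pB]
        quad_negv[OF qY(1) qB]]) simp
    have arc2: "arc B ?Y' Zero"
      by (rule arc_pencil[OF n'(6) gL(2) n'(2,3,4,5) B(1) LB' qB goodS_notin[OF pB] y'(1,2) qY(2)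
          goodS_notin[OF y'(6)]
        quad_negv[OF qB qY(2)]]) simp
    show ?thesis unfolding edgeOK_def
      using arc1 arc2 arc_refl[OF qB] \<phi> d by (intro exI[of _ B] exI[of _ B] exI[of _ Zero]) simp
  qed
qed

end

context lex_edge
begin

text \<open>If the line is allowed at the next level and \<open>P\<close> is bad, the line avoids
  \<open>p\<close>; it is then the old line of \<open>P\<close>, and \<open>Q\<close> is not bad.
  The lines not allowed contain \<open>p\<close> and \<open>T\<close> but not \<open>e\<close>,
  which is the setting of \<open>bad_edge\<close>.\<close>

lemma edge_OK:
  assumes vP: "vert P" and vQ: "vert Q" and PQ: "comod P Q" and Ed: "EdS T P Q" and Z: "dif G P Q Z"
  shows "edgeOK P Q (ev H Z)"
proof -
  have PC: "P \<in> C" "Q \<in> C" "P \<noteq> Q" "P \<noteq> negv Q" and F: "line (z P \<inter> z Q)"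
      using PQ by (auto simp: comod_def)
  have gd: "goodS S (z V)" if V: "\<not> bad V" "V \<in> C" "goodS T (z V)" for V
  proof (cases "p \<in> z V \<and> T \<subseteq> z V")
    case True
    then have "V e = Zero" using V(1,2) pz[of V] by (simp add: bad_def)
    then have "e \<in> z V" using eE by (simp add: in_z)
    then show ?thesis using True by (intro goodS_sub) simp
  qed (use V(3) in \<open>auto simp: goodS_def\<close>)
  have old_line: "edgeOK P Q (ev H Z)"
    if b: "bad P" and gF: "goodS S (z P \<inter> z Q)" and vP: "vert P" and vQ: "vert Q" and PQ: "comod P Q"
      and Ed: "EdS T P Q" and Z: "dif G P Q Z" for P Q Z
  proof -
    have PC: "P \<in> C" "Q \<in> C" "P \<noteq> Q" "P \<noteq> negv Q" and F: "line (z P \<inter> z Q)"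
        using PQ by (auto simp: comod_def)
    have pcl: "p \<notin> cl (z P - {p})" using new_p[of P] b by (simp add: bad_def)
    have pF: "p \<notin> z P \<inter> z Q"
    proof
      assume p: "p \<in> z P \<inter> z Q"
      have "p \<notin> cl (z P \<inter> z Q - {p})" using pcl cl_mono[of "z P \<inter> z Q - {p}" "z P -
          {p}"] by blast
      then have "e \<in> z P" using gF p unfolding goodS_def by simp
      then show False using bad_e[OF b] ep by blast
    qed
    then have "z P \<inter> z Q \<subseteq> z P - {p}" by blast
    then have FL: "z P \<inter> z Q = z P - {p}" by (rule lines_eq[OF F bad_line[OF b]])
    have nb: "\<not> bad Q"
      using pF pz[of P] pz[of Q] b unfolding bad_def by simp
    have "goodS S (z Q)" using gd[OF nb PC(2)] Ed by (simp add: EdS_def)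
    then show ?thesis by (rule edge_old_line[OF b vP vQ nb _ PQ FL Z])
  qed
  show ?thesis
  proof (cases "goodS S (z P \<inter> z Q)")
    case True
    consider "bad P" | "bad Q" | "\<not> bad P" "\<not> bad Q" by blast
    then show ?thesis
    proof cases
      case 1 then show ?thesis using old_line[OF 1 True vP vQ PQ Ed Z] by blast
    next
      case 2
      have "goodS S (z Q \<inter> z P)" using True by (simp add: Int_commute)
      from edgeOK_sym[OF old_line[OF 2 this vQ vP comod_sym[OF PQ] EdS_sym[OF Ed] dif_negv[OF Z]]]
      show ?thesis by simp
    next
      case 3
      then have \<phi>: "\<phi> P = P" "\<phi> Q = Q" "aval P = Zero" "aval Q = Zero"
        by (auto simp: \<phi>_def zc_def nr_def aval_def)
      have "EdS S P Q" using gd[OF 3(1) PC(1)] gd[OF 3(2) PC(2)] Ed True by (simp add: EdS_def)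
      then have "arc P Q (ev H Z)" using PQ Z quad_vert[OF vP] quad_vert[OF vQ] unfolding arc_def by blast
      then show ?thesis unfolding edgeOK_def
        using \<phi> arc_refl[OF quad_vert[OF vP]] arc_refl[OF quad_vert[OF vQ]]
        by (intro exI[of _ P] exI[of _ Q] exI[of _ "ev H Z"]) simp
    qed
  next
    case False
    then have b: "p \<in> z P \<inter> z Q" "T \<subseteq> z P \<inter> z Q" "e \<notin> z P \<inter> z Q"
      using Ed by (auto simp: goodS_def EdS_def)
    interpret PQ: bad_edge E C p D \<sigma> T e \<alpha> G H "z P \<inter> z Q" P Q Z
      using F b vP vQ PQ Z by unfold_locales auto
    have "z P \<inter> z Q = z Q \<inter> z P" by blast
    interpret QP: bad_edge E C p D \<sigma> T e \<alpha> G H "z P \<inter> z Q" Q P "negv Z"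
      using vP vQ comod_sym[OF PQ] dif_negv[OF Z] by unfold_locales auto
    consider "\<not> zc P" "\<not> zc Q" | "zc P" "\<not> zc Q" | "\<not> zc P" "zc Q" | "zc P" "zc Q" by blast
    then show ?thesis
    proof cases
      case 1 then show ?thesis by (rule PQ.edge_near)
    next
      case 2 then show ?thesis by (rule PQ.edge_pencil)
    next
      case 3 then show ?thesis using edgeOK_sym[OF QP.edge_pencil] by simp
    next
      case 4 then show ?thesis by (rule PQ.edge_two_pencils)
    qed
  qed
qed

end

section \<open>One step of the lexicographic perturbation\<close>

context bad_edge
begin

text \<open>If the heights of both ends differ infinitesimally from those of the neighbouring old points,
  then \<^term>\<open>ev H Z\<close> is governed by the old points \<^term>\<open>nr P\<close>,
      \<^term>\<open>nr Q\<close> and by the directions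
  \<^term>\<open>uu P\<close>, \<^term>\<open>uu Q\<close>.\<close>

lemma near_Z:
  assumes "near Z Zt"
  shows "Zt \<in> C" "K e \<subseteq> z Zt" "K (fst G) \<subseteq> z Zt" "Zt e = Zero" "Zt p = sneg (ev (e,
      \<alpha>) Z)"
    "ev H Zt = Zero \<or> ev H Zt = ev H Z"
proof -
  have FZ: "F \<subseteq> z Z" using dif_sub[OF Z] FPQ by simp
  show ZtC: "Zt \<in> C" by (rule near_C[OF assms])
  show "K e \<subseteq> z Zt" by (rule near_K[OF ZC FZ assms])
  have "Zt (fst G) = Zero" using near_sign[OF assms G(2)] dif_zero[OF Z] by auto
  moreover have "F0 \<subseteq> z Zt" using near_sub[OF assms] FZ by blast
  ultimately show "K (fst G) \<subseteq> z Zt" by (intro K_sub[OF ZtC _ _ G(1)])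
  show "Zt e = Zero" by (rule near_e[OF assms])
  show "Zt p = sneg (ev (e, \<alpha>) Z)" using near_p[OF assms] by (simp add: ev_def)
  show "ev H Zt = Zero \<or> ev H Zt = ev H Z" using near_ev[OF assms H(2)] by metis
qed

lemma uu_p: "bad V \<Longrightarrow> ev G V = Pos \<Longrightarrow> uu V p = ev (e, \<alpha>) V"
  using dif_right[OF uu_dif, of V p] near_p[OF nr_bad, of V] by (simp add: bad_def ev_def)

lemma parallel_e_H:
  assumes GX: "ev G (nr P) = Pos" and Zt: "near Z Zt" "ev H Zt = Zero" and a: "aval P \<noteq> Zero"
  shows "\<exists>c. c \<noteq> Zero \<and> (\<forall>V\<in>C. K (fst G) \<subseteq> z V \<longrightarrow>
      ev H V = smult c (ev (e, \<alpha>) V))"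
proof -
  note nz = near_Z[OF Zt(1)]
  have "fst H \<notin> K (fst G)" using aval_zero(1) a by blast
  then show ?thesis
    using near_dif_parallel[OF G(1) gF(1) nz(1-3) Zt(2) e_notin_Kg[OF GX] H(1,3)]
    by blast
qed

text \<open>By uniqueness of neighbours, the direction between the neighbours is the neighbour of
  the direction.\<close>

lemma conf_old_dif:
  assumes GX: "ev G (nr P) = Pos" and cf: "conf P Q" and ne: "nr P \<noteq> nr Q" and Zt: "near Z Zt"
  shows "comod (nr P) (nr Q)" "dif G (nr P) (nr Q) Zt" "ev H Zt = Zero"
proof -
  show c: "comod (nr P) (nr Q)" using cf ne by (auto simp: conf_def)
  obtain Z0 where Z0: "dif G (nr P) (nr Q) Z0" using dif_ex[OF c G(3)] by blast
  have FZ: "F \<subseteq> z Z" using dif_sub[OF Z] FPQ by simp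
  have "near Z Z0"
    by (rule near_dif[OF PC(1) Fz(1) nrP PC(2) Fz(2) nrQ PC(3) G GPQ(1,2) Z c Z0]) (use GX in simp)
  then have "Z0 = Zt" using near_unique[OF _ Zt ZC] on_F[OF ZC FZ] by blast
  then show "dif G (nr P) (nr Q) Zt" using Z0 by simp
  then show "ev H Zt = Zero" using cf ne by (auto simp: conf_def)
qed

text \<open>Equal neighbours have equal signs at \<open>p\<close>, which encode the signs of the
  ends at \<open>e\<close>. For distinct ones \<open>H\<close> is a fixed multiple of
  \<open>e\<close> on the directions, so equal \<open>aval\<close> forces equal signs at
  \<open>e\<close>.\<close>

lemma conf_e_sign:
  assumes GX: "ev G (nr P) = Pos" "ev G (nr Q) = Pos" and cf: "conf P Q" and a: "aval P = aval Q" "aval P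
      \<noteq> Zero"
  shows "ev (e, \<alpha>) P = ev (e, \<alpha>) Q"
proof -
  have b: "bad P" "bad Q" using cf by (auto simp: conf_def)
  have FZ: "F \<subseteq> z Z" using dif_sub[OF Z] FPQ by simp
  obtain Zt where Zt: "near Z Zt" using near_ex[OF ZC] on_F[OF ZC FZ] by blast
  show ?thesis
  proof (cases "nr P = nr Q")
    case True
    then show ?thesis using near_p[OF nrP] near_p[OF nrQ] by (simp add: ev_def)
  next
    case False
    obtain c where c: "c \<noteq> Zero" "\<forall>V\<in>C. K (fst G) \<subseteq> z V \<longrightarrow> ev H
        V = smult c (ev (e, \<alpha>) V)"
      using parallel_e_H[OF GX(1) Zt conf_old_dif(3)[OF GX(1) cf False Zt] a(2)] by blast
    have "aval P = smult c (ev (e, \<alpha>) P)" "aval Q = smult c (ev (e, \<alpha>) Q)"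
      using c(2) uu_K[OF b(1) Fz(1) PC(1) GPQ(1)] uu_K[OF b(2) Fz(2) PC(2) GPQ(2)]
        uu_e[OF b(1) GX(1)] uu_e[OF b(2) GX(2)] b GX by (auto simp: aval_def)
    then show ?thesis using a c(1) smult_self[OF c(1)] by metis
  qed
qed

text \<open>The product formula: \<open>aval P\<close> times the sign of
  \<open>(e, \<alpha>)\<close> at \<open>P\<close> is the ratio of \<open>H\<close> to
  \<open>(e, \<alpha>)\<close> on the line of \<open>fst G\<close>, and \<open>Zt p\<close> is the
  negative of \<open>(e, \<alpha>)\<close> at \<open>Z\<close>.\<close>

lemma conf_height:
  assumes GX: "ev G (nr P) = Pos" and b: "bad P" and a: "aval P \<noteq> Zero"
    and Zt: "near Z Zt" "ev H Zt = Zero"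
  shows "ev H Z = smult (smult (aval P) (sneg (ev (e, \<alpha>) P))) (Zt p)"
proof -
  obtain c where c: "c \<noteq> Zero" "\<forall>V\<in>C. K (fst G) \<subseteq> z V \<longrightarrow> ev H V
      = smult c (ev (e, \<alpha>) V)"
    using parallel_e_H[OF GX Zt a] by blast
  have "aval P = smult c (ev (e, \<alpha>) P)"
    using c(2) uu_K[OF b Fz(1) PC(1) GPQ(1)] uu_e[OF b GX] b GX by (auto simp: aval_def)
  moreover have "ev H Z = smult c (ev (e, \<alpha>) Z)" using c(2) ZC KZ by blast
  moreover have "Zt p = sneg (ev (e, \<alpha>) Z)" by (rule near_Z(5)[OF Zt(1)])
  ultimately show ?thesis using a
    by (cases c; cases "ev (e, \<alpha>) P"; cases "ev (e, \<alpha>) Z") auto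
qed

text \<open>\<open>uu P\<close> and \<open>uu Q\<close> lie on the line of \<open>fst G\<close>,
  whose only point on \<open>e\<close> is \<open>Zt\<close> up to sign. For a common neighbour the
  sign is fixed by an element vanishing at \<open>P\<close> but not at \<open>Q\<close>.\<close>

lemma conf_uu:
  assumes GX: "ev G (nr P) = Pos" "ev G (nr Q) = Pos" and cf: "conf P Q"
    and Ee: "ev (e, s) P = Pos" "ev (e, s) Q = Pos" and Zt: "near Z Zt"
  shows "nr P = nr Q \<Longrightarrow> uu P \<noteq> uu Q"
    and "uu P \<noteq> uu Q \<Longrightarrow> comod (uu P) (uu Q) \<and> z (uu P) \<inter> z (uu Q) = K (fst G)"
    and "uu P \<noteq> uu Q \<Longrightarrow> dif (e, s) (uu P) (uu Q) Z1 \<Longrightarrow> nr P = nr Q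
        \<Longrightarrow> Z1 = Zt"
    and "uu P \<noteq> uu Q \<Longrightarrow> dif (e, s) (uu P) (uu Q) Z1 \<Longrightarrow> Zt x = Zero
        \<Longrightarrow> Z1 x = Zero"
proof -
  have b: "bad P" "bad Q" using cf by (auto simp: conf_def)
  note nz = near_Z[OF Zt]
  note U = uu_K[OF b(1) Fz(1) PC(1) GPQ(1)] and U' = uu_K[OF b(2) Fz(2) PC(2) GPQ(2)]
  have EU: "ev (e, s) (uu P) = Pos" "ev (e, s) (uu Q) = Pos"
    using uu_e[OF b(1) GX(1)] uu_e[OF b(2) GX(2)] Ee by auto
  have eK: "e \<notin> K (fst G)" by (rule e_notin_Kg[OF GX(1)])
  obtain a where a: "a \<in> E" "a \<noteq> p" "P a = Zero" "Q a \<noteq> Zero"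
    by (rule anchor[OF PC(1) Fz(1) PC(2) Fz(2) PC(3,4)])
  have ua: "uu P a = Zero" "uu Q a = Q a" if "nr P = nr Q"
  proof -
    have Xa: "nr P a = Zero" using a near_sub[OF nrP] by (auto simp: in_z)
    show "uu P a = Zero" using dif_left[OF uu_dif[OF b(1)] Xa] a by simp
    show "uu Q a = Q a" using dif_left[OF uu_dif[OF b(2)], of a] Xa that GX by simp
  qed
  show "uu P \<noteq> uu Q" if "nr P = nr Q" using ua[OF that] a by auto
  have c: "comod (uu P) (uu Q) \<and> z (uu P) \<inter> z (uu Q) = K (fst G)" if ne: "uu P \<noteq> uu Q"
  proof -
    have "uu P \<noteq> negv (uu Q)"
    proof
      assume "uu P = negv (uu Q)"
      then have "ev (e, s) (uu P) = sneg (ev (e, s) (uu Q))" using ev_negv by metis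
      then show False using EU by simp
    qed
    then show ?thesis using comodI[OF Kg(1) U U' ne] by blast
  qed
  then show "uu P \<noteq> uu Q \<Longrightarrow> comod (uu P) (uu Q) \<and> z (uu P) \<inter> z (uu Q) = K
      (fst G)" .
  assume ne: "uu P \<noteq> uu Q" and Z1: "dif (e, s) (uu P) (uu Q) Z1"
  have Z1C: "Z1 \<in> C" using dif_in_C[OF _ Z1] c[OF ne] EU by simp
  have KZ1: "K (fst G) \<subseteq> z Z1" using dif_sub[OF Z1] c[OF ne] by simp
  have Z1e: "Z1 e = Zero" using dif_zero[OF Z1] by simp
  have pm: "Z1 = Zt \<or> Z1 = negv Zt"
    by (rule line_point_unique[OF Kg(1) eE eK Z1C KZ1 Z1e nz(1,3,4)])
  show "Z1 x = Zero" if "Zt x = Zero"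
    by (rule point_zero[OF Kg(1) eE eK Z1C KZ1 Z1e nz(1,3,4) that])
  show "Z1 = Zt" if same: "nr P = nr Q"
  proof -
    have Z1a: "Z1 a = Q a" using dif_left[OF Z1 ua(1)[OF same]] ua(2)[OF same] EU by simp
    then have "Zt a \<noteq> Zero" using pm a by auto
    moreover from this have "Zt a = Z a" using near_sign[OF Zt a(2)] by simp
    moreover have "Z a = Q a" using dif_left[OF Z a(3)] GPQ by simp
    ultimately show ?thesis
      using point_eqI[OF Kg(1) eE eK Z1C KZ1 Z1e nz(1,3,4), of a] Z1a by simp
  qed
qed

end

context extension
begin

definition Edp :: "sign \<Rightarrow> 'a svec \<Rightarrow> 'a svec \<Rightarrow> bool" where
  "Edp \<beta> X Y \<longleftrightarrow> ev (p, \<beta>) X = Pos \<and> ev (p, \<beta>) Y = Pos"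

lemma Edp_sym: "Edp \<beta> X Y \<Longrightarrow> Edp \<beta> Y X"
  by (simp add: Edp_def)

lemma EdQ_sym: "EdQ S H X Y \<Longrightarrow> EdQ S H Y X"
  using EdS_sym by (auto simp: EdQ_def)

end

section \<open>Closed walks of one level\<close>

context lex_edge
begin

definition Rc :: "('a svec \<times> 'a svec) set" where
  "Rc = {(X, Y). quad X \<and> quad Y \<and> comod X Y \<and> EdS S X Y \<and> (\<exists>Z. dif G X Y Z
      \<and> ev H Z \<noteq> Neg)}"

text \<open>An upward step never leaves infinity and never returns to height zero.\<close>

lemma Rc_mono:
  assumes "(X, Y) \<in> Rc"
  shows "ev G X = Zero \<Longrightarrow> ev G Y = Zero" "ev H X = Pos \<Longrightarrow> ev H Y = Pos"
proof -
  obtain Z where Z: "quad X" "quad Y" "dif G X Y Z" "ev H Z \<noteq> Neg" using assms by (auto simp: Rc_def)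
  have ss: "ssum (smult (ev G X) (ev H Y)) (sneg (smult (ev G Y) (ev H X))) (ev H Z)"
    by (rule ev_ssum[OF Z(3)])
  show "ev G X = Zero \<Longrightarrow> ev G Y = Zero" "ev H X = Pos \<Longrightarrow> ev H Y = Pos"
    using ss Z(1,2,4) by (cases "ev G X"; cases "ev H X"; cases "ev G Y"; cases "ev H Y"; simp add:
        quad_def ssum_def)+
qed

text \<open>A closed walk neither enters nor leaves the ends of the height range. At the ends the
  sum of signs makes the direction zero at once; in between the acyclicity assumption
  applies.\<close>

lemma closed_acyc:
  assumes ac: "acyc (EdQ S H) G H" and XY: "(X, Y) \<in> cyc Rc" and Z: "dif G X Y Z"
  shows "ev H Z = Zero"
proof -
  have R: "cyclic_rel (cyc Rc)" by (rule cyclic_cyc)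
  have mono: "(x, y) \<in> Rc" if "(x, y) \<in> cyc Rc" for x y using that cyc_subset[of Rc] by blast
  have g: "ev G X = Zero \<longleftrightarrow> ev G Y = Zero"
    by (rule cyclic_invariant[OF R _ XY]) (use mono Rc_mono(1) in blast)
  have f: "ev H X = Pos \<longleftrightarrow> ev H Y = Pos"
    by (rule cyclic_invariant[OF R _ XY]) (use mono Rc_mono(2) in blast)
  have q: "quad X" "quad Y" using mono[OF XY] by (auto simp: Rc_def)
  have ss: "ssum (smult (ev G X) (ev H Y)) (sneg (smult (ev G Y) (ev H X))) (ev H Z)"
    by (rule ev_ssum[OF Z])
  show ?thesis
  proof (cases "ev G X \<noteq> Zero \<and> ev H X = Pos")
    case False
    then show ?thesis using ss q g f
      by (cases "ev G X"; cases "ev H X"; cases "ev G Y"; cases "ev H Y") (simp_all add: quad_def)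
  next
    case True
    let ?Q = "\<lambda>X. ev G X \<noteq> Zero \<and> ev H X = Pos"
    have inv: "?Q y" if "(x, y) \<in> cyc Rc" "?Q x" for x y
    proof -
      have "ev G x = Zero \<longleftrightarrow> ev G y = Zero"
        by (rule cyclic_invariant[OF R _ that(1)]) (use mono Rc_mono(1) in blast)
      then show ?thesis using Rc_mono(2)[OF mono[OF that(1)]] that(2) by blast
    qed
    have R': "cyclic_rel {(x, y) \<in> cyc Rc. ?Q x}" by (rule cyclic_restrict[OF R inv])
    show ?thesis
    proof (rule acycD[where \<phi> = "\<lambda>x. x" and s = Pos, OF ac EdQ_sym R'])
      show "(X, Y) \<in> {(x, y) \<in> cyc Rc. ?Q x}" using XY True by simp
      show "X \<noteq> Y" using mono[OF XY] by (auto simp: Rc_def comod_def)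
      show "dif G X Y Z" by (rule Z)
      fix x y assume "(x, y) \<in> {(x, y) \<in> cyc Rc. ?Q x}"
      then have xy: "(x, y) \<in> cyc Rc" "?Q x" by auto
      have "ev G V = Pos" if "quad V" "?Q V" for V using that by (cases "ev G V") (auto simp: quad_def)
      then show "comod x y \<and> EdQ S H x y \<and> ev G x = Pos \<and> ev G y = Pos \<and> (\<exists>Z.
          dif G x y Z \<and> smult Pos (ev H Z) \<noteq> Neg)"
        using mono[OF xy(1)] xy(2) inv[OF xy] by (auto simp: Rc_def EdQ_def)
    qed simp_all
  qed
qed

lemma arc_Rc: "arc A B s \<Longrightarrow> s \<noteq> Neg \<Longrightarrow> (A, B) \<in> Rc\<^sup>*"
  by (auto simp: arc_def Rc_def)

lemma Rc_path_G: "(X, Y) \<in> Rc\<^sup>* \<Longrightarrow> ev G X = Zero \<Longrightarrow> ev G Y = Zero"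
  by (induction rule: rtrancl_induct) (auto intro: Rc_mono(1))

lemma RelG_edge:
  assumes "(P, Q) \<in> RelG (EdQ T H) G H"
  shows "vert P \<and> vert Q \<and> comod P Q \<and> (\<exists>Z. dif G P Q Z \<and> ev H Z \<noteq> Neg
      \<and> edgeOK P Q (ev H Z))"
proof -
  obtain Z where *: "comod P Q" "EdQ T H P Q" "ev G P = Pos" "ev G Q = Pos" "dif G P Q Z" "ev H Z \<noteq> Neg"
    using assms by (auto simp: RelG_def)
  then have v: "vert P" "vert Q" "EdS T P Q" by (auto simp: vert_def EdQ_def comod_def)
  then show ?thesis using edge_OK[OF v(1,2) *(1) v(3) *(5)] * by blast
qed

lemma \<phi>_path:
  assumes "(P, Q) \<in> RelG (EdQ T H) G H"
  shows "(\<phi> P, \<phi> Q) \<in> Rc\<^sup>*"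
proof -
  obtain Z where Z: "ev H Z \<noteq> Neg" "edgeOK P Q (ev H Z)" using RelG_edge[OF assms] by blast
  obtain A B s where *: "arc (\<phi> P) A Zero" "arc A B s" "arc B (\<phi> Q) Zero" "s = Zero \<or> s = ev H Z"
    using Z(2) unfolding edgeOK_def by blast
  have "s \<noteq> Neg" using *(4) Z(1) by auto
  then have "(\<phi> P, A) \<in> Rc\<^sup>*" "(A, B) \<in> Rc\<^sup>*" "(B, \<phi> Q) \<in> Rc\<^sup>*"
    using arc_Rc[OF *(1)] arc_Rc[OF *(2)] arc_Rc[OF *(3)] by simp_all
  then show ?thesis by (meson rtrancl_trans)
qed

lemma lex_edge_acyc:
  assumes IH: "\<And>G H. fst G \<in> E - {p} \<Longrightarrow> snd G \<noteq> Zero \<Longrightarrow> fst H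
      \<in> E - {p} \<Longrightarrow> snd H \<noteq> Zero \<Longrightarrow> acyc (EdQ S H) G H"
    and PP: "\<And>G \<beta>. fst G \<in> E - {p} \<Longrightarrow> snd G \<noteq> Zero \<Longrightarrow>
        \<beta> \<noteq> Zero \<Longrightarrow> acyc (Edp \<beta>) G (p, \<beta>)"
    and PQ0: "(P0, Q0) \<in> cyc (RelG (EdQ T H) G H)" and Z0: "dif G P0 Q0 Z0" and G0: "ev G (\<phi> P0)
        \<noteq> Zero"
  shows "ev H Z0 = Zero"
proof -
  define R1 where "R1 = cyc (RelG (EdQ T H) G H)"
  have cR1: "cyclic_rel R1" unfolding R1_def by (rule cyclic_cyc)
  have acGH: "acyc (EdQ S H) G H" using IH G H by blast
  have edge: "vert P \<and> vert Q \<and> comod P Q \<and> (\<exists>Z. dif G P Q Z \<and> ev H Z \<noteq>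
      Neg \<and> edgeOK P Q (ev H Z))"
    if "(P, Q) \<in> R1" for P Q
    using RelG_edge that cyc_subset[of "RelG (EdQ T H) G H"] unfolding R1_def by blast
  have path: "(\<phi> P, \<phi> Q) \<in> Rc\<^sup>*" if "(P, Q) \<in> R1" for P Q
    using \<phi>_path that cyc_subset[of "RelG (EdQ T H) G H"] unfolding R1_def by blast
  \<comment> \<open>The part of finite first-order height. It is again cyclic, since an infinite
    height would persist along the way back.\<close>
  define R2 where "R2 = {(P, Q) \<in> R1. ev G (\<phi> P) \<noteq> Zero}"
  have ret: "(\<phi> Q, \<phi> P) \<in> Rc\<^sup>*" if "(P, Q) \<in> R1" for P Q
    using cyclic_path[where \<phi> = \<phi>, OF cR1 path r_into_rtrancl[OF that]] .
  have cR2: "cyclic_rel R2"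
    unfolding R2_def by (rule cyclic_restrict[OF cR1]) (use ret Rc_path_G in blast)
  have second: "\<exists>Z. dif G P Q Z \<and> ev H Z \<noteq> Neg \<and> ssum (aval P) (ev H Z) (aval Q)
      \<and> (aval P \<noteq> Zero \<and> aval Q \<noteq> Zero \<longrightarrow> conf P Q)" if PQ: "(P, Q)
          \<in> R2" for P Q
  proof -
    have PQ1: "(P, Q) \<in> R1" and g: "ev G (\<phi> P) \<noteq> Zero" using PQ by (auto simp: R2_def)
    have v: "vert P" "vert Q" using edge[OF PQ1] by auto
    have "ev G (\<phi> Q) \<noteq> Zero" using g Rc_path_G[OF ret[OF PQ1]] by blast
    then have GP: "ev G (\<phi> P) = Pos" "ev G (\<phi> Q) = Pos"
      using g \<phi>_quad[OF v(1)] \<phi>_quad[OF v(2)] by (cases "ev G (\<phi> P)"; cases "ev G (\<phi>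
          Q)"; simp add: quad_def)+
    obtain Z where Z: "dif G P Q Z" "ev H Z \<noteq> Neg" "edgeOK P Q (ev H Z)" using edge[OF PQ1] by blast
    obtain A B s where *: "arc (\<phi> P) A Zero" "arc A B s" "arc B (\<phi> Q) Zero" "s = Zero \<or> s =
        ev H Z"
      "s = Zero \<and> ev G (\<phi> P) = Pos \<and> ev G (\<phi> Q) = Pos \<longrightarrow>
          ssum (aval P) (ev H Z) (aval Q) \<and> (aval P \<noteq> Zero \<and> aval Q \<noteq> Zero
              \<longrightarrow> conf P Q)"
      using Z(3) unfolding edgeOK_def by (elim exE conjE)
    \<comment> \<open>The middle arc lies on a closed walk of the next level and cannot change the
      height, so the infinitesimal clause of \<open>edgeOK\<close> takes effect.\<close>
    have "s = Zero"
    proof (cases "A = B \<and> s = Zero")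
      case False
      then obtain W where W: "quad A" "quad B" "comod A B" "EdS S A B" "dif G A B W" "ev H W = s"
        using *(2) by (auto simp: arc_def)
      have "s \<noteq> Neg" using *(4) Z(2) by auto
      then have AB: "(A, B) \<in> Rc" using W by (auto simp: Rc_def)
      have "(B, \<phi> Q) \<in> Rc\<^sup>*" "(\<phi> P, A) \<in> Rc\<^sup>*"
        using arc_Rc[OF *(3)] arc_Rc[OF *(1)] by simp_all
      then have "(B, A) \<in> Rc\<^sup>*" using ret[OF PQ1] by (meson rtrancl_trans)
      then have "(A, B) \<in> cyc Rc" using AB by (simp add: cyc_def)
      then show ?thesis using closed_acyc[OF acGH _ W(5)] W(6) by blast
    qed simp
    then show ?thesis using *(5) GP Z(1,2) by blast
  qed
  have PQ2: "(P0, Q0) \<in> R2" using PQ0 G0 by (simp add: R2_def R1_def)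
  have aconst: "aval P = aval Q" if PQ: "(P, Q) \<in> R2" for P Q
  proof -
    have 1: "aval P = Pos \<longleftrightarrow> aval Q = Pos"
    proof (rule cyclic_invariant[OF cR2 _ PQ])
      fix x y assume xy: "(x, y) \<in> R2" "aval x = Pos"
      obtain Z where "ssum (aval x) (ev H Z) (aval y)" "ev H Z \<noteq> Neg" using second[OF xy(1)] by blast
      then show "aval y = Pos" using xy(2) by (cases "ev H Z") (auto simp: ssum_def)
    qed
    have 2: "aval P \<noteq> Neg \<longleftrightarrow> aval Q \<noteq> Neg"
    proof (rule cyclic_invariant[OF cR2 _ PQ])
      fix x y assume xy: "(x, y) \<in> R2" "aval x \<noteq> Neg"
      obtain Z where "ssum (aval x) (ev H Z) (aval y)" "ev H Z \<noteq> Neg" using second[OF xy(1)] by blast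
      then show "aval y \<noteq> Neg" using xy(2) by (cases "aval x"; cases "ev H Z") (auto simp: ssum_def)
    qed
    show ?thesis using 1 2 by (cases "aval P"; cases "aval Q") auto
  qed
  show ?thesis
  proof (cases "aval P0 = Zero")
    case True
    obtain Z where Z: "dif G P0 Q0 Z" "ssum (aval P0) (ev H Z) (aval Q0)" using second[OF PQ2] by blast
    have "comod P0 Q0" using edge[of P0 Q0] PQ0 by (simp add: R1_def)
    then have "Z = Z0" using dif_unique[OF _ G(1,3) Z(1) Z0] by blast
    then show ?thesis using Z(2) True aconst[OF PQ2] by simp
  next
    case a0: False
    define a where "a = aval P0"
    have a: "a \<noteq> Zero" using a0 by (simp add: a_def)
    define R3 where "R3 = {(P, Q) \<in> R2. aval P = a}"
    have cR3: "cyclic_rel R3"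
      unfolding R3_def by (rule cyclic_restrict[OF cR2]) (use aconst in simp)
    have e3: "bad P \<and> bad Q \<and> ev G (nr P) = Pos \<and> ev G (nr Q) = Pos \<and> conf P Q \<and>
        aval P = a \<and> aval Q = a
        \<and> ev (e, \<alpha>) P = ev (e, \<alpha>) Q \<and> (\<exists>Z Zt. bad_edge E C p D \<sigma> T e
            \<alpha> G H (z P \<inter> z Q) P Q Z
             \<and> ev H Z \<noteq> Neg \<and> near Z Zt)" if PQ: "(P, Q) \<in> R3" for P Q
    proof -
      have PQ': "(P, Q) \<in> R2" "aval P = a" using PQ by (auto simp: R3_def)
      have aQ: "aval Q = a" using aconst[OF PQ'(1)] PQ'(2) by simp
      obtain Z where Z: "dif G P Q Z" "ev H Z \<noteq> Neg" "conf P Q"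
        using second[OF PQ'(1)] aQ PQ'(2) a by auto
      have b: "bad P" "bad Q" using Z(3) by (auto simp: conf_def)
      have GX: "ev G (nr P) = Pos" "ev G (nr Q) = Pos"
        using PQ'(2) aQ a by (auto simp: aval_def split: if_splits)
      have v: "vert P" "vert Q" "comod P Q" using edge[of P Q] PQ'(1) by (auto simp: R2_def)
      have F: "line (z P \<inter> z Q)" using v(3) by (simp add: comod_def)
      have pF: "p \<in> z P \<inter> z Q" "T \<subseteq> z P \<inter> z Q" "e \<notin> z P \<inter> z Q"
        using b pz[of P] pz[of Q] by (auto simp: bad_def in_z[of e])
      interpret B: bad_edge E C p D \<sigma> T e \<alpha> G H "z P \<inter> z Q" P Q Z
        using F pF v Z by unfold_locales auto
      obtain Zt where Zt: "near Z Zt" using near_ex[OF B.ZC] B.on_F[OF B.ZC dif_sub[OF Z(1)]] by blast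
      have "ev (e, \<alpha>) P = ev (e, \<alpha>) Q" using B.conf_e_sign[OF GX Z(3)] PQ'(2) aQ a by simp
      then show ?thesis using b GX Z PQ'(2) aQ Zt B.bad_edge_axioms by blast
    qed
    define \<epsilon> where "\<epsilon> = ev (e, \<alpha>) P0"
    have PQ3: "(P0, Q0) \<in> R3" using PQ2 by (simp add: R3_def a_def)
    have \<epsilon>: "\<epsilon> \<noteq> Zero" using e3[OF PQ3] \<alpha> by (auto simp: \<epsilon>_def
        bad_def ev_def)
    define R4 where "R4 = {(P, Q) \<in> R3. ev (e, \<alpha>) P = \<epsilon>}"
    have cR4: "cyclic_rel R4"
      unfolding R4_def by (rule cyclic_restrict[OF cR3]) (use e3 in simp)
    have PQ4: "(P0, Q0) \<in> R4" using PQ3 by (simp add: R4_def \<epsilon>_def)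
    \<comment> \<open>The sign of \<open>e\<close> at the directions \<open>uu P\<close> is
      \<open>\<alpha> \<epsilon>\<close>, so this choice makes \<open>(e, s)\<close> positive at
      them.\<close>
    define s where "s = smult \<alpha> \<epsilon>"
    have s: "snd (e, s) \<noteq> Zero" using \<alpha> \<epsilon> by (simp add: s_def)
    have es: "fst (e, s) \<in> E - {p}" using eE ep by simp
    \<comment> \<open>\<open>H\<close> has the sign \<open>a\<close> at the directions; the factor
      \<open>a\<close> makes \<open>H'\<close> positive there, as the vertices of \<open>EdQ\<close>
      require.\<close>
    define H' where "H' = (fst H, smult (snd H) a)"
    have H'ev: "ev H' V = smult a (ev H V)" for V
      by (cases a; cases "snd H"; cases "V (fst H)") (simp_all add: H'_def ev_def)
    \<comment> \<open>The sign of \<open>p\<close> is \<open>sneg \<epsilon>\<close> at the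
      neighbours and \<open>\<epsilon>\<close> at the directions.\<close>
    define old_data where "old_data P Q Zt \<longleftrightarrow> comod (nr P) (nr Q) \<and> Edp (sneg
        \<epsilon>) (nr P) (nr Q)
      \<and> ev G (nr P) = Pos \<and> ev G (nr Q) = Pos \<and> dif G (nr P) (nr Q) Zt \<and> ev H Zt =
          Zero" for P Q Zt
    define dir_data where "dir_data P Q Zt Z1 \<longleftrightarrow> comod (uu P) (uu Q) \<and> EdQ S H' (uu
        P) (uu Q)
      \<and> Edp \<epsilon> (uu P) (uu Q) \<and> ev (e, s) (uu P) = Pos \<and> ev (e, s) (uu Q) = Pos
      \<and> dif (e, s) (uu P) (uu Q) Z1 \<and> (nr P = nr Q \<longrightarrow> Z1 = Zt) \<and> (\<forall>x.
          Zt x = Zero \<longrightarrow> Z1 x = Zero)" for P Q Zt Z1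
    have "\<exists>Z Zt. dif G P Q Z \<and> ev H Z \<noteq> Neg \<and> (ev H Zt = Zero \<or> ev H Zt = ev H Z)
        \<and> (ev H Zt = Zero \<longrightarrow> ev H Z = smult (smult a (sneg \<epsilon>)) (Zt p))
        \<and> (nr P \<noteq> nr Q \<longrightarrow> old_data P Q Zt) \<and> (nr P = nr Q \<longrightarrow>
            uu P \<noteq> uu Q)
        \<and> (uu P \<noteq> uu Q \<longrightarrow> (\<exists>Z1. dir_data P Q Zt Z1))" if "(P, Q) \<in>
            R4" for P Q
    proof -
      have PQ: "(P, Q) \<in> R3" "ev (e, \<alpha>) P = \<epsilon>" using that by (auto simp: R4_def)
      obtain Z Zt where be: "bad_edge E C p D \<sigma> T e \<alpha> G H (z P \<inter> z Q) P Q Z" and HZ: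
          "ev H Z \<noteq> Neg"
        and Zt: "near Z Zt" using e3[OF PQ(1)] by blast
      have d: "bad P" "bad Q" and GX: "ev G (nr P) = Pos" "ev G (nr Q) = Pos" and cf: "conf P Q"
        and av: "aval P = a" "aval Q = a" and \<epsilon>Q: "ev (e, \<alpha>) Q = \<epsilon>" using e3[OF
            PQ(1)] PQ(2) by auto
      interpret B: bad_edge E C p D \<sigma> T e \<alpha> G H "z P \<inter> z Q" P Q Z by (rule be)
      have sv: "ev (e, s) V = Pos" if "ev (e, \<alpha>) V = \<epsilon>" for V
        using that \<epsilon> \<alpha> by (cases \<alpha>; cases "V e") (auto simp: ev_def s_def)
      note cu = B.conf_uu[OF GX cf sv[OF PQ(2)] sv[OF \<epsilon>Q] Zt]
      have "old_data P Q Zt" if ne: "nr P \<noteq> nr Q"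
      proof -
        have "nr P p = sneg \<epsilon>" "nr Q p = sneg \<epsilon>"
          using near_p[OF B.nrP] near_p[OF B.nrQ] PQ(2) \<epsilon>Q by (auto simp: ev_def)
        then have "Edp (sneg \<epsilon>) (nr P) (nr Q)" using \<epsilon> by (cases \<epsilon>) (auto simp:
            Edp_def ev_def)
        then show ?thesis using B.conf_old_dif[OF GX(1) cf ne Zt] GX by (simp add: old_data_def)
      qed
      moreover have "\<exists>Z1. dir_data P Q Zt Z1" if ne: "uu P \<noteq> uu Q"
      proof -
        obtain Z1 where Z1: "dif (e, s) (uu P) (uu Q) Z1" using dif_ex[OF _ s] cu(2)[OF ne] by blast
        have up: "uu P p = \<epsilon>" "uu Q p = \<epsilon>"
          using B.uu_p[OF d(1) B.GPQ(1)] B.uu_p[OF d(2) B.GPQ(2)] PQ(2) \<epsilon>Q by auto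
        then have "Edp \<epsilon> (uu P) (uu Q)" using \<epsilon> by (cases \<epsilon>) (auto simp: Edp_def
            ev_def)
        moreover have "p \<notin> z (uu P)" "p \<notin> z (uu Q)" using up \<epsilon> pz[of "uu P"] pz[of
            "uu Q"] by simp_all
        then have "EdS S (uu P) (uu Q)" unfolding EdS_def by (intro conjI goodS_notin) auto
        then have "EdQ S H' (uu P) (uu Q)"
          using d GX av a by (cases a) (auto simp: EdQ_def H'ev aval_def)
        ultimately show ?thesis
          using cu(2)[OF ne] Z1 cu(3,4)[OF ne Z1] B.uu_e[OF d(1) GX(1)] B.uu_e[OF d(2) GX(2)]
            sv[OF PQ(2)] sv[OF \<epsilon>Q] unfolding dir_data_def by auto
      qed
      moreover have "ev H Z = smult (smult a (sneg \<epsilon>)) (Zt p)" if "ev H Zt = Zero"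
        using B.conf_height[OF GX(1) d(1) _ Zt that] av(1) a PQ(2) by simp
      ultimately show ?thesis using B.Z HZ B.near_Z(6)[OF Zt] cu(1) by blast
    qed
    then obtain zf zt where data: "\<And>P Q. (P, Q) \<in> R4 \<Longrightarrow> dif G P Q (zf P Q) \<and>
        ev H (zf P Q) \<noteq> Neg
        \<and> (ev H (zt P Q) = Zero \<or> ev H (zt P Q) = ev H (zf P Q))
        \<and> (ev H (zt P Q) = Zero \<longrightarrow> ev H (zf P Q) = smult (smult a (sneg \<epsilon>))
            (zt P Q p))
        \<and> (nr P \<noteq> nr Q \<longrightarrow> old_data P Q (zt P Q)) \<and> (nr P = nr Q
            \<longrightarrow> uu P \<noteq> uu Q)
        \<and> (uu P \<noteq> uu Q \<longrightarrow> (\<exists>Z1. dir_data P Q (zt P Q) Z1))" by metis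
    have eH: "ev H Z1 = Zero" if "ev H V = Zero" "\<forall>x. V x = Zero \<longrightarrow> Z1 x = Zero" for V Z1
      using that H(3) by (simp add: ev_eq_Zero)
    \<comment> \<open>The program of \<open>e\<close> and \<open>H\<close>, walked by the
      directions. Steps between distinct neighbours are already level; for a common neighbour the
      direction of the step is \<open>zt P Q\<close> itself.\<close>
    have stageA: "ev H (zt P Q) = Zero" if PQ: "(P, Q) \<in> R4" for P Q
    proof (cases "nr P = nr Q")
      case False
      then show ?thesis using data[OF PQ] by (simp add: old_data_def)
    next
      case True
      then have ne: "uu P \<noteq> uu Q" using data[OF PQ] by blast
      then obtain Z1 where Z1: "dir_data P Q (zt P Q) Z1" using data[OF PQ] by blast
      then have d1: "dif (e, s) (uu P) (uu Q) Z1" by (simp add: dir_data_def)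
      have "ev H' Z1 = Zero"
      proof (rule acycD[where \<phi> = uu and s = a, OF IH EdQ_sym cR4 a _ PQ ne d1])
        show "fst H' \<in> E - {p}" "snd H' \<noteq> Zero" using H a by (auto simp: H'_def)
        fix P Q assume PQ: "(P, Q) \<in> R4" and ne: "uu P \<noteq> uu Q"
        obtain Z1 where Z1: "dir_data P Q (zt P Q) Z1" using data[OF PQ] ne by blast
        have "ev H Z1 \<noteq> Neg"
        proof (cases "nr P = nr Q")
          case True
          then show ?thesis using Z1 data[OF PQ] by (auto simp: dir_data_def)
        next
          case False
          then show ?thesis using eH[of "zt P Q" Z1] Z1 data[OF PQ] by (simp add: dir_data_def old_data_def)
        qed
        then have "smult a (ev H' Z1) \<noteq> Neg" using smult_self[OF a] by (simp add: H'ev)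
        then show "comod (uu P) (uu Q) \<and> EdQ S H' (uu P) (uu Q) \<and> ev (e, s) (uu P) = Pos \<and>
            ev (e, s) (uu Q) = Pos
          \<and> (\<exists>Z. dif (e, s) (uu P) (uu Q) Z \<and> smult a (ev H' Z) \<noteq> Neg)"
          using Z1 unfolding dir_data_def by blast
      qed (use es s in auto)
      then show ?thesis using a Z1 True by (simp add: H'ev dir_data_def)
    qed
    then have height: "ev H (zf P Q) = smult (smult a (sneg \<epsilon>)) (zt P Q p)" if "(P, Q) \<in> R4"
        for P Q
      using data[OF that] that by blast
    \<comment> \<open>The program of \<open>G\<close> and \<open>p\<close>, walked by the
      neighbours, settles the steps on which the neighbour changes.\<close>
    have stageB: "zt P Q p = Zero" if PQ: "(P, Q) \<in> R4" and ne: "nr P \<noteq> nr Q" for P Q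
    proof -
      have d: "dif G (nr P) (nr Q) (zt P Q)" using data[OF PQ] ne by (simp add: old_data_def)
      have "ev (p, sneg \<epsilon>) (zt P Q) = Zero"
      proof (rule acycD[where \<phi> = nr and s = a, OF PP Edp_sym cR4 a _ PQ ne d])
        fix P Q assume PQ: "(P, Q) \<in> R4" and ne: "nr P \<noteq> nr Q"
        have "smult a (ev (p, sneg \<epsilon>) (zt P Q)) = ev H (zf P Q)"
          using height[OF PQ] by (simp add: ev_def smult_assoc)
        then have "smult a (ev (p, sneg \<epsilon>) (zt P Q)) \<noteq> Neg" using data[OF PQ] by simp
        then show "comod (nr P) (nr Q) \<and> Edp (sneg \<epsilon>) (nr P) (nr Q) \<and> ev G (nr P) = Pos
            \<and> ev G (nr Q) = Pos
          \<and> (\<exists>Z. dif G (nr P) (nr Q) Z \<and> smult a (ev (p, sneg \<epsilon>) Z) \<noteq> Neg)"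
          using data[OF PQ] ne unfolding old_data_def by blast
      qed (use G \<epsilon> in auto)
      then show ?thesis using \<epsilon> by (simp add: ev_def)
    qed
    \<comment> \<open>For a common neighbour the program of \<open>e\<close> and \<open>p\<close>
      remains, walked by the directions; steps that change the neighbour are level in it by
      \<open>stageB\<close>.\<close>
    have "zt P0 Q0 p = Zero"
    proof (cases "nr P0 = nr Q0")
      case False
      then show ?thesis by (rule stageB[OF PQ4])
    next
      case True
      then have ne: "uu P0 \<noteq> uu Q0" using data[OF PQ4] by blast
      then obtain Z1 where Z1: "dir_data P0 Q0 (zt P0 Q0) Z1" using data[OF PQ4] by blast
      then have d1: "dif (e, s) (uu P0) (uu Q0) Z1" by (simp add: dir_data_def)
      have "ev (p, \<epsilon>) Z1 = Zero"
      proof (rule acycD[where \<phi> = uu and s = "sneg a", OF PP Edp_sym cR4 _ _ PQ4 ne d1])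
        fix P Q assume PQ: "(P, Q) \<in> R4" and ne: "uu P \<noteq> uu Q"
        obtain Z1 where Z1: "dir_data P Q (zt P Q) Z1" using data[OF PQ] ne by blast
        have "smult (sneg a) (ev (p, \<epsilon>) Z1) \<noteq> Neg"
        proof (cases "nr P = nr Q")
          case True
          then have "smult (sneg a) (ev (p, \<epsilon>) Z1) = ev H (zf P Q)"
            using height[OF PQ] Z1 by (simp add: dir_data_def ev_def smult_assoc)
          then show ?thesis using data[OF PQ] by simp
        next
          case False
          then show ?thesis using stageB[OF PQ] Z1 by (simp add: dir_data_def ev_def)
        qed
        then show "comod (uu P) (uu Q) \<and> Edp \<epsilon> (uu P) (uu Q) \<and> ev (e, s) (uu P) = Pos
            \<and> ev (e, s) (uu Q) = Pos
          \<and> (\<exists>Z. dif (e, s) (uu P) (uu Q) Z \<and> smult (sneg a) (ev (p, \<epsilon>) Z)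
              \<noteq> Neg)"
          using Z1 unfolding dir_data_def by blast
      qed (use es s \<epsilon> a in auto)
      then show ?thesis using \<epsilon> Z1 True by (simp add: dir_data_def ev_def)
    qed
    then have "ev H (zf P0 Q0) = Zero" using height[OF PQ4] by simp
    moreover have "comod P0 Q0" using edge[of P0 Q0] PQ0 by (simp add: R1_def)
    then have "zf P0 Q0 = Z0" using dif_unique[OF _ G(1,3) _ Z0] data[OF PQ4] by blast
    ultimately show ?thesis by simp
  qed
qed

end

context lex_step
begin

text \<open>At infinite first-order height the walk is reversed and \<open>G\<close> and
  \<open>H\<close> are exchanged, which turns infinity into height zero.\<close>

lemma lex_step_acyc:
  assumes IH: "\<And>G H. fst G \<in> E - {p} \<Longrightarrow> snd G \<noteq> Zero \<Longrightarrow> fst H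
      \<in> E - {p} \<Longrightarrow> snd H \<noteq> Zero \<Longrightarrow> acyc (EdQ (insert e T) H) G H"
    and PP: "\<And>G \<beta>. fst G \<in> E - {p} \<Longrightarrow> snd G \<noteq> Zero \<Longrightarrow>
        \<beta> \<noteq> Zero \<Longrightarrow> acyc (Edp \<beta>) G (p, \<beta>)"
    and G: "fst G \<in> E - {p}" "snd G \<noteq> Zero" and H: "fst H \<in> E - {p}" "snd H \<noteq> Zero"
  shows "acyc (EdQ T H) G H"
  unfolding acyc_def
proof (intro allI impI)
  fix P Q Z assume PQ: "(P, Q) \<in> cyc (RelG (EdQ T H) G H)" and Z: "dif G P Q Z"
  interpret GH: lex_edge E C p D \<sigma> T e \<alpha> G H using G H by unfold_locales auto
  interpret HG: lex_edge E C p D \<sigma> T e \<alpha> H G using G H by unfold_locales auto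
  let ?R = "RelG (EdQ T H) G H" and ?R' = "RelG (EdQ T G) H G"
  have rel: "comod P Q \<and> ev G P = Pos \<and> ev G Q = Pos \<and> ev H P = Pos \<and> ev H Q = Pos
      \<and> EdS T P Q
    \<and> (\<exists>Z. dif G P Q Z \<and> ev H Z \<noteq> Neg)" if "(P, Q) \<in> ?R" for P Q
    using that by (auto simp: RelG_def EdQ_def)
  have PQR: "(P, Q) \<in> ?R" "(Q, P) \<in> ?R\<^sup>*" using PQ by (auto simp: cyc_def)
  note r = rel[OF PQR(1)]
  show "ev H Z = Zero"
  proof (cases "ev G (GH.\<phi> P) = Zero")
    case False
    show ?thesis by (rule GH.lex_edge_acyc[OF IH PP PQ Z False])
  next
    case True
    have vP: "GH.vert P" "GH.vert Q" using r by (auto simp: GH.vert_def comod_def)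
    have "ev G (GH.\<phi> Q) = Zero" by (rule GH.Rc_path_G[OF GH.\<phi>_path[OF PQR(1)] True])
    then have "\<not> GH.zc Q" "ev G (GH.nr Q) = Zero"
      using GH.yy_prop(4)[OF _ vP(2)] by (auto simp: GH.\<phi>_def split: if_splits)
    moreover from this have "ev H (GH.nr Q) \<noteq> Zero" using GH.nr_quad[OF vP(2)] by (auto simp:
        GH.quad_def)
    ultimately have HQ: "ev H (HG.\<phi> Q) \<noteq> Zero" by (simp add: HG.\<phi>_def HG.zc_def)
    have swap: "(Q, P) \<in> ?R'" if PQ: "(P, Q) \<in> ?R" for P Q
    proof -
      obtain Z where Z: "comod P Q" "ev G P = Pos" "ev G Q = Pos" "ev H P = Pos" "ev H Q = Pos" "EdS T P Q"
        "dif G P Q Z" "ev H Z \<noteq> Neg" using rel[OF PQ] by blast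
      obtain W where W: "dif H P Q W" using dif_ex[OF Z(1) H(2)] by blast
      have "ev G W = sneg (ev H Z)" using dif_swap[OF Z(1) _ G(2) _ H(2) Z(2-5) Z(7) W] G H by simp
      then have "ev G (negv W) \<noteq> Neg" using Z(8) by simp
      then show ?thesis using dif_negv[OF W] comod_sym[OF Z(1)] EdS_sym[OF Z(6)] Z(2-5)
        by (auto simp: RelG_def EdQ_def)
    qed
    have "?R\<inverse> \<subseteq> ?R'" using swap by auto
    then have "(?R\<inverse>)\<^sup>* \<subseteq> ?R'\<^sup>*" by (rule rtrancl_mono)
    moreover have "(P, Q) \<in> (?R\<inverse>)\<^sup>*" using PQR(2) by (simp add: rtrancl_converse)
    ultimately have QP: "(Q, P) \<in> cyc ?R'" using swap[OF PQR(1)] by (auto simp: cyc_def)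
    obtain W where W: "dif H P Q W" using dif_ex[OF _ H(2)] r by blast
    have "ev G (negv W) = Zero" by (rule HG.lex_edge_acyc[OF IH PP QP dif_negv[OF W] HQ])
    moreover have "ev G W = sneg (ev H Z)" using dif_swap[OF _ _ G(2) _ H(2) _ _ _ _ Z W] r G H by simp
    ultimately show ?thesis by simp
  qed
qed

end

section \<open>Lexicographic extensions\<close>

lemma lex_sigma_zero:
  assumes "\<And>e. e \<in> set es \<Longrightarrow> Y e = Zero"
  shows "lex_sigma es al Y = Zero"
  using assms by (induction es al Y rule: lex_sigma.induct) auto

lemma lex_sigma_index:
  assumes "length al = length es" "i < length es" "\<And>j. j < i \<Longrightarrow> Y (es ! j) = Zero" "Y
      (es ! i) \<noteq> Zero"
  shows "lex_sigma es al Y = smult (al ! i) (Y (es ! i))"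
  using assms
proof (induction es al Y arbitrary: i rule: lex_sigma.induct)
  case (1 e es a as Y)
  show ?case
  proof (cases i)
    case 0
    then show ?thesis using 1(5) by simp
  next
    case (Suc k)
    then have "Y e = Zero" using 1(4)[of 0] by simp
    moreover have "lex_sigma es as Y = smult (as ! k) (Y (es ! k))"
      using 1(1)[of k] 1(2,3,5) 1(4)[of "Suc _"] Suc \<open>Y e = Zero\<close> by simp
    ultimately show ?thesis using Suc by simp
  qed
qed auto

lemma first_nonzero:
  assumes "e \<in> set es" "Y e \<noteq> Zero"
  obtains i where "i < length es" "\<And>j. j < i \<Longrightarrow> Y (es ! j) = Zero" "Y (es ! i) \<noteq>
      Zero"
proof -
  let ?Q = "\<lambda>i. i < length es \<and> Y (es ! i) \<noteq> Zero"
  obtain k where "?Q k" using assms by (metis in_set_conv_nth)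
  then have "?Q (LEAST i. ?Q i)" by (rule LeastI)
  moreover have "Y (es ! j) = Zero" if "j < (LEAST i. ?Q i)" for j
    using not_less_Least[OF that] that calculation by auto
  ultimately show thesis using that by blast
qed

locale lex_extension = nondegenerate_extension E C p D "lex_sigma es al"
  for E :: "'a set" and C p D es al +
  assumes esE: "set es \<subseteq> E - {p}" and len: "length al = length es" and al: "set al \<subseteq>
      {Pos, Neg}"
    and eu: "euclidean_OM (E - {p}) D"
begin

lemma al_nz: "i < length es \<Longrightarrow> al ! i \<noteq> Zero"
  using al len nth_mem[of i al] by (metis insertE singletonD sign.distinct(1,5) subsetD)

lemma es_ne: "i < length es \<Longrightarrow> es ! i \<in> E \<and> es ! i \<noteq> p"
  using esE nth_mem[of i es] by blast

lemma old_sigma: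
  assumes "X \<in> C" "oldset (z X)"
  shows "X p = lex_sigma es al (X(p := Zero))"
  using restrict_old(2)[OF assms] by simp

lemma old_index:
  assumes X: "X \<in> C" "oldset (z X)" and i: "i < length es" "\<And>j. j < i \<Longrightarrow> X (es ! j)
      = Zero" "X (es ! i) \<noteq> Zero"
  shows "X p = smult (al ! i) (X (es ! i))"
proof -
  have "lex_sigma es al (X(p := Zero)) = smult (al ! i) ((X(p := Zero)) (es ! i))"
    by (rule lex_sigma_index[OF len i(1)]) (use i es_ne in auto)
  then show ?thesis using old_sigma[OF X] es_ne[OF i(1)] by simp
qed

lemma old_zero:
  assumes X: "X \<in> C" "oldset (z X)" and e: "e \<in> set es" "X p = Zero"
  shows "X e = Zero"
proof (rule ccontr)
  assume "X e \<noteq> Zero"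
  then obtain i where i: "i < length es" "\<And>j. j < i \<Longrightarrow> X (es ! j) = Zero" "X (es ! i)
      \<noteq> Zero"
    using first_nonzero[OF e(1)] by blast
  then show False using old_index[OF X i] e(2) al_nz[OF i(1)] by (metis smult_eq_Zero)
qed

lemma oldset_p: "X p \<noteq> Zero \<Longrightarrow> oldset (z X)"
  by (simp add: oldset_def in_z)

lemma es_zero: "X \<in> C \<Longrightarrow> set es \<subseteq> z X \<Longrightarrow> X p = Zero"
proof (rule ccontr)
  assume X: "X \<in> C" "set es \<subseteq> z X" "X p \<noteq> Zero"
  have "lex_sigma es al (X(p := Zero)) = Zero"
    using X(2) by (intro lex_sigma_zero) (auto simp: in_z)
  then show False using old_sigma[OF X(1) oldset_p[of X, OF X(3)]] X(3) by simp
qed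

lemma p_cl_es: "p \<in> cl (set es)"
  using es_zero pE by (simp add: cl_def)

text \<open>All vertices are off \<open>p\<close>, so the points and lines of the walk are old, and
  with them the directions.\<close>

lemma acyc_p:
  assumes G: "fst G \<in> E - {p}" "snd G \<noteq> Zero" and \<beta>: "\<beta> \<noteq> Zero"
  shows "acyc (Edp \<beta>) G (p, \<beta>)"
  unfolding acyc_def
proof (intro allI impI)
  let ?R = "cyc (RelG (Edp \<beta>) G (p, \<beta>))"
  fix X Y Z assume XY: "(X, Y) \<in> ?R" and Z: "dif G X Y Z"
  have rel: "comod X Y \<and> X p \<noteq> Zero \<and> Y p \<noteq> Zero \<and> ev G X = Pos \<and> ev G Y = Pos
      \<and> Edold X Y \<and> Z \<in> C \<and> oldset (z Z) \<and> ev (p, \<beta>) Z \<noteq> Neg"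
    if "(X, Y) \<in> ?R" "dif G X Y Z" for X Y Z
  proof -
    have "(X, Y) \<in> RelG (Edp \<beta>) G (p, \<beta>)" using that(1) cyc_subset by blast
    then obtain W where W: "comod X Y" "ev (p, \<beta>) X = Pos" "ev (p, \<beta>) Y = Pos" "ev G X = Pos"
        "ev G Y = Pos"
      "dif G X Y W" "ev (p, \<beta>) W \<noteq> Neg" by (auto simp: RelG_def Edp_def)
    have "X p \<noteq> Zero" "Y p \<noteq> Zero" using W(2,3) by (auto simp: ev_def)
    note * = W(1) this W(4-7)
    have "W = Z" using dif_unique[OF *(1) _ G(2) *(6) that(2)] G by blast
    moreover have "Edold X Y" using *(2,3) by (simp add: Edold_def oldset_def in_z)
    ultimately show ?thesis using * oldset_dif[OF *(1) _ G *(4) that(2)] by (auto simp: Edold_def)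
  qed
  have zero: "\<forall>X Y Z. (X, Y) \<in> ?R \<longrightarrow> dif G X Y Z \<longrightarrow>
      (\<forall>j<i. Z (es ! j) = Zero)" if "i \<le> length es" for i
    using that
  proof (induction i)
    case (Suc i)
    have i: "i < length es" using Suc.prems by simp
    have IH: "Z (es ! j) = Zero" if "(X, Y) \<in> ?R" "dif G X Y Z" "j < i" for X Y Z j
      using Suc.IH i that by auto
    have sgn: "ev (es ! i, smult (al ! i) \<beta>) Z \<noteq> Neg" if XY: "(X, Y) \<in> ?R" "dif G X Y Z"
        for X Y Z
    proof (cases "Z (es ! i) = Zero")
      case True then show ?thesis by (simp add: ev_def)
    next
      case False
      note r = rel[OF XY]
      have "Z p = smult (al ! i) (Z (es ! i))" using old_index[of Z i] r i IH[OF XY] False by blast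
      then have "ev (es ! i, smult (al ! i) \<beta>) Z = ev (p, \<beta>) Z"
        by (cases \<beta>; cases "al ! i") (simp_all add: ev_def)
      then show ?thesis using r by simp
    qed
    have "Z (es ! i) = Zero" if XY: "(X, Y) \<in> ?R" and Z: "dif G X Y Z" for X Y Z
    proof -
      let ?H = "(es ! i, smult (al ! i) \<beta>)"
      have ac: "acyc Edold G ?H"
        using es_ne[OF i] al_nz[OF i] \<beta> by (intro acyc_old[OF eu G]) auto
      have "ev ?H Z = Zero"
      proof (rule acycD[where \<phi> = "\<lambda>x. x" and s = Pos, OF ac Edold_sym cyclic_cyc _ _ XY _ Z])
        show "X \<noteq> Y" using rel[OF XY Z] by (auto simp: comod_def)
        fix x y assume xy: "(x, y) \<in> ?R"
        then have "comod x y" using cyc_subset[of "RelG (Edp \<beta>) G (p, \<beta>)"] by (auto simp: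
            RelG_def cyc_def)
        then obtain W where W: "dif G x y W" using dif_ex[OF _ G(2)] by blast
        show "comod x y \<and> Edold x y \<and> ev G x = Pos \<and> ev G y = Pos \<and> (\<exists>Z. dif G
            x y Z \<and> smult Pos (ev ?H Z) \<noteq> Neg)"
          using rel[OF xy W] sgn[OF xy W] W by auto
      qed simp_all
      then show ?thesis using al_nz[OF i] \<beta> by (simp add: ev_def)
    qed
    then show ?case using IH less_Suc_eq by metis
  qed simp
  have "set es \<subseteq> z Z"
    using zero[OF order_refl] XY Z es_ne by (auto simp: in_set_conv_nth in_z)
  then have "Z p = Zero" using es_zero rel[OF XY Z] by blast
  then show "ev (p, \<beta>) Z = Zero" by (simp add: ev_def)
qed

text \<open>Starts the downward induction: \<open>p\<close> is spanned by \<open>es\<close>, so at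
  the last level no new points or lines are left.\<close>

lemma goodS_old: "goodS (set es) A \<Longrightarrow> oldset A"
proof -
  assume g: "goodS (set es) A"
  have "p \<in> cl (A - {p})" if "set es \<subseteq> A"
    using p_cl_es cl_mono[of "set es" "A - {p}"] that esE by blast
  then show ?thesis using g by (auto simp: goodS_def oldset_def)
qed

lemma acyc_level:
  assumes "m \<le> length es" "fst G \<in> E - {p}" "snd G \<noteq> Zero" "fst H \<in> E - {p}" "snd H
      \<noteq> Zero"
  shows "acyc (EdQ (set (take m es)) H) G H"
  using assms
proof (induction m arbitrary: G H rule: inc_induct)
  case base
  have "acyc Edold G H" using acyc_old[OF eu] base by blast
  then show ?case
    by (rule acyc_mono) (use goodS_old in \<open>auto simp: EdQ_def EdS_def Edold_def\<close>)
next
  case (step m)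
  let ?T = "set (take m es)"
  have m: "m < length es" using step by simp
  have ins: "insert (es ! m) ?T = set (take (Suc m) es)" using m by (simp add: take_Suc_conv_app_nth)
  have Tj: "X (es ! j) = Zero" if "?T \<subseteq> z X" "j < m" for X j
    using that m by (auto simp: in_z in_set_conv_nth subset_iff)
  \<comment> \<open>On a point vanishing at the entries before position \<open>m\<close>, the
    localization is decided by \<open>es ! m\<close> as soon as this entry is nonzero.\<close>
  interpret L: lex_step E C p D "lex_sigma es al" ?T "es ! m" "al ! m"
  proof unfold_locales
    show "es ! m \<in> E" "es ! m \<noteq> p" using es_ne[OF m] by auto
    show "?T \<subseteq> E - {p}" using esE set_take_subset[of m es] by blast
    show "al ! m \<noteq> Zero" by (rule al_nz[OF m])
    show "X p = smult (al ! m) (X (es ! m))" if "X \<in> C" "?T \<subseteq> z X" "X (es ! m) \<noteq> Zero"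
        "X p \<noteq> Zero" for X
      using old_index[OF that(1) oldset_p[of X, OF that(4)] m _ that(3)] Tj[OF that(2)] by blast
    show "p \<notin> cl (z X - {p})" if "X \<in> C" "?T \<subseteq> z X" "X (es ! m) \<noteq> Zero" "X p =
        Zero" for X
      using old_zero[OF that(1) _ nth_mem[OF m] that(4)] that(3) by (auto simp: oldset_def)
  qed
  show ?case
  proof (rule L.lex_step_acyc[OF _ acyc_p])
    show "acyc (EdQ (insert (es ! m) ?T) H) G H"
      if "fst G \<in> E - {p}" "snd G \<noteq> Zero" "fst H \<in> E - {p}" "snd H \<noteq> Zero" for G H
      using step.IH that by (simp add: ins)
  qed (use step in auto)
qed

lemma acyc_RelU:
  assumes g: "g \<in> E" and f: "f \<in> E" and XY: "(X, Y) \<in> cyc (RelU g f)" and Z: "dif (g, Pos) X Y Z"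
  shows "Z f = Zero"
proof -
  let ?R = "cyc (RelU g f)"
  have R: "cyclic_rel ?R" by (rule cyclic_cyc)
  have rel: "comod X Y \<and> X g = Pos \<and> Y g = Pos \<and> (\<exists>Z. dif (g, Pos) X Y Z \<and> Z f
      \<noteq> Neg)" if "(X, Y) \<in> ?R" for X Y
    using that by (auto simp: cyc_def RelU_def)
  have ss: "\<exists>Z. ssum (Y f) (sneg (X f)) (Z f) \<and> Z f \<noteq> Neg" if XY: "(X, Y) \<in> ?R" for X Y
  proof -
    obtain Z where Z: "dif (g, Pos) X Y Z" "Z f \<noteq> Neg" using rel[OF XY] by blast
    have "ssum (Y f) (sneg (X f)) (Z f)" using dif_ssum[OF Z(1), of f] rel[OF XY] by simp
    then show ?thesis using Z(2) by blast
  qed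
  have const: "X f = Y f" if XY: "(X, Y) \<in> ?R" for X Y
  proof -
    have 1: "X f = Pos \<longleftrightarrow> Y f = Pos"
    proof (rule cyclic_invariant[OF R _ XY])
      fix x y assume xy: "(x, y) \<in> ?R" "x f = Pos"
      obtain Z where "ssum (y f) (sneg (x f)) (Z f)" "Z f \<noteq> Neg" using ss[OF xy(1)] by blast
      then show "y f = Pos" using xy(2) by (cases "y f"; cases "Z f") (auto simp: ssum_def)
    qed
    have 2: "X f \<noteq> Neg \<longleftrightarrow> Y f \<noteq> Neg"
    proof (rule cyclic_invariant[OF R _ XY])
      fix x y assume xy: "(x, y) \<in> ?R" "x f \<noteq> Neg"
      obtain Z where "ssum (y f) (sneg (x f)) (Z f)" "Z f \<noteq> Neg" using ss[OF xy(1)] by blast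
      then show "y f \<noteq> Neg" using xy(2) by (cases "x f"; cases "Z f") (auto simp: ssum_def)
    qed
    show ?thesis using 1 2 by (cases "X f"; cases "Y f") auto
  qed
  define t where "t = X f"
  define R' where "R' = {(x, y) \<in> ?R. x f = t}"
  have R': "cyclic_rel R'" unfolding R'_def by (rule cyclic_restrict[OF R]) (use const in metis)
  have XY': "(X, Y) \<in> R'" using XY by (simp add: R'_def t_def)
  have ne: "X \<noteq> Y" using rel[OF XY] by (auto simp: comod_def)
  have rel': "comod x y" "x g = Pos" "y g = Pos" "x f = t" "y f = t" "\<exists>Z. dif (g, Pos) x y Z \<and>
      Z f \<noteq> Neg"
    if "(x, y) \<in> R'" for x y
  proof -
    have xy: "(x, y) \<in> ?R" "x f = t" using that by (auto simp: R'_def)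
    show "comod x y" "x g = Pos" "y g = Pos" "x f = t" "y f = t" "\<exists>Z. dif (g, Pos) x y Z \<and> Z f
        \<noteq> Neg"
      using rel[OF xy(1)] xy(2) const[OF xy(1)] by auto
  qed
  have tt: "smult t t = Pos" if "t \<noteq> Zero" using that by (cases t) auto
  show ?thesis
  proof (cases "t = Zero \<or> g = f")
    case True
    then show ?thesis using dif_ssum[OF Z, of f] rel'(4,5)[OF XY'] dif_zero[OF Z] by auto
  next
    case False
    then have t: "t \<noteq> Zero" and gf: "g \<noteq> f" by auto
    have evt: "ev (f, t) V = smult t (V f)" for V by (simp add: ev_def)
    consider "g \<noteq> p" "f \<noteq> p" | "g \<noteq> p" "f = p" | "g = p" "f \<noteq> p" using gf by blast
    then show ?thesis
    proof cases
      case 1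
      \<comment> \<open>Every flat is good for the empty set, so level zero imposes nothing but the
        sign at \<open>f\<close>.\<close>
      have ac: "acyc (EdQ {} (f, t)) (g, Pos) (f, t)"
        using acyc_level[of 0 "(g, Pos)" "(f, t)"] 1 g f t by simp
      have "ev (f, t) Z = Zero"
      proof (rule acycD[where \<phi> = "\<lambda>x. x" and s = t, OF ac EdQ_sym R' t _ XY' ne Z])
        fix x y assume xy: "(x, y) \<in> R'"
        show "comod x y \<and> EdQ {} (f, t) x y \<and> ev (g, Pos) x = Pos \<and> ev (g, Pos) y = Pos
          \<and> (\<exists>Z. dif (g, Pos) x y Z \<and> smult t (ev (f, t) Z) \<noteq> Neg)"
          using rel'[OF xy] tt[OF t] smult_self[OF t] by (simp add: EdQ_def EdS_def goodS_def evt)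
      qed
      then show ?thesis using t by (simp add: ev_def)
    next
      case 2
      have ac: "acyc (Edp t) (g, Pos) (p, t)" using acyc_p[of "(g, Pos)" t] 2 g t by simp
      have "ev (p, t) Z = Zero"
      proof (rule acycD[where \<phi> = "\<lambda>x. x" and s = t, OF ac Edp_sym R' t _ XY' ne Z])
        fix x y assume xy: "(x, y) \<in> R'"
        show "comod x y \<and> Edp t x y \<and> ev (g, Pos) x = Pos \<and> ev (g, Pos) y = Pos
          \<and> (\<exists>Z. dif (g, Pos) x y Z \<and> smult t (ev (p, t) Z) \<noteq> Neg)"
          using rel'[OF xy] tt[OF t] smult_self[OF t] evt 2 by (simp add: Edp_def)
      qed
      then show ?thesis using t 2 by (simp add: ev_def)
    next
      \<comment> \<open>The program of \<open>f\<close> and \<open>p\<close> replaces that of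
        \<open>p\<close> and \<open>f\<close>; \<open>dif_swap\<close> gives the sign
        \<open>sneg t\<close> between the two heights.\<close>
      case 3
      have ac: "acyc (Edp Pos) (f, t) (p, Pos)" using acyc_p[of "(f, t)" Pos] 3 f t by simp
      have sw: "ev (p, Pos) W = sneg (smult t (Z f))"
        if "(x, y) \<in> R'" "dif (g, Pos) x y Z" "dif (f, t) x y W" for x y Z W
        using dif_swap[OF rel'(1)[OF that(1)] _ _ _ _ _ _ _ _ that(2,3)] rel'(2-5)[OF that(1)] tt[OF t] g f
            t evt 3
        by simp
      obtain W where W: "dif (f, t) X Y W" using dif_ex[OF rel'(1)[OF XY'], of "(f, t)"] t by auto
      have "ev (p, Pos) W = Zero"
      proof (rule acycD[where \<phi> = "\<lambda>x. x" and s = "sneg t", OF ac Edp_sym R' _ _ XY' ne W])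
        show "sneg t \<noteq> Zero" using t by simp
        fix x y assume xy: "(x, y) \<in> R'"
        obtain Z where Z: "dif (g, Pos) x y Z" "Z f \<noteq> Neg" using rel'(6)[OF xy] by blast
        obtain W where W: "dif (f, t) x y W" using dif_ex[OF rel'(1)[OF xy], of "(f, t)"] t by auto
        have "smult (sneg t) (ev (p, Pos) W) = Z f" using sw[OF xy Z(1) W] smult_self[OF t] by simp
        then have "smult (sneg t) (ev (p, Pos) W) \<noteq> Neg" using Z(2) by simp
        then show "comod x y \<and> Edp Pos x y \<and> ev (f, t) x = Pos \<and> ev (f, t) y = Pos
          \<and> (\<exists>Z. dif (f, t) x y Z \<and> smult (sneg t) (ev (p, Pos) Z) \<noteq> Neg)"
          using rel'[OF xy] tt[OF t] evt 3 W by (auto simp: Edp_def)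
      qed
      then show ?thesis using sw[OF XY' Z W] t by simp
    qed
  qed
qed

lemma euclidean: "euclidean_OM E C"
  using om acyclic_euclidean_program acyc_RelU by (auto simp: euclidean_OM_def is_program_def)

end

section \<open>Extension by a coloop\<close>

context extension
begin

text \<open>A coloop \<open>p\<close> can occur as an extension when the localization vanishes. Then
  a single pair of cocircuits is nonzero at \<open>p\<close>, so for \<open>g = p\<close> there is
  no edge, while for any other \<open>g\<close> the vertices and directions vanish at
  \<open>p\<close> and restrict to the old oriented matroid.\<close>

lemma euclidean_coloop:
  assumes eu: "euclidean_OM (E - {p}) D" and Q: "Q \<in> C" "supp Q = {p}"
  shows "euclidean_OM E C"
proof -
  have Qp: "X = Q \<or> X = negv Q" if "X \<in> C" "X p \<noteq> Zero" for X
    using supp_subset_eq[OF Q(1) that(1)] Q(2) that(2) by (auto simp: supp_def)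
  have Qz: "Q h = Zero" if "h \<noteq> p" for h using Q(2) that by (auto simp: supp_def)
  have zero: "X p = Zero" if "X \<in> C" "h \<noteq> p" "X h \<noteq> Zero" for X h
    using Qp[OF that(1)] Qz[OF that(2)] that(3) by (metis negv_apply sneg_eq_iff(1))
  have res: "X(p := Zero) \<in> D" if X: "X \<in> C" "X p = Zero" for X
  proof (rule restrictI[OF X(1)])
    show "\<exists>h. h \<noteq> p \<and> X h \<noteq> Zero" using nonzero_point[OF X(1)] X(2) by metis
    fix Y assume Y: "Y \<in> C" "supp Y - {p} \<subseteq> supp X" "\<exists>h. h \<noteq> p \<and> Y h
        \<noteq> Zero"
    then have "Y p = Zero" using zero by blast
    then show "supp Y \<subseteq> supp X" using Y(2) by (auto simp: supp_def)
  qed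
  have "euclidean_program E C g f" if pr: "is_program E C g f" for g f
  proof -
    have gf: "g \<in> E" "f \<in> E" "f \<noteq> p" using pr Q by (auto simp: is_program_def is_coloop_def)
    show ?thesis
    proof (rule acyclic_euclidean_program[OF _ gf(1)])
      fix X Y Z assume XY: "(X, Y) \<in> cyc (RelU g f)" and Z: "dif (g, Pos) X Y Z"
      have c: "comod X Y" "X g = Pos" "Y g = Pos" using XY by (auto simp: cyc_def RelU_def)
      have gp: "g \<noteq> p"
      proof
        assume "g = p"
        then have "X = Q \<or> X = negv Q" "Y = Q \<or> Y = negv Q" using Qp c by (auto simp: comod_def)
        then show False using c(1) unfolding comod_def by (metis negv_negv)
      qed
      have "acyc (\<lambda>_ _. True) (g, Pos) (f, Pos)"
      proof (rule transfer_acyc[OF eu])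
        show "g \<in> E - {p}" "f \<in> E - {p}" using gf gp by auto
        fix X Y Z assume *: "comod X Y" "X g = Pos" "Y g = Pos" "dif (g, Pos) X Y Z"
        have X: "X \<in> C" "Y \<in> C" using *(1) by (auto simp: comod_def)
        have p0: "X p = Zero" "Y p = Zero" using zero[OF X(1) gp] zero[OF X(2) gp] * by auto
        have Z: "Z \<in> C" "Z p = Zero"
          using dif_in_C[OF *(1,4)] dif_ssum[OF *(4), of p] p0 * by auto
        have "\<sigma> V = Zero" if V: "V \<in> D" for V
        proof -
          obtain h where h: "h \<in> E - {p}" "V h \<noteq> Zero" using old.nonzero_point[OF V] by blast
          then show ?thesis using zero[OF lift[OF V], of h] by simp
        qed
        then show "X(p := Zero) \<in> D \<and> Y(p := Zero) \<in> D \<and> Z(p := Zero) \<in> D \<and>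
          (\<forall>V\<in>D. (z X \<inter> z Y) - {p} \<subseteq> z V \<longrightarrow> p \<in> z X
              \<inter> z Y \<longrightarrow> \<sigma> V = Zero)"
          using res X p0 Z by blast
      qed
      moreover have "RelU g f = RelG (\<lambda>_ _. True) (g, Pos) (f, Pos)" by (simp add: RelU_def RelG_def)
      ultimately have "ev (f, Pos) Z = Zero" using XY Z unfolding acyc_def by metis
      then show "Z f = Zero" by simp
    qed
  qed
  then show ?thesis using om by (simp add: euclidean_OM_def)
qed

end

theorem theorem1p2:
  fixes E :: "'a set" and C C' :: "'a svec set" and es :: "'a list"
    and al :: "sign list" and p :: 'a
  assumes "OM E C"
    and "euclidean_OM E C"
    and "distinct es" and "set es \<subseteq> E"
    and "length al = length es" and "set al \<subseteq> {Pos, Neg}"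
    and "single_elem_ext E C p (lex_sigma es al) C'"
  shows "euclidean_OM (insert p E) C'"
proof -
  have ext: "p \<notin> E" "OM (insert p E) C'" "deletion C' p = C" "\<forall>Y\<in>C. Y(p := lex_sigma es
      al Y) \<in> C'"
    using assms(7) by (auto simp: single_elem_ext_def)
  have Ep: "insert p E - {p} = E" using ext(1) by simp
  interpret extension "insert p E" C' p C "lex_sigma es al"
    using ext assms(1) Ep by unfold_locales auto
  show ?thesis
  proof (cases "\<exists>Q\<in>C'. supp Q = {p}")
    case True
    then show ?thesis using euclidean_coloop assms(2) Ep by auto
  next
    case False
    have nz: "\<exists>h. h \<noteq> p \<and> X h \<noteq> Zero" if X: "X \<in> C'" for X
    proof (rule ccontr)
      assume a: "\<not> ?thesis"
      obtain h where "X h \<noteq> Zero" using nonzero_point[OF X] by blast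
      then have "supp X = {p}" using a by (auto simp: supp_def)
      then show False using False X by blast
    qed
    interpret lex_extension "insert p E" C' p C es al
      using nz assms(2,4-6) ext(1) Ep by unfold_locales auto
    show ?thesis by (rule euclidean)
  qed
qed

end
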